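(* Let $\rho_0=1.26107\cdots$ be the smaller of the two roots of the equation $2e\log(\rho)=\rho$, $\rho>0$. Let $(X_n)_{n\in\mathbb{N}}$ be the sequence of binary trees generated by the BST algorithm with input a sequence of independent random variables uniformly distributed on $(0,1)$, and let $X_\infty$ be the almost sure weak limit of $\mathrm{unif}(X_n)$ as $n\to\infty$, a random probability measure on $\partial\mathbb{V}$. Let $\rho\ge 1$ and let $d_{X_n,\rho}$ and $d_{X_\infty,\rho}$ be the weighted subtree size metrics with weight parameter $\rho$. (a) For $\rho<\rho_0$, the metric space $(\mathbb{V},d_{X_\infty,\rho})$ is compact with probability 1. (b) For $\rho>\rho_0$, the metric space $(\mathbb{V},d_{X_\infty,\rho})$ has infinite diameter with probability 1. (c) For $\rho<\rho_0$, the metric spaces $(X_n,d_{X_n,\rho})$ converge uniformly to $(\mathbb{V},d_{X_\infty,\rho})$ as $n\to\infty$ in the sense of $$\sup_{u,v\in X_n}\bigl|d_{X_n,\rho}(u,v)-d_{X_\infty,\rho}(u,v)\bigr|\to 0\qquad\text{almost surely and in mean}.$$ (d) For $\rho>\rho_0$, and with $d_{X_n,\rho}(\bar u,u):=0$ for $u\notin X_n$ (so that $d_{X_n,\rho}$ is defined on all of $\mathbb{V}\times\mathbb{V}$ by summation along paths), $$\sup_{u,v\in\mathbb{V}}\bigl|d_{X_n,\rho}(u,v)-d_{X_\infty,\rho}(u,v)\bigr|=\infty\qquad\text{with probability 1}.$$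
   Context: Nodes. $\mathbb{V}=\bigsqcup_{k\ge 0}\{0,1\}^k$ is the set of all finite 0--1 sequences (nodes), $\varnothing$ is the empty sequence, $|u|$ is the length of $u$, and $\partial\mathbb{V}=\{0,1\}^\infty$; $\bar{\mathbb{V}}=\mathbb{V}\cup\partial\mathbb{V}$. For $u=(u_1,\dots,u_k)\in\mathbb{V}$ write $u0=(u_1,\dots,u_k,0)$, $u1=(u_1,\dots,u_k,1)$, and, if $k\ge1$, $\bar u=(u_1,\dots,u_{k-1})$ (the parent). Write $u\le v$ if $u$ is a prefix of $v$ ($v\in\bar{\mathbb{V}}$), and $u\wedge v$ for the longest common prefix. For $u\in\mathbb{V}$, $A_u=\{v\in\partial\mathbb{V}: v\ge u\}$. Topology. $\bar{\mathbb{V}}$ is the completion of $\mathbb{V}$ under the metric $d_{\mathbb{V}}(u,v)=2^{-|u\wedge v|}-\frac12(2^{-|u|}+2^{-|v|})$; it is compact, and weak convergence of probability measures refers to $(\bar{\mathbb{V}},d_{\mathbb{V}})$. For a finite nonempty $M\subset\mathbb{V}$, $\mathrm{unif}(M)$ is the uniform distribution on $M$. Binary trees. A binary tree is a prefix-stable set $x\subset\mathbb{V}$ ($u\in x$ and $v\le u$ imply $v\in x$); for $x$ finite and $u\in\mathbb{V}$, $\sigma(x,u)=\#\{v\in x: u\le v\}$. BST algorithm. For pairwise distinct reals $t_1,t_2,\dots$ it produces labeled binary trees $(x_n,L_n)$ with $\#x_n=n$: $x_1=\{\varnothing\}$, $L_1(\varnothing)=t_1$; given $(x_n,L_n)$,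 start at the root $\varnothing$, and at a current node $u\in x_n$ move to $u0$ if $t_{n+1}<L_n(u)$ and to $u1$ otherwise, until a node $u\notin x_n$ is reached; then $x_{n+1}=x_n\cup\{u\}$, $L_{n+1}(u)=t_{n+1}$, $L_{n+1}=L_n$ on $x_n$. With the random input, $X_n$ is the resulting tree $x_n$. Almost surely $\mathrm{unif}(X_n)$ converges weakly to a random probability measure $X_\infty$ concentrated on $\partial\mathbb{V}$; equivalently $X_\infty(A_u)=\lim_{n}\sigma(X_n,u)/n$ for all $u\in\mathbb{V}$, and almost surely $X_\infty(A_u)>0$ for all $u$. Weighted subtree size metrics. A tree metric $d$ on a binary tree (or on $\mathbb{V}$) is specified by its values $d(\bar u,u)$ on edges, $u\ne\varnothing$; the distance $d(u,v)$ of two nodes is the sum of the edge values along the unique path from $u$ to $v$ in the tree in which each $u\neq\varnothing$ is joined to $\bar u$. For $\rho\ge1$ and a finite nonempty binary tree $x$, $d_{x,\rho}$ is the tree metric on $x$ with $d_{x,\rho}(\bar u,u)=\rho^{|u|}\,\sigma(x,u)/\sigma(x,\varnothing)$ for $u\in x$, $u\ne\varnothing$. For a probability measure $\mu$ on $\partial\mathbb{V}$ with $\mu(A_u)>0$ for all $u$, $d_{\mu,\rho}$ is the tree metric on $\mathbb{V}$ with $d_{\mu,\rho}(\bar u,u)=\rho^{|u|}\mu(A_u)$, $u\ne\varnothing$. Convergence in mean of a sequence of real random variables to $0$ means that the expectations of their absolute values tend to $0$.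
   Formalization: In (a), "compact" is replaced by "has compact metric completion": with probability 1 all edge values are positive, so the space of nodes with this metric is infinite and discrete and is never literally compact. *)

theory Defs
  imports
    "HOL-Probability.Probability"
    "HOL-Library.Sublist"
    "HOL-Library.While_Combinator"
begin

section \<open>Nodes, infinite paths and the topology on their union\<close>

text \<open>
  A node is a finite 0-1 sequence; the digits 0 and 1 are \<^term>\<open>False\<close> and \<^term>\<open>True\<close>, the
  parent of \<open>u \<noteq> []\<close> is \<^term>\<open>butlast u\<close>, and the prefix order is \<^const>\<open>prefix\<close>.
\<close>

type_synonym node = "bool list"

datatype xnode = Node node | End "nat \<Rightarrow> bool"

fun xprefix :: "node \<Rightarrow> xnode \<Rightarrow> bool" where
  "xprefix u (Node v) = prefix u v"
| "xprefix u (End s) = (u = map s [0..<length u])"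

definition xmeet :: "xnode \<Rightarrow> xnode \<Rightarrow> xnode" where
  "xmeet x y = (if x = y then x else Node (ARG_MAX length u. xprefix u x \<and> xprefix u y))"

text \<open>\<open>two_pow_neg x\<close> is \<open>2 ^ (- |x|)\<close>, where \<open>|x| = \<infinity>\<close> for infinite sequences.\<close>

fun two_pow_neg :: "xnode \<Rightarrow> real" where
  "two_pow_neg (Node u) = (1 / 2) ^ length u"
| "two_pow_neg (End s) = 0"

lemma xprefix_eq_take:
  assumes "xprefix u x" "xprefix v x" "length u \<le> length v"
  shows "prefix u v"
proof (cases x)
  case (Node w)
  then show ?thesis using assms by (auto intro: prefix_length_prefix)
next
  case (End s)
  then have "u = map s [0..<length u]" "v = map s [0..<length v]" using assms by simp_all
  then have "u = take (length u) v"
    by (metis assms(3) take_map take_upt add_0)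
  then show ?thesis by (metis take_is_prefix)
qed

lemma xprefix_mono:
  assumes "prefix u v" "xprefix v x"
  shows "xprefix u x"
proof (cases x)
  case (Node w)
  then show ?thesis using assms by (auto intro: prefix_order.trans)
next
  case (End s)
  then have "v = map s [0..<length v]" using assms by simp
  moreover have "u = take (length u) v" using assms(1) by (metis append_eq_conv_conj prefixE)
  ultimately have "u = map s [0..<length u]"
    by (metis assms(1) prefix_length_le take_map take_upt add_0)
  then show ?thesis using End by simp
qed

lemma common_prefix_bounded:
  assumes "x \<noteq> y"
  shows "\<exists>b. \<forall>u. xprefix u x \<and> xprefix u y \<longrightarrow> length u \<le> b"
proof -
  have node: "\<exists>b. \<forall>u. xprefix u z \<longrightarrow> length u \<le> b" if "z = Node v" for z v
    using that by (auto intro: prefix_length_le)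
  show ?thesis
  proof (cases "(\<exists>v. x = Node v) \<or> (\<exists>v. y = Node v)")
    case True
    then show ?thesis using node by blast
  next
    case False
    then obtain s t where st: "x = End s" "y = End t" by (metis xnode.exhaust)
    with assms obtain i where i: "s i \<noteq> t i" by auto
    have "length u \<le> i" if "xprefix u x" "xprefix u y" for u
    proof (rule ccontr)
      assume "\<not> length u \<le> i"
      moreover from that st have "map s [0..<length u] = map t [0..<length u]" by simp
      ultimately show False using i by simp
    qed
    then show ?thesis by blast
  qed
qed

lemma xmeet_props:
  assumes "x \<noteq> y"
  obtains w where "xmeet x y = Node w" "xprefix w x" "xprefix w y"
    "\<And>u. xprefix u x \<Longrightarrow> xprefix u y \<Longrightarrow> length u \<le> length w"
proof -
  define P where "P u \<longleftrightarrow> xprefix u x \<and> xprefix u y" for u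
  obtain b where b: "\<And>u. P u \<Longrightarrow> length u \<le> b"
    using common_prefix_bounded[OF assms] unfolding P_def by blast
  have "xprefix [] z" for z by (cases z) auto
  then have "P []" unfolding P_def by simp
  with b have "P (arg_max length P)" "\<And>u. P u \<Longrightarrow> length u \<le> length (arg_max length P)"
    using arg_max_nat_lemma[of P "[]" length "Suc b"] by (auto simp: less_Suc_eq_le)
  moreover have "xmeet x y = Node (arg_max length P)"
    using assms unfolding xmeet_def P_def by simp
  ultimately show thesis using that unfolding P_def by blast
qed

lemma two_pow_neg_xprefix:
  assumes "xprefix w x"
  shows "two_pow_neg x \<le> (1 / 2) ^ length w"
  using assms by (cases x) (auto intro!: power_decreasing prefix_length_le)

lemma two_pow_neg_xmeet: "two_pow_neg x \<le> two_pow_neg (xmeet x y)" "two_pow_neg y \<le> two_pow_neg (xmeet x y)"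
proof -
  have "two_pow_neg x \<le> two_pow_neg (xmeet x y) \<and> two_pow_neg y \<le> two_pow_neg (xmeet x y)"
  proof (cases "x = y")
    case False
    then show ?thesis by (elim xmeet_props) (simp add: two_pow_neg_xprefix)
  qed (simp add: xmeet_def)
  then show "two_pow_neg x \<le> two_pow_neg (xmeet x y)" "two_pow_neg y \<le> two_pow_neg (xmeet x y)"
    by auto
qed

lemma xmeet_commute: "xmeet x y = xmeet y x"
  unfolding xmeet_def by (simp add: conj_commute)

lemma two_pow_neg_xmeet_ultra:
  "two_pow_neg (xmeet x z) \<le> max (two_pow_neg (xmeet x y)) (two_pow_neg (xmeet y z))"
proof -
  consider "x = y" | "y = z" | "x = z" | "x \<noteq> y" "y \<noteq> z" "x \<noteq> z" by blast
  then show ?thesis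
  proof cases
    case 3
    then show ?thesis using two_pow_neg_xmeet(1)[of x y] by (auto simp: xmeet_def)
  next
    case 4
    obtain a where a: "xmeet x y = Node a" "xprefix a x" "xprefix a y"
      by (rule xmeet_props[OF 4(1)])
    obtain b where b: "xmeet y z = Node b" "xprefix b y" "xprefix b z"
      by (rule xmeet_props[OF 4(2)])
    obtain c where c: "xmeet x z = Node c"
      "\<And>u. xprefix u x \<Longrightarrow> xprefix u z \<Longrightarrow> length u \<le> length c"
    proof (rule xmeet_props[OF 4(3)])
      fix w assume "xmeet x z = Node w" "\<And>u. xprefix u x \<Longrightarrow> xprefix u z \<Longrightarrow> length u \<le> length w"
      then show thesis by (rule that)
    qed
    show ?thesis
    proof (cases "length a \<le> length b")
      case True
      then have "prefix a b" using a b xprefix_eq_take by blast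
      then have "length a \<le> length c" using a b c xprefix_mono by blast
      then have "(1 / 2 :: real) ^ length c \<le> (1 / 2) ^ length a" by (intro power_decreasing) auto
      then show ?thesis unfolding a(1) b(1) c(1) two_pow_neg.simps by linarith
    next
      case False
      then have "prefix b a" using a b xprefix_eq_take by (metis nat_le_linear)
      then have "length b \<le> length c" using a b c xprefix_mono by blast
      then have "(1 / 2 :: real) ^ length c \<le> (1 / 2) ^ length b" by (intro power_decreasing) auto
      then show ?thesis unfolding a(1) b(1) c(1) two_pow_neg.simps by linarith
    qed
  qed (auto simp: xmeet_def)
qed

instantiation xnode :: metric_space
begin

definition dist_xnode :: "xnode \<Rightarrow> xnode \<Rightarrow> real" where
  "dist_xnode x y = two_pow_neg (xmeet x y) - (two_pow_neg x + two_pow_neg y) / 2"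

definition uniformity_xnode :: "(xnode \<times> xnode) filter" where
  "uniformity_xnode = (INF e\<in>{0 <..}. principal {(x, y). dist x y < e})"

definition open_xnode :: "xnode set \<Rightarrow> bool" where
  "open_xnode U \<longleftrightarrow> (\<forall>x\<in>U. \<forall>\<^sub>F (x', y) in uniformity. x' = x \<longrightarrow> y \<in> U)"

instance
proof
  show "uniformity = (INF e\<in>{0 <..}. principal {(x :: xnode, y). dist x y < e})"
    by (rule uniformity_xnode_def)
  show "open U \<longleftrightarrow> (\<forall>x\<in>U. \<forall>\<^sub>F (x', y) in uniformity. x' = x \<longrightarrow> y \<in> U)" for U :: "xnode set"
    by (rule open_xnode_def)
  fix x y z :: xnode
  show "dist x y = 0 \<longleftrightarrow> x = y"
  proof
    assume "x = y"
    then show "dist x y = 0" by (simp add: dist_xnode_def xmeet_def)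
  next
    assume d: "dist x y = 0"
    show "x = y"
    proof (rule ccontr)
      assume "x \<noteq> y"
      then obtain w where w: "xmeet x y = Node w" "xprefix w x" "xprefix w y"
        by (rule xmeet_props)
      have pow: "(1 / 2 :: real) ^ m = (1 / 2) ^ n \<longleftrightarrow> m = n" for m n
        by (simp add: power_inject_exp')
      have half: "b = a" "c = a" if "a - (b + c) / 2 = 0" "b \<le> a" "c \<le> a" for a b c :: real
        using that by simp_all
      note eqs = half[OF d[unfolded dist_xnode_def] two_pow_neg_xmeet]
      then have "two_pow_neg x = (1 / 2) ^ length w" "two_pow_neg y = (1 / 2) ^ length w"
        unfolding w(1) two_pow_neg.simps .
      then have "x = Node w" "y = Node w"
        using w(2,3) by (cases x; cases y; auto simp: pow prefix_def)+
      with \<open>x \<noteq> y\<close> show False by simp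
    qed
  qed
  have "a - (p + q) / 2 \<le> b - (p + r) / 2 + (c - (q + r) / 2)"
    if "r \<le> b" "r \<le> c" "a \<le> b \<or> a \<le> c" for a b c p q r :: real
    using that by (auto simp: field_simps)
  moreover have "two_pow_neg (xmeet x y) \<le> two_pow_neg (xmeet x z) \<or>
      two_pow_neg (xmeet x y) \<le> two_pow_neg (xmeet y z)"
    using two_pow_neg_xmeet_ultra[of x y z] by (simp add: xmeet_commute[of y z] le_max_iff_disj)
  ultimately show "dist x y \<le> dist x z + dist y z"
    unfolding dist_xnode_def using two_pow_neg_xmeet(2)[of z] by blast
qed

end

text \<open>Weak convergence of measures on an arbitrary topological space.\<close>

definition weakly_converges ::
    "(nat \<Rightarrow> 'a::topological_space measure) \<Rightarrow> 'a measure \<Rightarrow> bool" where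
  "weakly_converges \<mu> \<nu> \<longleftrightarrow>
     (\<forall>f :: 'a \<Rightarrow> real. continuous_on UNIV f \<and> bounded (range f) \<longrightarrow>
        (\<lambda>n. \<integral>x. f x \<partial>\<mu> n) \<longlonglongrightarrow> (\<integral>x. f x \<partial>\<nu>))"

definition unif_nodes :: "node set \<Rightarrow> xnode measure" where
  "unif_nodes x = distr (measure_pmf (pmf_of_set x)) borel Node"

definition cylinder :: "node \<Rightarrow> xnode set" where
  "cylinder u = {x \<in> range End. xprefix u x}"


section \<open>Binary search trees\<close>

text \<open>A labelled binary tree \<open>(x, L)\<close> is represented by the partial map \<open>L\<close> with domain \<open>x\<close>.\<close>

definition bst_slot :: "(node \<rightharpoonup> real) \<Rightarrow> real \<Rightarrow> node" where
  "bst_slot L t =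
     while (\<lambda>u. u \<in> dom L) (\<lambda>u. if t < the (L u) then u @ [False] else u @ [True]) []"

text \<open>The input is indexed from 0, so \<open>bst t n\<close> has processed the \<open>n\<close> numbers \<open>t 0, \<dots>, t (n - 1)\<close>.\<close>

primrec bst :: "(nat \<Rightarrow> real) \<Rightarrow> nat \<Rightarrow> (node \<rightharpoonup> real)" where
  "bst t 0 = Map.empty"
| "bst t (Suc n) = (bst t n)(bst_slot (bst t n) (t n) \<mapsto> t n)"

definition bst_tree :: "(nat \<Rightarrow> real) \<Rightarrow> nat \<Rightarrow> node set" where
  "bst_tree t n = dom (bst t n)"


section \<open>Weighted subtree size metrics\<close>

text \<open>
  An assignment of edge values is a function \<open>w\<close> on nodes, \<open>w u\<close> being the value of the edge
  joining \<open>u \<noteq> []\<close> to its parent.  The path between \<open>u\<close> and \<open>v\<close> uses exactly those edges that lie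
  above one of \<open>u\<close> and \<open>v\<close> but not above both; see \<open>tree_dist_path\<close> below.
\<close>

definition tree_dist :: "(node \<Rightarrow> real) \<Rightarrow> node \<Rightarrow> node \<Rightarrow> real" where
  "tree_dist w u v = (\<Sum>a | a \<noteq> [] \<and> prefix a u \<noteq> prefix a v. w a)"

definition tree_adj :: "node \<Rightarrow> node \<Rightarrow> bool" where
  "tree_adj u v \<longleftrightarrow> (v \<noteq> [] \<and> butlast v = u) \<or> (u \<noteq> [] \<and> butlast u = v)"

fun path_sum :: "(node \<Rightarrow> real) \<Rightarrow> node list \<Rightarrow> real" where
  "path_sum w (u # v # p) = w (if v \<noteq> [] \<and> butlast v = u then v else u) + path_sum w (v # p)"
| "path_sum w p = 0"

lemma path_enters_subtree:
  assumes "p \<noteq> []" "successively tree_adj p" "\<not> prefix a (hd p)" "prefix a (last p)"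
  shows "a \<in> set p"
  using assms
proof (induction p rule: induct_list012)
  case (3 x y zs)
  show ?case
  proof (cases "prefix a y")
    case True
    have "tree_adj x y" using 3 by simp
    then have "a = y"
      using True 3(5) unfolding tree_adj_def
      by (metis append_butlast_last_id list.sel(1) prefix_order.trans prefix_snoc prefixeq_butlast)
    then show ?thesis by simp
  next
    case False
    then show ?thesis using 3 by auto
  qed
qed auto

lemma path_leaves_subtree:
  assumes "p \<noteq> []" "successively tree_adj p" "prefix a (hd p)" "\<not> prefix a (last p)"
  shows "butlast a \<in> set p"
  using assms
proof (induction p rule: induct_list012)
  case (3 x y zs)
  show ?case
  proof (cases "prefix a y")
    case False
    have "tree_adj x y" using 3 by simp
    then have "a = x \<and> butlast x = y"
      using False 3(5) unfolding tree_adj_def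
      by (metis append_butlast_last_id list.sel(1) prefix_order.trans prefix_snoc prefixeq_butlast)
    then show ?thesis by simp
  next
    case True
    then show ?thesis using 3 by auto
  qed
qed auto

lemma finite_prefixes: "finite {a. prefix a u}"
  by (simp flip: set_prefixes_eq)

lemma finite_path_edges: "finite {a. a \<noteq> [] \<and> prefix a u \<noteq> prefix a v}"
  by (rule finite_subset[of _ "{a. prefix a u} \<union> {a. prefix a v}"])
    (auto simp: finite_prefixes)

lemma tree_dist_path:
  assumes "p \<noteq> []" "distinct p" "successively tree_adj p"
  shows "tree_dist w (hd p) (last p) = path_sum w p"
  using assms
proof (induction p rule: induct_list012)
  case (3 x y zs)
  define l where "l = last (y # zs)"
  have IH: "tree_dist w y l = path_sum w (y # zs)"
    using 3 by (simp add: l_def)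
  have adj: "tree_adj x y" and ds: "x \<notin> set (y # zs)" and succ: "successively tree_adj (y # zs)"
    using 3 by auto
  define c where "c = (if y \<noteq> [] \<and> butlast y = x then y else x)"
  have pre: "(prefix a x \<noteq> prefix a y) \<longleftrightarrow> a = c" if "a \<noteq> []" for a
  proof (cases "y \<noteq> [] \<and> butlast y = x")
    case True
    then obtain b where "y = x @ [b]" by (metis append_butlast_last_id)
    then show ?thesis using True by (auto simp: c_def)
  next
    case False
    then have "x \<noteq> []" "butlast x = y" using adj by (auto simp: tree_adj_def)
    then obtain b where "x = y @ [b]" by (metis append_butlast_last_id)
    then show ?thesis using False by (auto simp: c_def)
  qed
  have c_ne: "c \<noteq> []" using adj by (auto simp: c_def tree_adj_def)
  have c_y: "prefix c y = prefix c l"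
  proof (cases "y \<noteq> [] \<and> butlast y = x")
    case True
    then have c: "c = y" by (simp add: c_def)
    have "prefix y l"
    proof (rule ccontr)
      assume "\<not> prefix y l"
      then have "butlast y \<in> set (y # zs)"
        using path_leaves_subtree[of "y # zs" y] succ by (simp add: l_def)
      with ds True show False by blast
    qed
    then show ?thesis using c by simp
  next
    case False
    then have c: "c = x" unfolding c_def by (rule if_not_P)
    have "\<not> prefix x y" using pre[OF c_ne] c by auto
    then show ?thesis
      using path_enters_subtree[of "y # zs" x] succ ds c by (auto simp: l_def)
  qed
  define S where "S = {a. a \<noteq> [] \<and> prefix a y \<noteq> prefix a l}"
  have "finite S" "c \<notin> S" using finite_path_edges c_y by (simp_all add: S_def)
  moreover have "{a. a \<noteq> [] \<and> prefix a x \<noteq> prefix a l} = insert c S"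
    unfolding S_def using pre c_ne c_y by blast
  ultimately have "tree_dist w x l = w c + tree_dist w y l"
    unfolding tree_dist_def S_def[symmetric] by simp
  then show ?case using IH by (simp add: l_def c_def)
qed (auto simp: tree_dist_def)

definition subtree_size :: "node set \<Rightarrow> node \<Rightarrow> nat" where
  "subtree_size x u = card {v \<in> x. prefix u v}"

definition subtree_dist :: "real \<Rightarrow> node set \<Rightarrow> node \<Rightarrow> node \<Rightarrow> real" where
  "subtree_dist \<rho> x = tree_dist (\<lambda>u. if u \<in> x
     then \<rho> ^ length u * real (subtree_size x u) / real (subtree_size x []) else 0)"

definition limit_dist :: "real \<Rightarrow> xnode measure \<Rightarrow> node \<Rightarrow> node \<Rightarrow> real" where
  "limit_dist \<rho> \<mu> = tree_dist (\<lambda>u. \<rho> ^ length u * measure \<mu> (cylinder u))"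


section \<open>Compactness of the metric completion\<close>

text \<open>
  With positive edge values the nodes form an infinite discrete space, which is never compact
  (\<open>tree_dist_not_compact\<close>).  Calling such a space compact means that adding its limit points
  makes it compact, i.e. that its metric completion is compact.  The completion is unique up to
  isometry and is always realised on a set of real-valued functions on the space, so an
  existential quantifier over metrics on such functions loses nothing.
\<close>

definition is_metric_completion ::
    "'a set \<Rightarrow> ('a \<Rightarrow> 'a \<Rightarrow> real) \<Rightarrow> 'b metric \<Rightarrow> ('a \<Rightarrow> 'b) \<Rightarrow> bool" where
  "is_metric_completion M d m \<iota> \<longleftrightarrow>
     Metric_space M d \<and> mcomplete_of m \<and> \<iota> \<in> M \<rightarrow> mspace m \<and>
     (\<forall>x\<in>M. \<forall>y\<in>M. mdist m (\<iota> x) (\<iota> y) = d x y) \<and>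
     mtopology_of m closure_of (\<iota> ` M) = mspace m"

definition compact_completion :: "'a set \<Rightarrow> ('a \<Rightarrow> 'a \<Rightarrow> real) \<Rightarrow> bool" where
  "compact_completion M d \<longleftrightarrow>
     (\<exists>(m :: ('a \<Rightarrow> real) metric) \<iota>. is_metric_completion M d m \<iota> \<and> compact_space (mtopology_of m))"

lemma is_metric_completion_exists:
  fixes M :: "'a set"
  assumes "Metric_space M d"
  shows "\<exists>(m :: ('a \<Rightarrow> real) metric) \<iota>. is_metric_completion M d m \<iota>"
  using Metric_space.metric_completion[OF assms] assms unfolding is_metric_completion_def
  by metis

lemma tree_dist_not_compact:
  assumes pos: "\<And>u. u \<noteq> [] \<Longrightarrow> w u > 0" and ms: "Metric_space UNIV (tree_dist w)"
  shows "\<not> compact_space (Metric_space.mtopology UNIV (tree_dist w))"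
proof
  interpret Metric_space UNIV "tree_dist w" by (rule ms)
  assume "compact_space mtopology"
  have sing: "openin mtopology {u}" for u
  proof -
    define E where "E = (insert (u @ [False]) (insert (u @ [True]) (if u = [] then {} else {u})))"
    have E: "finite E" "E \<noteq> {}" "\<And>a. a \<in> E \<Longrightarrow> a \<noteq> []"
      by (auto simp: E_def split: if_splits)
    define r where "r = Min (w ` E)"
    have r: "r > 0" "\<And>a. a \<in> E \<Longrightarrow> r \<le> w a"
      using E pos by (auto simp: r_def)
    have far: "r \<le> tree_dist w u v" if "v \<noteq> u" for v
    proof -
      have "\<exists>a\<in>E. prefix a u \<noteq> prefix a v"
      proof (cases "prefix u v")
        case True
        then obtain y where y: "v = u @ y" by (rule prefixE)
        with that obtain b z where "y = b # z" by (cases y) auto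
        with y have "v = u @ b # z" by simp
        then have "prefix (u @ [b]) v" "\<not> prefix (u @ [b]) u" by auto
        moreover have "u @ [b] \<in> E" by (cases b) (auto simp: E_def)
        ultimately show ?thesis by blast
      next
        case False
        then have "u \<noteq> []" by auto
        then have "u \<in> E" by (simp add: E_def)
        then show ?thesis using False by blast
      qed
      then obtain a where a: "a \<in> E" "prefix a u \<noteq> prefix a v" by blast
      then have "w a \<le> tree_dist w u v"
        unfolding tree_dist_def using E(3) pos
        by (intro member_le_sum finite_path_edges) (auto intro: less_imp_le)
      then show ?thesis using r(2)[OF a(1)] by simp
    qed
    have "mball u r = {u}"
      using far r(1) by (fastforce simp: in_mball)
    then show ?thesis using openin_mball by metis
  qed
  then have "mtopology = discrete_topology UNIV"
    using discrete_topology_unique[of UNIV mtopology] by auto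
  then have "finite (UNIV :: node set)"
    using \<open>compact_space mtopology\<close> compact_space_discrete_topology by metis
  then show False using infinite_UNIV_listI by blast
qed


section \<open>The critical weight\<close>

text \<open>The function \<open>2 * exp 1 * ln r - r\<close> is strictly concave with exactly two zeros.\<close>

definition rho0 :: real where
  "rho0 = (LEAST r. r > 0 \<and> 2 * exp 1 * ln r = r)"

end

theory Submission
  imports Defs
begin

text \<open>
  The first input value \<open>v\<close> cuts the unit interval into two parts, and the later values falling into
  the two parts are, after rescaling, two independent copies of the whole input. Iterating this, the
  node \<open>u\<close> receives an interval of random length \<open>Lam u\<close>; the lengths form a multiplicative
  cascade with uniform splits, and by the law of large numbers they are the limits of the relative
  subtree sizes, hence the masses \<open>X\<^sub>\<infinity>(A\<^sub>u)\<close>.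

  Since the \<open>s\<close>-th powers of the lengths at level \<open>k\<close> have total mean \<open>(2 / (1 + s)) ^ k\<close>, the
  weighted maxima over the levels are summable in mean below \<open>rho0\<close> (take \<open>s = 1 / ln r - 1\<close>). For
  the trees themselves, Chernoff bounds over dyadic intervals show that at every time a node
  of depth \<open>l\<close> has relative size at most a multiple of \<open>l\<close> times the length of an ancestor's
  interval; domination then gives the convergence almost surely and in mean. Above \<open>rho0\<close>, the
  probability that \<open>r ^ |u| * Lam u\<close> ever reaches a level \<open>c\<close> satisfies a
  supercritical recursion in \<open>c\<close> and so does not tend to 0; by the self-similarity these values are
  unbounded with probability 0 or 1.
\<close>

section \<open>Splitting a uniform sequence at its first value\<close>

text \<open>Convergence at a single node is easy; the obstacle is uniformity over all nodes and
  times. At a time \<open>n\<close> far below \<open>1 / Lam u\<close> an occupied node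
  \<open>u\<close> already has relative size at least \<open>1 / n\<close>, so its size cannot be
  compared with its own interval. It is compared with that of an ancestor at depth about
  \<open>\<theta> * l\<close>: the path down to \<open>u\<close> puts a number of values
  proportional to \<open>l\<close> into the ancestor's interval, which outside a rare event forces
  \<open>n\<close> to exceed the order of the inverse length. Room between \<open>\<rho>\<close> and
  \<open>r < rho0\<close> pays for passing from \<open>l\<close> to \<open>\<theta> * l\<close>. The
  exponent \<open>1 / ln r - 1\<close> minimises \<open>2 * r powr s / (1 + s)\<close>, with minimum
  \<open>2 * exp 1 * ln r / r\<close>; this ratio is below 1 for \<open>r < rho0\<close>, which is
  where the equation for \<open>rho0\<close> comes from. For \<open>rho0 < r \<le> exp 1\<close> it
  exceeds 1 and governs the growth of the expected number of \<open>u\<close> at a level with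
  \<open>r ^ length u * Lam u \<ge> 1\<close>. A large mean alone gives no existence;
  inclusion-exclusion for the two independent halves loses only a term quadratic in the probability
  of success, which is harmless while that probability is small.\<close>

definition U01 :: "real measure" where
  "U01 = uniform_measure lborel {0<..<1}"

interpretation U01: prob_space U01
  unfolding U01_def by (rule prob_space_uniform_measure) simp_all

lemma sets_U01 [simp, measurable_cong]: "sets U01 = sets borel"
  by (simp add: U01_def)

lemma space_U01 [simp]: "space U01 = UNIV"
  by (simp add: U01_def)

abbreviation S01 :: "real stream measure" where
  "S01 \<equiv> stream_space U01"

interpretation S01: prob_space S01
  by (rule U01.prob_space_stream_space)

lemma space_S01 [simp]: "space S01 = UNIV"
  by (simp add: space_stream_space)

lemma sets_S01 [simp, measurable_cong]: "sets S01 = sets (stream_space borel)"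
  by (rule sets_stream_space_cong) simp

text \<open>Unlike \<^const>\<open>sfilter\<close>, this selection is measurable also where the selected
  subsequence is finite; there it continues with junk.\<close>

primcorec sel :: "('a \<Rightarrow> bool) \<Rightarrow> 'a stream \<Rightarrow> 'a stream" where
  "shd (sel P s) = s !! (LEAST n. P (s !! n))"
| "stl (sel P s) = sel P (sdrop (Suc (LEAST n. P (s !! n))) s)"

lemma sel_Stream_hit:
  assumes "P x"
  shows "sel P (x ## s) = x ## sel P s"
proof -
  have "(LEAST n. P ((x ## s) !! n)) = 0"
    using assms by (intro Least_equality) auto
  then show ?thesis by (subst sel.ctr) simp
qed

lemma sel_Stream_miss:
  assumes "\<not> P x" "P (s !! n)"
  shows "sel P (x ## s) = sel P s"
proof -
  have "(LEAST n. P ((x ## s) !! n)) = Suc (LEAST n. P (s !! n))"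
    using Least_Suc[of "\<lambda>n. P ((x ## s) !! n)" "Suc n"] assms by simp
  then show ?thesis by (subst (1 2) sel.ctr) simp
qed

text \<open>Only as many terms of \<open>sel P s\<close> are read as \<open>P\<close> selects from
  the first \<open>n\<close> values, so its junk never becomes visible.\<close>

lemma filter_stake: "filter P (stake n s) = stake (length (filter P (stake n s))) (sel P s)"
proof (induction n arbitrary: s)
  case (Suc n)
  obtain x s' where s: "s = x ## s'" by (cases s)
  show ?case
  proof (cases "P x")
    case True
    then show ?thesis using Suc[of s'] by (simp add: s sel_Stream_hit)
  next
    case miss: False
    show ?thesis
    proof (cases "\<exists>i. P (s' !! i)")
      case True
      then show ?thesis using Suc[of s'] miss by (auto simp: s sel_Stream_miss)
    next
      case False
      then have "filter P (stake n s') = []"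
        by (auto simp: filter_empty_conv in_set_conv_nth)
      then show ?thesis using miss by (simp add: s)
    qed
  qed
qed simp

text \<open>The predicate depends on \<open>x\<close> because the pivot that splits the sequence is
  itself random. The coinduction runs over all functions of the form
  \<open>\<lambda>x. sel (P x) (g x)\<close>, a class closed under taking tails.\<close>

lemma measurable_sel [measurable (raw)]:
  fixes g :: "'a \<Rightarrow> 'b::topological_space stream"
  assumes P: "Measurable.pred (N \<Otimes>\<^sub>M borel) (\<lambda>(x, y). P x y)"
    and g: "g \<in> measurable N (stream_space borel)"
  shows "(\<lambda>x. sel (P x) (g x)) \<in> measurable N (stream_space borel)"
proof -
  define F where "F f \<longleftrightarrow> (\<exists>g\<in>measurable N (stream_space borel). f = (\<lambda>x. sel (P x) (g x)))" for f
  have pred: "Measurable.pred N (\<lambda>x. P x (g x !! i))" if [measurable]: "g \<in> measurable N (stream_space borel)" for g i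
  proof -
    have "(\<lambda>x. (x, g x !! i)) \<in> measurable N (N \<Otimes>\<^sub>M borel)" by measurable
    from measurable_compose[OF this P] show ?thesis by simp
  qed
  have least: "(\<lambda>x. LEAST i. P x (g x !! i)) \<in> measurable N (count_space UNIV)"
    if "g \<in> measurable N (stream_space borel)" for g
    using pred[OF that] by measurable
  have "F (\<lambda>x. sel (P x) (g x))" using g by (auto simp: F_def)
  then show ?thesis
  proof (rule measurable_stream_coinduct[where F = F and f = "\<lambda>x. sel (P x) (g x)"])
    fix f :: "'a \<Rightarrow> 'b stream" assume "F f"
    then obtain g where g[measurable]: "g \<in> measurable N (stream_space borel)"
      and f: "f = (\<lambda>x. sel (P x) (g x))" unfolding F_def by blast
    have "(\<lambda>x. g x !! (LEAST i. P x (g x !! i))) \<in> borel_measurable N"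
    proof (rule measurable_compose_countable[where f = "\<lambda>i x. g x !! i" and g = "\<lambda>x. LEAST i. P x (g x !! i)"])
      show "(\<lambda>x. g x !! i) \<in> borel_measurable N" for i
        by (rule measurable_compose[OF g measurable_snth])
    qed (rule least[OF g])
    then show "(\<lambda>x. shd (f x)) \<in> borel_measurable N"
      by (simp add: f)
  next
    fix f :: "'a \<Rightarrow> 'b stream" assume "F f"
    then obtain g where g[measurable]: "g \<in> measurable N (stream_space borel)"
      and f: "f = (\<lambda>x. sel (P x) (g x))" unfolding F_def by blast
    have "(\<lambda>x. sdrop (Suc (LEAST i. P x (g x !! i))) (g x)) \<in> measurable N (stream_space borel)"
    proof (rule measurable_compose_countable[where f = "\<lambda>i x. sdrop (Suc i) (g x)" and g = "\<lambda>x. LEAST i. P x (g x !! i)"])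
      show "(\<lambda>x. sdrop (Suc i) (g x)) \<in> measurable N (stream_space borel)" for i
        by (rule measurable_compose[OF g measurable_sdrop])
    qed (rule least[OF g])
    then show "F (\<lambda>x. stl (f x))" unfolding f sel.simps F_def
      by (intro bexI[where x = "\<lambda>x. sdrop (Suc (LEAST i. P x (g x !! i))) (g x)"] refl)
  qed
qed

text \<open>Together with \<open>width\<close>: the map from \<open>x\<close> to
  \<open>off b v + width b v * x\<close> carries the unit interval onto the part to the right
  (\<open>True\<close>) or left (\<open>False\<close>) of the pivot \<open>v\<close>.\<close>

definition off :: "bool \<Rightarrow> real \<Rightarrow> real" where
  "off b v = (if b then v else 0)"

definition width :: "bool \<Rightarrow> real \<Rightarrow> real" where
  "width b v = (if b then 1 - v else v)"

text \<open>Rescaling makes the selected values uniform on the unit interval again. Ties go to the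
  right, as in \<open>bst_slot\<close>.\<close>

definition child :: "bool \<Rightarrow> real \<Rightarrow> real stream \<Rightarrow> real stream" where
  "child b v s = smap (\<lambda>x. (x - off b v) / width b v) (sel (\<lambda>x. v \<le> x \<longleftrightarrow> b) s)"

lemma measurable_off [measurable]: "off b \<in> borel_measurable borel"
  unfolding off_def[abs_def] by (cases b) simp_all

lemma measurable_width [measurable]: "width b \<in> borel_measurable borel"
  unfolding width_def[abs_def] by (cases b) simp_all

lemma measurable_child [measurable (raw)]:
  assumes [measurable]: "f \<in> borel_measurable N" "g \<in> measurable N (stream_space borel)"
  shows "(\<lambda>x. child b (f x) (g x)) \<in> measurable N (stream_space borel)"
proof (rule measurable_stream_space2)
  fix n
  have [measurable]: "(\<lambda>x. sel (\<lambda>y. f x \<le> y \<longleftrightarrow> b) (g x)) \<in> measurable N (stream_space borel)"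
    by (rule measurable_sel) measurable
  show "(\<lambda>x. child b (f x) (g x) !! n) \<in> borel_measurable N"
    unfolding child_def by simp
qed

lemma emeasure_U01_side:
  assumes v: "0 < v" "v < 1" and A[measurable]: "A \<in> sets borel"
  shows "emeasure U01 {x. (v \<le> x \<longleftrightarrow> b) \<and> (x - off b v) / width b v \<in> A} = ennreal (width b v) * emeasure U01 A"
proof -
  let ?B = "{x. (v \<le> x \<longleftrightarrow> b) \<and> (x - off b v) / width b v \<in> A}"
  have w: "width b v > 0" using v by (auto simp: width_def)
  have [measurable]: "?B \<in> sets borel" by measurable
  have e: "emeasure U01 X = (\<integral>\<^sup>+x. indicator {0<..<1} x * indicator X x \<partial>lborel)"
    if "X \<in> sets borel" for X
    using that by (simp flip: indicator_inter_arith add: divide_ennreal_def U01_def)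
  have "emeasure U01 ?B = (\<integral>\<^sup>+x. indicator {0<..<1} x * indicator ?B x \<partial>lborel)"
    by (rule e) simp
  also have "\<dots> = ennreal (width b v) * (\<integral>\<^sup>+x. indicator {0<..<1} (off b v + width b v * x) *
      indicator ?B (off b v + width b v * x) \<partial>lborel)"
    using w by (subst nn_integral_real_affine[where c = "width b v" and t = "off b v"]) auto
  also have "(\<integral>\<^sup>+x. indicator {0<..<1} (off b v + width b v * x) *
      indicator ?B (off b v + width b v * x) \<partial>lborel) = (\<integral>\<^sup>+x. indicator {0<..<1} x * indicator A x \<partial>lborel)"
  \<comment> \<open>The point \<open>x = 0\<close> corresponds to the pivot itself, which belongs to
    the right side although 0 is not in the open unit interval.\<close>
  proof (rule nn_integral_cong_AE, use AE_lborel_singleton[of 0] in eventually_elim)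
    case (elim x)
    have "(0 < off b v + width b v * x \<and> off b v + width b v * x < 1 \<and> (v \<le> off b v + width b v * x \<longleftrightarrow> b))
        \<longleftrightarrow> 0 < x \<and> x < 1"
    proof (cases b)
      case True
      have "v + (1 - v) * x < 1 \<longleftrightarrow> (1 - v) * x < (1 - v) * 1" by (simp add: algebra_simps)
      also have "\<dots> \<longleftrightarrow> x < 1" using v by (subst mult_less_cancel_left_pos) auto
      finally have "v + (1 - v) * x < 1 \<longleftrightarrow> x < 1" .
      moreover have "v \<le> v + (1 - v) * x \<longleftrightarrow> 0 < x"
        using v elim by (auto simp: zero_le_mult_iff)
      moreover have "0 < x \<Longrightarrow> 0 < v + (1 - v) * x" using v by (simp add: add_pos_pos)
      ultimately show ?thesis using True by (auto simp: off_def width_def)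
    next
      case False
      have "v * x < v \<longleftrightarrow> x < 1" using v mult_less_cancel_left_pos[of v x 1] by simp
      moreover have "v * x < v \<Longrightarrow> v * x < 1" using v by linarith
      ultimately show ?thesis using False v by (auto simp: off_def width_def zero_less_mult_iff)
    qed
    then show ?case using w by (auto split: split_indicator simp: indicator_def)
  qed
  also have "\<dots> = emeasure U01 A" by (rule e[symmetric]) simp
  finally show ?thesis .
qed

lemma AE_U01: "AE v in U01. 0 < v \<and> v < 1"
  unfolding U01_def by (rule AE_uniform_measureI) auto

text \<open>Conditioning on the first value, the probability \<open>x\<close> of never hitting
  satisfies \<open>x = x * (1 - width b v)\<close>, and \<open>width b v > 0\<close> forces
  \<open>x = 0\<close>. This is what keeps the junk of \<open>sel\<close> out of the probabilistic
  arguments.\<close>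

lemma AE_S01_hit:
  assumes v: "0 < v" "v < 1"
  shows "AE s in S01. \<exists>n. v \<le> s !! n \<longleftrightarrow> b"
proof -
  define x where "x = \<P>(s in S01. \<forall>n. \<not> (v \<le> s !! n \<longleftrightarrow> b))"
  have side: "measure U01 {x. v \<le> x \<longleftrightarrow> b} = width b v"
  proof -
    have "ennreal (measure U01 {x. v \<le> x \<longleftrightarrow> b}) = ennreal (width b v)"
      using emeasure_U01_side[OF v, of UNIV b] U01.emeasure_space_1
      by (simp add: U01.emeasure_eq_measure)
    then show ?thesis using v by (subst (asm) ennreal_inj) (auto simp: width_def)
  qed
  have "ennreal x = (\<integral>\<^sup>+t. \<P>(s in S01. \<forall>n. \<not> (v \<le> (t ## s) !! n \<longleftrightarrow> b)) \<partial>U01)"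
    unfolding x_def by (rule U01.prob_stream_space, measurable)
  also have "\<dots> = (\<integral>\<^sup>+t. ennreal x * indicator {t. \<not> (v \<le> t \<longleftrightarrow> b)} t \<partial>U01)"
  proof (rule nn_integral_cong)
    fix t
    have all: "(\<forall>n. \<not> (v \<le> (t ## s) !! n \<longleftrightarrow> b)) \<longleftrightarrow> \<not> (v \<le> t \<longleftrightarrow> b) \<and> (\<forall>n. \<not> (v \<le> s !! n \<longleftrightarrow> b))" for s
      by (auto simp: Stream_snth split: nat.splits)
    show "ennreal \<P>(s in S01. \<forall>n. \<not> (v \<le> (t ## s) !! n \<longleftrightarrow> b)) = ennreal x * indicator {t. \<not> (v \<le> t \<longleftrightarrow> b)} t"
      unfolding all by (auto simp: x_def indicator_def)
  qed
  also have "\<dots> = ennreal x * ennreal (measure U01 {t. \<not> (v \<le> t \<longleftrightarrow> b)})"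
    by (subst nn_integral_cmult_indicator) (auto simp: U01.emeasure_eq_measure)
  also have "measure U01 {t. \<not> (v \<le> t \<longleftrightarrow> b)} = 1 - width b v"
  proof -
    have "{t. \<not> (v \<le> t \<longleftrightarrow> b)} = space U01 - {x. v \<le> x \<longleftrightarrow> b}" by auto
    then show ?thesis using U01.prob_compl[of "{x. v \<le> x \<longleftrightarrow> b}"] side by simp
  qed
  finally have "ennreal x = ennreal (x * (1 - width b v))"
    using v by (subst ennreal_mult) (auto simp: x_def width_def)
  then have "x = x * (1 - width b v)"
    using v by (subst (asm) ennreal_inj) (auto simp: x_def width_def)
  then have "x = 0" using v by (auto simp: width_def algebra_simps split: if_splits)
  then have "AE s in S01. \<not> (\<forall>n. \<not> (v \<le> s !! n \<longleftrightarrow> b))"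
    unfolding x_def
  proof (subst S01.prob_Collect_eq_0[symmetric])
    show "{s \<in> space S01. \<forall>n. \<not> (v \<le> s !! n \<longleftrightarrow> b)} \<in> sets S01" by measurable
  qed
  then show ?thesis by simp
qed

lemma child_Stream_hit:
  "(v \<le> x \<longleftrightarrow> b) \<Longrightarrow> child b v (x ## s) = ((x - off b v) / width b v) ## child b v s"
  by (simp add: child_def sel_Stream_hit)

lemma child_Stream_miss:
  "\<not> (v \<le> x \<longleftrightarrow> b) \<Longrightarrow> \<exists>n. v \<le> s !! n \<longleftrightarrow> b \<Longrightarrow> child b v (x ## s) = child b v s"
  by (auto simp: child_def sel_Stream_miss)

section \<open>Joint law of the two rescaled subsequences\<close>

abbreviation cyl :: "real set list \<Rightarrow> real stream set" where
  "cyl \<equiv> scylinder UNIV"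

lemma sets_cyl: "As \<in> lists (sets borel) \<Longrightarrow> cyl As \<in> sets (stream_space borel)"
  using sets_scylinder[of As borel] by auto

lemma measure_cyl:
  assumes "As \<in> lists (sets borel)"
  shows "measure S01 (cyl As) = (\<Prod>A\<leftarrow>As. measure U01 A)"
  using assms
proof (induction As)
  case Nil
  then show ?case using S01.prob_space by simp
next
  case (Cons A As)
  have [measurable]: "A \<in> sets borel" "cyl As \<in> sets (stream_space borel)"
    using Cons.hyps by (auto intro!: sets_cyl)
  have eq: "cyl (A # As) = {s \<in> space S01. shd s \<in> A \<and> stl s \<in> cyl As}" by simp
  have "ennreal (measure S01 (cyl (A # As))) =
      (\<integral>\<^sup>+t. ennreal \<P>(s in S01. shd (t ## s) \<in> A \<and> stl (t ## s) \<in> cyl As) \<partial>U01)"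
    unfolding eq by (rule U01.prob_stream_space) measurable
  also have "\<dots> = (\<integral>\<^sup>+t. ennreal (measure S01 (cyl As)) * indicator A t \<partial>U01)"
    by (intro nn_integral_cong) (auto simp: indicator_def)
  also have "\<dots> = ennreal (measure S01 (cyl As)) * ennreal (measure U01 A)"
    by (subst nn_integral_cmult_indicator) (auto simp: U01.emeasure_eq_measure)
  finally have "measure S01 (cyl (A # As)) = measure S01 (cyl As) * measure U01 A"
    by (simp flip: ennreal_mult)
  then show ?case using Cons by simp
qed

definition split_prob :: "real \<Rightarrow> real set list \<Rightarrow> real set list \<Rightarrow> real" where
  "split_prob v As Bs = \<P>(s in S01. child False v s \<in> cyl As \<and> child True v s \<in> cyl Bs)"

text \<open>Condition on the first value: with probability \<open>v\<close> it goes left and has to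
  satisfy the head of \<open>As\<close>, with probability \<open>1 - v\<close> it goes right and has
  to satisfy the head of \<open>Bs\<close>. An exhausted list imposes nothing, so the same
  probability reappears on the right-hand side.\<close>

lemma split_prob_step:
  assumes v: "0 < v" "v < 1" and AB: "As \<in> lists (sets borel)" "Bs \<in> lists (sets borel)"
  shows "split_prob v As Bs =
    (case As of [] \<Rightarrow> v * split_prob v As Bs | A # As' \<Rightarrow> v * measure U01 A * split_prob v As' Bs) +
    (case Bs of [] \<Rightarrow> (1 - v) * split_prob v As Bs | B # Bs' \<Rightarrow> (1 - v) * measure U01 B * split_prob v As Bs')"
proof -
  \<comment> \<open>\<open>h\<close> is the constraint on the next rescaled value, trivial for an
    exhausted list; \<open>D\<close> is the same constraint before rescaling.\<close>
  define h where "h b Xs = (case Xs of [] \<Rightarrow> UNIV | X # _ \<Rightarrow> X)" for b :: bool and Xs :: "real set list"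
  define D where "D b Xs = {x. (v \<le> x \<longleftrightarrow> b) \<and> (x - off b v) / width b v \<in> h b Xs}" for b Xs
  have t_cyl: "x ## s \<in> cyl Xs \<longleftrightarrow> x \<in> h b Xs \<and> s \<in> cyl (tl Xs)" for b x s Xs
    by (cases Xs) (auto simp: h_def)
  have h[measurable]: "h b Xs \<in> sets borel" if "Xs \<in> lists (sets borel)" for b Xs
    using that by (cases Xs) (auto simp: h_def)
  have D[measurable]: "D b Xs \<in> sets borel" if "Xs \<in> lists (sets borel)" for b Xs
    using h[OF that] unfolding D_def by measurable
  have D_prob: "emeasure U01 (D b Xs) = ennreal (width b v * measure U01 (h b Xs))"
    if "Xs \<in> lists (sets borel)" for b Xs
    unfolding D_def using emeasure_U01_side[OF v h[OF that]] v
    by (simp add: U01.emeasure_eq_measure ennreal_mult width_def)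
  have tlAB: "tl As \<in> lists (sets borel)" "tl Bs \<in> lists (sets borel)"
    using AB by (metis lists.simps list.sel(2,3))+
  have m[measurable]: "cyl As \<in> sets (stream_space borel)" "cyl Bs \<in> sets (stream_space borel)"
    "cyl (tl As) \<in> sets (stream_space borel)" "cyl (tl Bs) \<in> sets (stream_space borel)"
    using AB tlAB by (auto intro!: sets_cyl)
  note D[OF AB(1), measurable] D[OF AB(2), measurable]
  have "ennreal (split_prob v As Bs) =
    (\<integral>\<^sup>+x. \<P>(s in S01. child False v (x ## s) \<in> cyl As \<and> child True v (x ## s) \<in> cyl Bs) \<partial>U01)"
    unfolding split_prob_def by (rule U01.prob_stream_space) measurable
  also have "\<dots> = (\<integral>\<^sup>+x. ennreal (split_prob v (tl As) Bs) * indicator (D False As) x +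
      ennreal (split_prob v As (tl Bs)) * indicator (D True Bs) x \<partial>U01)"
  proof (rule nn_integral_cong)
    fix x
    show "ennreal \<P>(s in S01. child False v (x ## s) \<in> cyl As \<and> child True v (x ## s) \<in> cyl Bs) =
      ennreal (split_prob v (tl As) Bs) * indicator (D False As) x +
      ennreal (split_prob v As (tl Bs)) * indicator (D True Bs) x"
    proof (cases "v \<le> x")
      case False
      have "\<P>(s in S01. child False v (x ## s) \<in> cyl As \<and> child True v (x ## s) \<in> cyl Bs) =
        \<P>(s in S01. x \<in> D False As \<and> child False v s \<in> cyl (tl As) \<and> child True v s \<in> cyl Bs)"
      proof (rule S01.finite_measure_eq_AE)
        show "AE s in S01. s \<in> {s \<in> space S01. child False v (x ## s) \<in> cyl As \<and> child True v (x ## s) \<in> cyl Bs} \<longleftrightarrow>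
          s \<in> {s \<in> space S01. x \<in> D False As \<and> child False v s \<in> cyl (tl As) \<and> child True v s \<in> cyl Bs}"
          using AE_S01_hit[OF v, of True]
          by eventually_elim (use False in \<open>auto simp: child_Stream_hit child_Stream_miss t_cyl[of _ _ _ False] D_def\<close>)
      qed measurable
      moreover have "x \<notin> D True Bs" using False by (simp add: D_def)
      ultimately show ?thesis by (auto simp: split_prob_def indicator_def)
    next
      case True
      have "\<P>(s in S01. child False v (x ## s) \<in> cyl As \<and> child True v (x ## s) \<in> cyl Bs) =
        \<P>(s in S01. x \<in> D True Bs \<and> child False v s \<in> cyl As \<and> child True v s \<in> cyl (tl Bs))"
      proof (rule S01.finite_measure_eq_AE)
        show "AE s in S01. s \<in> {s \<in> space S01. child False v (x ## s) \<in> cyl As \<and> child True v (x ## s) \<in> cyl Bs} \<longleftrightarrow>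
          s \<in> {s \<in> space S01. x \<in> D True Bs \<and> child False v s \<in> cyl As \<and> child True v s \<in> cyl (tl Bs)}"
          using AE_S01_hit[OF v, of False]
          by eventually_elim (use True in \<open>auto simp: child_Stream_hit child_Stream_miss t_cyl[of _ _ _ True] D_def\<close>)
      qed measurable
      moreover have "x \<notin> D False As" using True by (simp add: D_def)
      ultimately show ?thesis by (auto simp: split_prob_def indicator_def)
    qed
  qed
  also have "\<dots> = ennreal (split_prob v (tl As) Bs) * ennreal (v * measure U01 (h False As)) +
      ennreal (split_prob v As (tl Bs)) * ennreal ((1 - v) * measure U01 (h True Bs))"
    using AB by (subst nn_integral_add) (auto simp: nn_integral_cmult_indicator D_prob width_def)
  also have "\<dots> = ennreal (split_prob v (tl As) Bs * (v * measure U01 (h False As)) +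
      split_prob v As (tl Bs) * ((1 - v) * measure U01 (h True Bs)))"
    using v by (simp add: split_prob_def ennreal_mult ennreal_plus)
  finally have "split_prob v As Bs = split_prob v (tl As) Bs * (v * measure U01 (h False As)) +
      split_prob v As (tl Bs) * ((1 - v) * measure U01 (h True Bs))"
    using v by (subst (asm) ennreal_inj) (auto simp: split_prob_def)
  then show ?thesis
    using U01.prob_space by (auto simp: h_def split: list.splits)
qed

text \<open>When one list is empty, the recursion mentions the unknown itself with a weight in
  (0,1); it is solved for it. All other terms concern shorter lists.\<close>

lemma split_prob_eq:
  assumes v: "0 < v" "v < 1" and "As \<in> lists (sets borel)" "Bs \<in> lists (sets borel)"
  shows "split_prob v As Bs = measure S01 (cyl As) * measure S01 (cyl Bs)"
  using assms(3,4)
proof (induction "length As + length Bs" arbitrary: As Bs rule: less_induct)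
  case less
  note step = split_prob_step[OF v less.prems]
  have cyl: "measure S01 (cyl (A # As)) = measure U01 A * measure S01 (cyl As)"
    if "A # As \<in> lists (sets borel)" for A As
    using that by (simp add: measure_cyl del: scylinder.simps)
  have one: "measure S01 (cyl []) = 1" using S01.prob_space by simp
  consider "As = []" "Bs = []" | A As' where "As = A # As'" "Bs = []"
    | B Bs' where "As = []" "Bs = B # Bs'" | A As' B Bs' where "As = A # As'" "Bs = B # Bs'"
    by (cases As; cases Bs) auto
  then show ?case
  proof cases
    case 1
    then show ?thesis using S01.prob_space by (simp add: split_prob_def)
  next
    case 2
    have "split_prob v As' Bs = measure S01 (cyl As') * measure S01 (cyl Bs)"
      using less.prems 2 by (intro less.hyps) auto
    then have "v * split_prob v As Bs = v * (measure S01 (cyl As) * measure S01 (cyl Bs))"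
      using step less.prems cyl[of A As'] unfolding 2 by (simp add: algebra_simps)
    then show ?thesis using v by simp
  next
    case 3
    have "split_prob v As Bs' = measure S01 (cyl As) * measure S01 (cyl Bs')"
      using less.prems 3 by (intro less.hyps) auto
    then have "(1 - v) * split_prob v As Bs = (1 - v) * (measure S01 (cyl As) * measure S01 (cyl Bs))"
      using step less.prems cyl[of B Bs'] unfolding 3 by (simp add: algebra_simps)
    then show ?thesis using v by simp
  next
    case 4
    have "split_prob v As' Bs = measure S01 (cyl As') * measure S01 (cyl Bs)"
      using less.prems 4 by (intro less.hyps) auto
    moreover have "split_prob v As Bs' = measure S01 (cyl As) * measure S01 (cyl Bs')"
      using less.prems 4 by (intro less.hyps) auto
    ultimately show ?thesis
      using step less.prems cyl[of A As'] cyl[of B Bs'] unfolding 4 by (simp add: algebra_simps)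
  qed
qed

text \<open>The law of \<open>f\<close> conditioned on \<open>E\<close> agrees with
  \<open>S01\<close> on cylinders, which determine a measure on streams. Events \<open>E\<close> of
  probability 0 cannot be conditioned on and are treated apart.\<close>

lemma indep_of_cyl:
  assumes f: "f \<in> measurable S01 S01" and E: "Measurable.pred S01 E"
    and cyl: "\<And>As. As \<in> lists (sets borel) \<Longrightarrow>
      \<P>(s in S01. f s \<in> cyl As \<and> E s) = measure S01 (cyl As) * \<P>(s in S01. E s)"
    and A: "A \<in> sets S01"
  shows "\<P>(s in S01. f s \<in> A \<and> E s) = measure S01 A * \<P>(s in S01. E s)"
proof (cases "\<P>(s in S01. E s) = 0")
  case True
  have EB: "{s. E s} \<in> sets (stream_space borel)" using E[unfolded pred_def] by simp
  have "\<P>(s in S01. f s \<in> A \<and> E s) \<le> \<P>(s in S01. E s)"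
    using EB by (intro S01.finite_measure_mono) auto
  then show ?thesis using True by (simp add: measure_le_0_iff)
next
  case False
  have EB: "{s. E s} \<in> sets (stream_space borel)" using E[unfolded pred_def] by simp
  define B where "B = {s \<in> space S01. E s}"
  have B: "B \<in> sets S01" "measure S01 B > 0" "emeasure S01 B \<noteq> 0"
    using EB False by (auto simp: B_def S01.emeasure_eq_measure zero_less_measure_iff)
  define N where "N = distr (uniform_measure S01 B) S01 f"
  have fm: "f \<in> measurable (uniform_measure S01 B) S01" using f by simp
  have N: "measure N X = \<P>(s in S01. f s \<in> X \<and> E s) / measure S01 B" if X: "X \<in> sets S01" for X
  proof -
    have "measure N X = measure (uniform_measure S01 B) (f -` X)"
      unfolding N_def using fm X by (subst measure_distr) auto
    also have "\<dots> = measure S01 (B \<inter> f -` X) / measure S01 B"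
      using B measurable_sets[OF f X] by (subst measure_uniform_measure) auto
    also have "B \<inter> f -` X = {s \<in> space S01. f s \<in> X \<and> E s}" by (auto simp: B_def)
    finally show ?thesis .
  qed
  have pN: "prob_space N"
    unfolding N_def using B fm by (intro prob_space.prob_space_distr prob_space_uniform_measure) auto
  then interpret N: prob_space N .
  have "N = S01"
  proof (rule stream_space_eq_scylinder[where S = borel and G = "sets borel" and C = "{UNIV}"])
    show "sets borel = sets (sigma (space borel) (sets (borel :: real measure)))"
      by (metis sets.sigma_sets_eq sets.space_closed sets_measure_of)
    show "Int_stable (sets (borel :: real measure))" by (rule sets.Int_stable)
  next
    fix xs :: "real set list" assume xs: "xs \<in> lists (sets borel)"
    have "cyl xs \<in> sets S01" using sets_cyl[OF xs] by simp
    from N[OF this] cyl[OF xs] B(2) have "measure N (cyl xs) = measure S01 (cyl xs)"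
      by (simp add: B_def)
    then show "emeasure N (scylinder (space borel) xs) = emeasure S01 (scylinder (space borel) xs)"
      by (simp add: N.emeasure_eq_measure S01.emeasure_eq_measure)
  qed (use pN in \<open>auto simp: N_def S01.prob_space_axioms\<close>)
  with N[OF A] B(2) show ?thesis by (simp add: B_def field_simps)
qed

lemma measurable_child_S01 [measurable]: "child b v \<in> measurable S01 S01"
  by measurable

text \<open>\<open>indep_of_cyl\<close> is applied twice, replacing first the left and then the
  right cylinder by an arbitrary measurable set.\<close>

lemma child_indep:
  assumes v: "0 < v" "v < 1" and A: "A \<in> sets S01" and B: "B \<in> sets S01"
  shows "\<P>(s in S01. child False v s \<in> A \<and> child True v s \<in> B) = measure S01 A * measure S01 B"
proof -
  have cB: "\<P>(s in S01. child True v s \<in> cyl Bs) = measure S01 (cyl Bs)" if "Bs \<in> lists (sets borel)" for Bs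
    using split_prob_eq[OF v _ that, of "[]"] S01.prob_space by (simp add: split_prob_def)
  have 1: "\<P>(s in S01. child False v s \<in> A \<and> child True v s \<in> cyl Bs) = measure S01 A * measure S01 (cyl Bs)"
    if A: "A \<in> sets S01" and Bs: "Bs \<in> lists (sets borel)" for A Bs
  proof -
    have [measurable]: "cyl Bs \<in> sets (stream_space borel)" using Bs by (rule sets_cyl)
    have "\<P>(s in S01. child False v s \<in> A \<and> child True v s \<in> cyl Bs) =
        measure S01 A * \<P>(s in S01. child True v s \<in> cyl Bs)"
    proof (rule indep_of_cyl)
      fix As :: "real set list" assume "As \<in> lists (sets borel)"
      then show "\<P>(s in S01. child False v s \<in> cyl As \<and> child True v s \<in> cyl Bs) =
          measure S01 (cyl As) * \<P>(s in S01. child True v s \<in> cyl Bs)"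
        using split_prob_eq[OF v _ Bs] by (simp only: split_prob_def cB[OF Bs])
    qed (use A in measurable)
    then show ?thesis by (simp only: cB[OF Bs])
  qed
  have cA: "\<P>(s in S01. child False v s \<in> A) = measure S01 A"
    using 1[OF A, of "[]"] S01.prob_space by simp
  have [measurable]: "A \<in> sets (stream_space borel)" using A by simp
  have "\<P>(s in S01. child True v s \<in> B \<and> child False v s \<in> A) = measure S01 B * \<P>(s in S01. child False v s \<in> A)"
  proof (rule indep_of_cyl)
    fix Bs :: "real set list" assume "Bs \<in> lists (sets borel)"
    from 1[OF A this] show "\<P>(s in S01. child True v s \<in> cyl Bs \<and> child False v s \<in> A) =
        measure S01 (cyl Bs) * \<P>(s in S01. child False v s \<in> A)"
      by (simp only: cA conj_commute mult.commute)
  qed (use B in measurable)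
  then show ?thesis by (simp only: cA conj_commute mult.commute)
qed

lemma distr_child:
  assumes v: "0 < v" "v < 1"
  shows "distr S01 S01 (child b v) = S01"
proof (rule measure_eqI)
  fix A assume "A \<in> sets (distr S01 S01 (child b v))"
  then have A: "A \<in> sets S01" by simp
  have "child b v -` A \<inter> space S01 =
      {s \<in> space S01. child False v s \<in> (if b then UNIV else A) \<and> child True v s \<in> (if b then A else UNIV)}"
    by auto
  then have "measure S01 (child b v -` A \<inter> space S01) = measure S01 A"
    using child_indep[OF v, of "if b then UNIV else A" "if b then A else UNIV"] A S01.prob_space
      sets.top[of S01] by (auto split: if_splits)
  then show "emeasure (distr S01 S01 (child b v)) A = emeasure S01 A"
    using A by (subst emeasure_distr) (auto simp: S01.emeasure_eq_measure)
qed simp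

lemma AE_child:
  assumes "0 < v" "v < 1" "AE s in S01. P s"
  shows "AE s in S01. P (child b v s)"
proof -
  have "AE s in distr S01 S01 (child b v). P s"
    using assms(3) by (simp only: distr_child[OF assms(1,2)])
  then show ?thesis by (rule AE_distrD[rotated]) measurable
qed

section \<open>Subsequences and intervals attached to nodes\<close>

text \<open>The values stored in the subtree at the node, in order of arrival: the head is the label
  of the node and the length is the subtree size. Unlike in \<open>child\<close>, the values are not
  rescaled.\<close>

primrec sub :: "node \<Rightarrow> real list \<Rightarrow> real list" where
  "sub [] xs = xs"
| "sub (b # u) xs = (case xs of [] \<Rightarrow> [] | x # xs' \<Rightarrow> sub u (filter (\<lambda>y. x \<le> y \<longleftrightarrow> b) xs'))"

lemma sub_Nil [simp]: "sub u [] = []"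
  by (cases u) auto

lemma sub_append: "sub (u @ w) xs = sub w (sub u xs)"
  by (induction u arbitrary: xs) (auto split: list.splits)

text \<open>The node at which the search of \<open>bst_slot\<close> stops, by recursion on the input
  instead of a loop on the tree.\<close>

fun slot :: "real list \<Rightarrow> real \<Rightarrow> node" where
  "slot [] z = []"
| "slot (x # xs) z = (x \<le> z) # slot (filter (\<lambda>y. x \<le> y \<longleftrightarrow> x \<le> z) xs) z"

lemma sub_snoc: "sub u (xs @ [z]) = sub u xs @ (if prefix u (slot xs z) then [z] else [])"
proof (induction u arbitrary: xs)
  case (Cons b u)
  show ?case
  proof (cases xs)
    case (Cons x xs')
    then show ?thesis using Cons.IH[of "filter (\<lambda>y. x \<le> y \<longleftrightarrow> b) xs'"] by (cases b) auto
  qed simp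
qed simp

definition labels :: "real list \<Rightarrow> node \<rightharpoonup> real" where
  "labels xs u = (case sub u xs of [] \<Rightarrow> None | y # _ \<Rightarrow> Some y)"

lemma sub_slot: "sub (slot xs z) xs = []"
  by (induction xs z rule: slot.induct) auto

lemma bst_slot_labels: "bst_slot (labels xs) z = slot xs z"
proof -
  \<comment> \<open>The loop is considered from an arbitrary start \<open>u\<close>. Each pass
    removes at least the current label, so \<open>length (sub u xs)\<close> decreases.\<close>
  have "while (\<lambda>u. u \<in> dom (labels xs))
      (\<lambda>u. if z < the (labels xs u) then u @ [False] else u @ [True]) u = u @ slot (sub u xs) z" for u
  proof (induction "length (sub u xs)" arbitrary: u rule: less_induct)
    case less
    show ?case
    proof (cases "sub u xs")
      case Nil
      then show ?thesis by (subst while_unfold) (auto simp: labels_def)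
    next
      case (Cons y ys)
      let ?u = "u @ [y \<le> z]"
      have s: "sub ?u xs = filter (\<lambda>x. y \<le> x \<longleftrightarrow> y \<le> z) ys"
        unfolding sub_append Cons by simp
      have "length (sub ?u xs) < length (sub u xs)"
        unfolding s Cons by (simp add: le_imp_less_Suc)
      note less[OF this]
      then show ?thesis
        using Cons s by (subst while_unfold) (auto simp: labels_def not_less)
    qed
  qed
  from this[of "[]"] show ?thesis by (simp add: bst_slot_def)
qed

lemma bst_eq_labels: "bst t n = labels (map t [0..<n])"
proof (induction n)
  case 0
  show ?case by (auto simp: labels_def)
next
  case (Suc n)
  let ?xs = "map t [0..<n]"
  have "((labels ?xs)(slot ?xs (t n) \<mapsto> t n)) u = labels (?xs @ [t n]) u" for u
  proof (cases "u = slot ?xs (t n)")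
    case True
    then show ?thesis by (simp add: labels_def sub_snoc sub_slot)
  next
    case False
    show ?thesis
    proof (cases "prefix u (slot ?xs (t n))")
      case True
      then obtain w where w: "slot ?xs (t n) = u @ w" by (rule prefixE)
      \<comment> \<open>An empty list at a proper ancestor of the slot would have stopped the search
        there. Hence appending \<open>t n\<close> leaves the head, that is the label,
        unchanged.\<close>
      have "sub u ?xs \<noteq> []"
      proof
        assume *: "sub u ?xs = []"
        have "slot xs z = u" if "sub u xs = []" "prefix u (slot xs z)" for xs z
          using that
        proof (induction u arbitrary: xs)
          case (Cons b u)
          then show ?case by (cases xs) auto
        qed simp
        with * True False show False by metis
      qed
      then show ?thesis using False True by (auto simp: labels_def sub_snoc split: list.splits)
    qed (use False in \<open>auto simp: labels_def sub_snoc\<close>)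
  qed
  then show ?case by (simp add: Suc bst_slot_labels fun_eq_iff)
qed

lemma bst_tree_eq: "bst_tree t n = {u. sub u (map t [0..<n]) \<noteq> []}"
  unfolding bst_tree_def bst_eq_labels by (auto simp: labels_def dom_def split: list.splits)

lemma bst_tree_Suc: "bst_tree t (Suc n) = insert (slot (map t [0..<n]) (t n)) (bst_tree t n)"
  by (simp add: bst_tree_def bst_eq_labels[symmetric] bst_slot_labels[symmetric])

lemma finite_bst_tree [simp]: "finite (bst_tree t n)"
  by (induction n) (simp_all add: bst_tree_Suc, simp add: bst_tree_def)

lemma subtree_size_bst: "subtree_size (bst_tree t n) u = length (sub u (map t [0..<n]))"
proof (induction n)
  case 0
  then show ?case by (simp add: subtree_size_def bst_tree_def)
next
  case (Suc n)
  let ?z = "slot (map t [0..<n]) (t n)"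
  have "?z \<notin> bst_tree t n" by (simp add: bst_tree_eq sub_slot)
  moreover have "{v \<in> insert ?z (bst_tree t n). prefix u v} =
      (if prefix u ?z then insert ?z {v \<in> bst_tree t n. prefix u v} else {v \<in> bst_tree t n. prefix u v})"
    by auto
  ultimately show ?case
    using Suc by (simp add: subtree_size_def bst_tree_Suc sub_snoc)
qed

lemma card_bst_tree: "card (bst_tree t n) = n"
  using subtree_size_bst[of t n "[]"] by (simp add: subtree_size_def)

lemma length_sub_le: "length (sub u xs) \<le> length xs"
proof (induction u arbitrary: xs)
  case (Cons b u)
  then show ?case
    by (cases xs) (auto intro!: le_SucI order_trans[OF Cons.IH length_filter_le])
qed simp

text \<open>Each step along \<open>w\<close> removes at least the label of the node just left. This
  is why an ancestor of an occupied node holds many values.\<close>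

lemma length_sub_append:
  assumes "sub (u @ w) xs \<noteq> []"
  shows "length w < length (sub u xs)"
proof -
  have "sub w ys \<noteq> [] \<Longrightarrow> length w < length ys" for ys
  proof (induction w arbitrary: ys)
    case (Cons b w)
    then obtain y ys' where ys: "ys = y # ys'" by (cases ys) auto
    with Cons have "length w < length (filter (\<lambda>x. y \<le> x \<longleftrightarrow> b) ys')" by simp
    also have "\<dots> \<le> length ys'" by (rule length_filter_le)
    finally show ?case using ys by simp
  qed simp
  then show ?thesis using assms unfolding sub_append by blast
qed

lemma length_sub_append_le: "length (sub (u @ w) xs) \<le> length (sub u xs)"
  unfolding sub_append by (rule length_sub_le)

text \<open>\<open>sub\<close> only uses comparisons, so the rescaling in \<open>child\<close> is
  invisible to it.\<close>

lemma length_sub_map: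
  assumes "\<And>x y. f x \<le> f y \<longleftrightarrow> x \<le> (y :: real)"
  shows "length (sub u (map f xs)) = length (sub u xs)"
proof (induction u arbitrary: xs)
  case (Cons b u)
  then show ?case by (cases xs) (auto simp: filter_map o_def assms)
qed simp

section \<open>Counts in a set and the interval belonging to a node\<close>

definition cnt :: "real set \<Rightarrow> nat \<Rightarrow> real stream \<Rightarrow> nat" where
  "cnt A n s = length (filter (\<lambda>x. x \<in> A) (stake n s))"

text \<open>The subtree on side \<open>b\<close> evolves like a tree grown from
  \<open>child b v s\<close>, whose clock advances only when a value falls on that side.\<close>

lemma length_sub_stake:
  assumes v: "0 < v" "v < 1"
  shows "length (sub (b # u) (stake (Suc n) (v ## s))) =
    length (sub u (stake (cnt {y. v \<le> y \<longleftrightarrow> b} n s) (child b v s)))"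
proof -
  let ?f = "\<lambda>x. (x - off b v) / width b v"
  have w: "width b v > 0" using v by (auto simp: width_def)
  have "stake (cnt {y. v \<le> y \<longleftrightarrow> b} n s) (child b v s) = map ?f (filter (\<lambda>y. v \<le> y \<longleftrightarrow> b) (stake n s))"
    unfolding child_def stake_smap cnt_def by (simp flip: filter_stake)
  then show ?thesis
    using w by (simp add: length_sub_map divide_le_cancel)
qed

text \<open>The recursion peels off the first digit and not the last, so that what remains after the
  first pivot is the same quantity for a fresh copy of the input.\<close>

primrec Lam :: "node \<Rightarrow> real stream \<Rightarrow> real" where
  "Lam [] t = 1"
| "Lam (b # u) t = width b (shd t) * Lam u (child b (shd t) (stl t))"

primrec lo :: "node \<Rightarrow> real stream \<Rightarrow> real" where
  "lo [] t = 0"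
| "lo (b # u) t = off b (shd t) + width b (shd t) * lo u (child b (shd t) (stl t))"

lemma measurable_Lam [measurable]: "Lam u \<in> borel_measurable (stream_space borel)"
  by (induction u) (simp_all, measurable)

lemma AE_S01_child:
  assumes [measurable]: "Measurable.pred S01 P" and P: "AE s in S01. P s"
  shows "AE t in S01. P (child b (shd t) (stl t))"
proof -
  have [measurable]: "(\<lambda>t. child b (shd t) (stl t)) \<in> measurable S01 S01" by measurable
  have "AE v in U01. AE s in S01. P (child b v s)"
    using AE_U01 by eventually_elim (rule AE_child[OF _ _ P], auto)
  then show ?thesis
    by (subst U01.AE_stream_space) simp_all
qed

lemma AE_shd: "AE t in S01. 0 < shd t \<and> shd t < 1"
  by (subst U01.AE_stream_space) (use AE_U01 in \<open>simp_all\<close>)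

lemma AE_S01_values: "AE t in S01. \<forall>n. 0 < t !! n \<and> t !! n < 1"
proof -
  have "AE t in S01. stream_all (\<lambda>v. 0 < v \<and> v < 1) t"
    by (rule U01.AE_stream_all[OF _ AE_U01]) measurable
  then show ?thesis by eventually_elim (simp add: stream.pred_set snth_sset)
qed

text \<open>Goodness at a node is not inherited from the root: junk in \<open>sel\<close>, or a
  value equal to the pivot, leaves the open unit interval after rescaling.\<close>

primrec good :: "node \<Rightarrow> real stream \<Rightarrow> bool" where
  "good [] t \<longleftrightarrow> (\<forall>n. 0 < t !! n \<and> t !! n < 1)"
| "good (b # u) t \<longleftrightarrow> 0 < shd t \<and> shd t < 1 \<and> good u (child b (shd t) (stl t))"

lemma measurable_good [measurable]: "Measurable.pred (stream_space borel) (good u)"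
proof (induction u)
  case (Cons b u)
  have "(\<lambda>t. child b (shd t) (stl t)) \<in> measurable (stream_space borel) (stream_space borel)" by measurable
  from measurable_compose[OF this Cons] have [measurable]:
    "Measurable.pred (stream_space borel) (\<lambda>t. good u (child b (shd t) (stl t)))" .
  show ?case by simp
qed simp

lemma AE_good: "AE t in S01. good u t"
proof (induction u)
  case Nil
  then show ?case using AE_S01_values by simp
next
  case (Cons b u)
  have "AE t in S01. good u (child b (shd t) (stl t))"
    by (rule AE_S01_child[OF _ Cons]) measurable
  then show ?case using AE_shd by eventually_elim simp
qed

lemma Lam_lo_bounds:
  assumes "good u t"
  shows "0 < Lam u t" "0 \<le> lo u t" "lo u t + Lam u t \<le> 1"
proof -
  have "0 < Lam u t \<and> 0 \<le> lo u t \<and> lo u t + Lam u t \<le> 1"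
    using assms
  proof (induction u arbitrary: t)
    case (Cons b u)
    obtain v s where t: "t = v ## s" by (cases t)
    define c where "c = child b v s"
    have eqs: "Lam (b # u) t = width b v * Lam u c" "lo (b # u) t = off b v + width b v * lo u c"
      by (simp_all add: t c_def)
    from Cons.prems have v: "0 < v" "v < 1" and "good u c"
      by (auto simp: t c_def)
    with Cons.IH have c: "0 < Lam u c" "0 \<le> lo u c" "lo u c + Lam u c \<le> 1"
      by auto
    have w: "0 < width b v" "0 \<le> off b v" "off b v + width b v \<le> 1"
      using v by (auto simp: width_def off_def)
    have "width b v * (lo u c + Lam u c) \<le> width b v * 1"
      using w c by (intro mult_left_mono) auto
    then show ?case
      unfolding eqs using v c w by (auto simp: algebra_simps)
  qed simp
  then show "0 < Lam u t" "0 \<le> lo u t" "lo u t + Lam u t \<le> 1" by auto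
qed

lemma cnt_stl: "cnt A (Suc n) (x ## s) = (if x \<in> A then 1 else 0) + cnt A n s"
  by (simp add: cnt_def)

lemma cnt_le: "cnt A n s \<le> n"
  unfolding cnt_def by (metis length_filter_le length_stake)

lemma cnt_mono: "A \<subseteq> B \<Longrightarrow> m \<le> n \<Longrightarrow> cnt A m s \<le> cnt B n s"
proof (induction m arbitrary: n s)
  case (Suc m)
  then obtain n' where n: "n = Suc n'" by (cases n) auto
  obtain x s' where "s = x ## s'" by (cases s)
  then show ?case using Suc.IH[of n' s'] Suc.prems n by (auto simp: cnt_stl)
qed (simp add: cnt_def)

lemma length_filter_mono: "(\<And>x. P x \<Longrightarrow> Q x) \<Longrightarrow> length (filter P xs) \<le> length (filter Q xs)"
  by (induction xs) (auto simp: le_Suc_eq)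

text \<open>Equality can fail because the endpoints of the closed interval may be labels of
  ancestors, which lie outside the subtree.\<close>

lemma length_sub_le_cnt:
  assumes "good u t"
  shows "length (sub u (stake n t)) \<le> cnt {lo u t..lo u t + Lam u t} n t"
  using assms
proof (induction u arbitrary: n t)
  case Nil
  then have "filter (\<lambda>x. 0 \<le> x \<and> x \<le> 1) (stake n t) = stake n t"
    by (subst filter_id_conv) (auto simp: in_set_conv_nth less_imp_le)
  then show ?case by (simp add: cnt_def)
next
  case (Cons b u)
  obtain v s where t: "t = v ## s" by (cases t)
  define c where "c = child b v s"
  define I where "I = {lo u c..lo u c + Lam u c}"
  define J where "J = {lo (b # u) t..lo (b # u) t + Lam (b # u) t}"
  from Cons.prems have v: "0 < v" "v < 1" and c: "good u c"
    by (auto simp: t c_def)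
  have w: "width b v > 0" using v by (auto simp: width_def)
  show ?case
  proof (cases n)
    case (Suc m)
    let ?f = "\<lambda>x. (x - off b v) / width b v"
    let ?N = "cnt {y. v \<le> y \<longleftrightarrow> b} m s"
    have stake: "stake ?N c = map ?f (filter (\<lambda>y. v \<le> y \<longleftrightarrow> b) (stake m s))"
      unfolding c_def child_def stake_smap cnt_def by (simp flip: filter_stake)
    have J: "x \<in> J" if "?f x \<in> I" for x
      using that w by (auto simp: I_def J_def t c_def[symmetric] field_simps)
    have "length (sub (b # u) (stake n t)) = length (sub u (stake ?N c))"
      unfolding Suc t c_def by (rule length_sub_stake[OF v])
    also have "\<dots> \<le> cnt I ?N c"
      unfolding I_def by (rule Cons.IH[OF c])
    also have "\<dots> \<le> cnt J m s"
      unfolding cnt_def[of I] cnt_def[of J] stake filter_map length_map filter_filter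
      by (rule length_filter_mono) (use J in auto)
    also have "\<dots> \<le> cnt J n t"
      unfolding Suc t cnt_stl by simp
    finally show ?thesis unfolding J_def .
  qed simp
qed

section \<open>Chernoff bounds and limits of subtree sizes\<close>

lemma measurable_cnt [measurable (raw)]:
  assumes A: "Measurable.pred (N \<Otimes>\<^sub>M borel) (\<lambda>(x, y). y \<in> A x)"
    and f: "f \<in> measurable N (stream_space borel)"
  shows "(\<lambda>x. cnt (A x) n (f x)) \<in> measurable N (count_space UNIV)"
  using f
proof (induction n arbitrary: f)
  case 0
  show ?case by (simp add: cnt_def)
next
  case (Suc n)
  note [measurable] = Suc.prems
  have [measurable]: "(\<lambda>x. cnt (A x) n (stl (f x))) \<in> measurable N (count_space UNIV)"
    by (rule Suc.IH) measurable
  have "(\<lambda>x. (x, shd (f x))) \<in> measurable N (N \<Otimes>\<^sub>M borel)" by measurable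
  from measurable_compose[OF this A] have [measurable]: "Measurable.pred N (\<lambda>x. shd (f x) \<in> A x)"
    by simp
  have "cnt (A x) (Suc n) (f x) = (if shd (f x) \<in> A x then 1 else 0) + cnt (A x) n (stl (f x))" for x
    by (simp add: cnt_def)
  then show ?case by (simp only:) measurable
qed

lemma measurable_length_sub [measurable (raw)]:
  assumes f: "f \<in> measurable N (stream_space borel)"
  shows "(\<lambda>x. length (sub u (stake n (f x)))) \<in> measurable N (count_space UNIV)"
  using f
proof (induction u arbitrary: f n)
  case Nil
  then show ?case by simp
next
  case (Cons b u)
  note [measurable] = Cons.prems
  show ?case
  proof (cases n)
    case (Suc m)
    define A where "A x = {y. shd (f x) \<le> y \<longleftrightarrow> b}" for x
    define g where "g x = sel (\<lambda>y. shd (f x) \<le> y \<longleftrightarrow> b) (stl (f x))" for x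
    have g[measurable]: "g \<in> measurable N (stream_space borel)"
      unfolding g_def by (rule measurable_sel) measurable
    have c: "(\<lambda>x. cnt (A x) m (stl (f x))) \<in> measurable N (count_space UNIV)"
      unfolding A_def by (rule measurable_cnt) measurable
    have "length (sub (b # u) (stake n (f x))) = length (sub u (stake (cnt (A x) m (stl (f x))) (g x)))" for x
      unfolding Suc cnt_def A_def g_def mem_Collect_eq by (simp flip: filter_stake)
    then show ?thesis
      using measurable_compose_countable[where f = "\<lambda>i x. length (sub u (stake i (g x)))", OF Cons.IH[OF g] c]
      by simp
  qed simp
qed

lemma pred_LIMSEQ:
  fixes f :: "nat \<Rightarrow> 'a \<Rightarrow> real"
  assumes [measurable]: "\<And>n. f n \<in> borel_measurable N" "l \<in> borel_measurable N"
  shows "Measurable.pred N (\<lambda>x. (\<lambda>n. f n x) \<longlonglongrightarrow> l x)"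
proof -
  have "(\<lambda>n. f n x) \<longlonglongrightarrow> l x \<longleftrightarrow> (\<forall>k. \<exists>m. \<forall>n\<ge>m. \<bar>f n x - l x\<bar> < 1 / real (Suc k))" (is "_ \<longleftrightarrow> ?R") for x
  proof
    assume "(\<lambda>n. f n x) \<longlonglongrightarrow> l x"
    then show ?R by (auto simp: LIMSEQ_def dist_real_def)
  next
    assume R: ?R
    show "(\<lambda>n. f n x) \<longlonglongrightarrow> l x"
      unfolding LIMSEQ_def dist_real_def
    proof (intro allI impI)
      fix r :: real assume "0 < r"
      then obtain k where "1 / real (Suc k) < r" using nat_approx_posE by blast
      then show "\<exists>m. \<forall>n\<ge>m. \<bar>f n x - l x\<bar> < r" using R by (meson order.strict_trans)
    qed
  qed
  then show ?thesis by simp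
qed

text \<open>The count is binomial; each value contributes the factor
  \<open>1 + measure U01 A * (exp \<theta> - 1)\<close>.\<close>

lemma cnt_mgf:
  assumes A[measurable]: "A \<in> sets borel"
  shows "(\<integral>\<^sup>+s. ennreal (exp (\<theta> * real (cnt A n s))) \<partial>S01) = ennreal ((1 + measure U01 A * (exp \<theta> - 1)) ^ n)"
proof (induction n)
  case 0
  then show ?case using S01.emeasure_space_1 by (simp add: cnt_def)
next
  case (Suc n)
  let ?p = "measure U01 A"
  let ?C = "\<integral>\<^sup>+s. ennreal (exp (\<theta> * real (cnt A n s))) \<partial>S01"
  have p: "?p \<le> 1" "0 \<le> ?p" by auto
  have q: "0 \<le> 1 + ?p * (exp \<theta> - 1)"
  proof -
    have "0 \<le> (1 - ?p) + ?p * exp \<theta>" using p by (intro add_nonneg_nonneg) auto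
    then show ?thesis by (simp add: algebra_simps)
  qed
  have "(\<integral>\<^sup>+s. ennreal (exp (\<theta> * real (cnt A (Suc n) s))) \<partial>S01) =
      (\<integral>\<^sup>+x. \<integral>\<^sup>+s. ennreal (exp (\<theta> * real (cnt A (Suc n) (x ## s)))) \<partial>S01 \<partial>U01)"
    by (rule U01.nn_integral_stream_space) measurable
  also have "\<dots> = (\<integral>\<^sup>+x. ?C * (ennreal (exp \<theta>) * indicator A x + indicator (- A) x) \<partial>U01)"
  proof (rule nn_integral_cong)
    fix x
    have "ennreal (exp (\<theta> * real (cnt A (Suc n) (x ## s)))) =
      ennreal (exp (\<theta> * real (cnt A n s))) * (ennreal (exp \<theta>) * indicator A x + indicator (- A) x)" for s
      by (auto simp: cnt_stl indicator_def distrib_left exp_add ennreal_mult mult.commute)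
    then show "(\<integral>\<^sup>+s. ennreal (exp (\<theta> * real (cnt A (Suc n) (x ## s)))) \<partial>S01) =
        ?C * (ennreal (exp \<theta>) * indicator A x + indicator (- A) x)"
      by (simp add: nn_integral_multc)
  qed
  also have "\<dots> = ?C * (ennreal (exp \<theta>) * ennreal ?p + ennreal (1 - ?p))"
  proof -
    have "measure U01 (- A) = 1 - ?p"
      using U01.prob_compl[of A] by (simp add: Compl_eq_Diff_UNIV)
    then show ?thesis
      by (simp add: nn_integral_cmult nn_integral_add nn_integral_cmult_indicator U01.emeasure_eq_measure)
  qed
  also have "ennreal (exp \<theta>) * ennreal ?p + ennreal (1 - ?p) = ennreal (1 + ?p * (exp \<theta> - 1))"
    using p by (simp add: algebra_simps flip: ennreal_mult ennreal_plus)
  finally show ?case using q by (simp add: Suc ennreal_mult[symmetric] mult.commute)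
qed

text \<open>Markov's inequality for \<open>exp (\<theta> * cnt A n s)\<close>, then
  \<open>1 + x \<le> exp x\<close>; the bound is the one for a Poisson variable of the same
  mean.\<close>

lemma cnt_chernoff:
  assumes A[measurable]: "A \<in> sets borel" and \<theta>: "0 \<le> \<theta>"
  shows "\<P>(s in S01. real (cnt A n s) \<ge> m) \<le> exp (real n * measure U01 A * (exp \<theta> - 1) - \<theta> * m)"
proof -
  let ?p = "measure U01 A"
  have "{s \<in> space S01. m \<le> real (cnt A n s)} \<in> sets S01" by measurable
  then have [measurable]: "{s. m \<le> real (cnt A n s)} \<in> sets (stream_space borel)" by simp
  have "ennreal \<P>(s in S01. real (cnt A n s) \<ge> m) = (\<integral>\<^sup>+s. indicator {s. real (cnt A n s) \<ge> m} s \<partial>S01)"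
    by (subst nn_integral_indicator) (simp_all add: S01.emeasure_eq_measure)
  also have "\<dots> \<le> (\<integral>\<^sup>+s. ennreal (exp (- \<theta> * m)) * ennreal (exp (\<theta> * real (cnt A n s))) \<partial>S01)"
  proof (rule nn_integral_mono)
    fix s
    have "1 \<le> exp (- \<theta> * m) * exp (\<theta> * real (cnt A n s))" if "m \<le> real (cnt A n s)"
      using that \<theta> by (simp add: mult_left_mono flip: exp_add)
    then show "indicator {s. real (cnt A n s) \<ge> m} s \<le> ennreal (exp (- \<theta> * m)) * ennreal (exp (\<theta> * real (cnt A n s)))"
      by (auto simp: indicator_def simp flip: ennreal_mult ennreal_1 intro!: ennreal_leI)
  qed
  also have "\<dots> = ennreal (exp (- \<theta> * m)) * ennreal ((1 + ?p * (exp \<theta> - 1)) ^ n)"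
    by (subst nn_integral_cmult) (simp_all add: cnt_mgf)
  also have "\<dots> \<le> ennreal (exp (- \<theta> * m)) * ennreal (exp (?p * (exp \<theta> - 1)) ^ n)"
    using \<theta> by (intro mult_left_mono ennreal_leI power_mono) (auto intro: exp_ge_add_one_self)
  also have "\<dots> = ennreal (exp (real n * ?p * (exp \<theta> - 1) - \<theta> * m))"
    by (simp add: exp_of_nat_mult[symmetric] mult.assoc flip: ennreal_mult exp_add)
  finally show ?thesis by simp
qed

text \<open>Chernoff with \<open>\<theta> = e / 2\<close>: since \<open>exp y - 1 - y\<close> is at
  most the square of \<open>y\<close> for \<open>y = e / 2\<close>, the exponent is at most
  \<open>- n * e^2 / 4\<close>, and Borel-Cantelli applies.\<close>

lemma cnt_upper:
  assumes A[measurable]: "A \<in> sets borel" and e: "0 < e" "e \<le> 1"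
  shows "AE s in S01. eventually (\<lambda>n. real (cnt A n s) / real n < measure U01 A + e) sequentially"
proof -
  let ?p = "measure U01 A"
  define B where "B n = {s \<in> space S01. real (cnt A n s) \<ge> real n * (?p + e)}" for n
  have le: "measure S01 (B n) \<le> exp (- (e\<^sup>2 / 4)) ^ n" for n
  proof -
    have "exp (e / 2) - 1 - e / 2 \<le> (e / 2)\<^sup>2" using exp_bound[of "e / 2"] e by simp
    moreover have "0 \<le> exp (e / 2) - 1 - e / 2" using exp_ge_add_one_self[of "e / 2"] by linarith
    ultimately have "?p * (exp (e / 2) - 1 - e / 2) \<le> 1 * (e / 2)\<^sup>2"
      by (intro mult_mono) auto
    then have "real n * (?p * (exp (e / 2) - 1 - e / 2) - e\<^sup>2 / 2) \<le> real n * (1 * (e / 2)\<^sup>2 - e\<^sup>2 / 2)"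
      by (intro mult_left_mono) auto
    then have le: "real n * ?p * (exp (e / 2) - 1) - e / 2 * (real n * (?p + e)) \<le> real n * - (e\<^sup>2 / 4)"
      by (simp add: algebra_simps power2_eq_square)
    have "measure S01 (B n) \<le> exp (real n * ?p * (exp (e / 2) - 1) - e / 2 * (real n * (?p + e)))"
      unfolding B_def using e by (intro cnt_chernoff) auto
    also have "\<dots> \<le> exp (real n * - (e\<^sup>2 / 4))" using le by simp
    finally show ?thesis by (simp only: exp_of_nat_mult)
  qed
  have "summable (\<lambda>n. exp (- (e\<^sup>2 / 4)) ^ n)"
    using e by (intro summable_geometric) auto
  then have "summable (\<lambda>n. measure S01 (B n))"
    by (rule summable_comparison_test'[where N = 0]) (simp add: le)
  moreover have "B n \<in> sets S01" for n unfolding B_def by measurable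
  ultimately have "AE s in S01. eventually (\<lambda>n. s \<in> space S01 - B n) sequentially"
    by (intro borel_cantelli_AE1) (auto simp: S01.emeasure_eq_measure)
  then show ?thesis
  proof eventually_elim
    case (elim s)
    then show ?case using eventually_gt_at_top[of 0]
      by eventually_elim (auto simp: B_def not_le divide_less_eq mult.commute)
  qed
qed

lemma cnt_compl: "cnt A n s + cnt (- A) n s = n"
  unfolding cnt_def using sum_length_filter_compl[of "\<lambda>x. x \<in> A" "stake n s"] by simp

text \<open>The lower deviation is the upper deviation for the complement of
  \<open>A\<close>.\<close>

lemma cnt_strong_law:
  assumes A[measurable]: "A \<in> sets borel"
  shows "AE s in S01. (\<lambda>n. real (cnt A n s) / real n) \<longlonglongrightarrow> measure U01 A"
proof -
  let ?p = "measure U01 A"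
  have "measure U01 (- A) = 1 - ?p"
    using U01.prob_compl[of A] by (simp add: Compl_eq_Diff_UNIV)
  then have "AE s in S01. eventually (\<lambda>n. real (cnt A n s) / real n < ?p + 1 / real (Suc k)) sequentially \<and>
      eventually (\<lambda>n. real (cnt (- A) n s) / real n < 1 - ?p + 1 / real (Suc k)) sequentially" for k
    using cnt_upper[of A "1 / real (Suc k)"] cnt_upper[of "- A" "1 / real (Suc k)"] by simp
  then have "AE s in S01. \<forall>k. eventually (\<lambda>n. real (cnt A n s) / real n < ?p + 1 / real (Suc k)) sequentially \<and>
      eventually (\<lambda>n. real (cnt (- A) n s) / real n < 1 - ?p + 1 / real (Suc k)) sequentially"
    by (simp only: AE_all_countable) simp
  then show ?thesis
  proof eventually_elim
    case (elim s)
    show ?case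
    proof (rule tendstoI)
      fix e :: real assume "0 < e"
      then obtain k where k: "1 / real (Suc k) < e" using nat_approx_posE by blast
      from elim have "eventually (\<lambda>n. real (cnt A n s) / real n < ?p + 1 / real (Suc k)) sequentially"
        "eventually (\<lambda>n. real (cnt (- A) n s) / real n < 1 - ?p + 1 / real (Suc k)) sequentially"
        by auto
      then show "eventually (\<lambda>n. dist (real (cnt A n s) / real n) ?p < e) sequentially"
        using eventually_gt_at_top[of 0]
      proof eventually_elim
        case (elim n)
        have "real (cnt (- A) n s) = real n - real (cnt A n s)"
          using cnt_compl[of A n s] by linarith
        then have "real (cnt (- A) n s) / real n = 1 - real (cnt A n s) / real n"
          using elim by (simp add: diff_divide_distrib)
        then show ?case using elim k by (simp add: dist_real_def abs_less_iff)
      qed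
    qed
  qed
qed

text \<open>By \<open>length_sub_stake\<close> the size at \<open>b # u\<close> is a size at
  \<open>u\<close> for the child at the random time \<open>cnt side n s\<close>, which tends to
  infinity like \<open>n * width b v\<close>. The limits multiply.\<close>

lemma length_sub_limit:
  "AE t in S01. (\<lambda>n. real (length (sub u (stake n t))) / real n) \<longlonglongrightarrow> Lam u t"
proof (induction u)
  case Nil
  have "(\<lambda>n. real n / real n) \<longlonglongrightarrow> 1"
    by (rule tendsto_eventually) (use eventually_gt_at_top[of 0] in \<open>eventually_elim, simp\<close>)
  then show ?case by simp
next
  case (Cons b u)
  let ?f = "\<lambda>u n t. real (length (sub u (stake n t))) / real n"
  have "AE v in U01. AE s in S01. (\<lambda>n. ?f (b # u) n (v ## s)) \<longlonglongrightarrow> Lam (b # u) (v ## s)"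
    using AE_U01
  proof eventually_elim
    case (elim v)
    then have v: "0 < v" "v < 1" by auto
    define side where "side = {y. v \<le> y \<longleftrightarrow> b}"
    have side[measurable]: "side \<in> sets borel" unfolding side_def by measurable
    have w: "width b v > 0" using v by (auto simp: width_def)
    have "measure U01 side = width b v"
      using emeasure_U01_side[OF v, of UNIV b] U01.emeasure_space_1 w
      by (simp add: U01.emeasure_eq_measure side_def)
    then have "AE s in S01. (\<lambda>n. real (cnt side n s) / real n) \<longlonglongrightarrow> width b v"
      using cnt_strong_law[OF side] by simp
    moreover have "AE s in S01. (\<lambda>n. ?f u n (child b v s)) \<longlonglongrightarrow> Lam u (child b v s)"
      by (rule AE_child[OF v Cons.IH])
    ultimately show ?case
    proof eventually_elim
      case (elim s)
      have inf: "filterlim (\<lambda>n. cnt side n s) at_top sequentially"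
      proof -
        have "filterlim (\<lambda>n. (real (cnt side n s) / real n) * real n) at_top sequentially"
          by (rule filterlim_tendsto_pos_mult_at_top[OF elim(1) w filterlim_real_sequentially])
        moreover have "(real (cnt side n s) / real n) * real n = real (cnt side n s)" for n
          using cnt_le[of side n s] by (cases "n = 0") auto
        ultimately have "filterlim (\<lambda>n. real (cnt side n s)) at_top sequentially" by simp
        then show ?thesis
          by (simp add: filterlim_sequentially_iff_filterlim_real)
      qed
      have lim: "(\<lambda>n. ?f u (cnt side n s) (child b v s)) \<longlonglongrightarrow> Lam u (child b v s)"
        by (rule filterlim_compose[OF elim(2) inf])
      \<comment> \<open>The pivot uses up one value, so \<open>n\<close> later values belong to time
        \<open>Suc n\<close>.\<close>
      have "(\<lambda>n. real n / real (Suc n)) \<longlonglongrightarrow> 1"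
        by (rule LIMSEQ_n_over_Suc_n)
      from tendsto_mult[OF tendsto_mult[OF this elim(1)] lim]
      have "(\<lambda>n. real n / real (Suc n) * (real (cnt side n s) / real n) * ?f u (cnt side n s) (child b v s))
          \<longlonglongrightarrow> width b v * Lam u (child b v s)" by simp
      moreover have "real n / real (Suc n) * (real (cnt side n s) / real n) * ?f u (cnt side n s) (child b v s)
          = ?f (b # u) (Suc n) (v ## s)" for n
      proof -
        have "length (sub (b # u) (stake (Suc n) (v ## s))) = length (sub u (stake (cnt side n s) (child b v s)))"
          unfolding side_def by (rule length_sub_stake[OF v])
        then show ?thesis using cnt_le[of side n s]
          by (cases "n = 0"; cases "cnt side n s = 0") auto
      qed
      ultimately have "(\<lambda>n. ?f (b # u) (Suc n) (v ## s)) \<longlonglongrightarrow> width b v * Lam u (child b v s)" by simp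
      from LIMSEQ_imp_Suc[OF this] show ?case by simp
    qed
  qed
  moreover have "Measurable.pred S01 (\<lambda>t. (\<lambda>n. ?f (b # u) n t) \<longlonglongrightarrow> Lam (b # u) t)"
    by (rule pred_LIMSEQ) measurable
  ultimately show ?case
    by (simp only: U01.AE_stream_space)
qed

section \<open>Moments of the interval lengths\<close>

lemma nn_integral_U01:
  assumes [measurable]: "f \<in> borel_measurable borel"
  shows "(\<integral>\<^sup>+x. f x \<partial>U01) = (\<integral>\<^sup>+x. f x * indicator {0<..<1} x \<partial>lborel)"
  unfolding U01_def by (subst nn_integral_uniform_measure) (simp_all add: divide_ennreal_def)

lemma nn_integral_U01_width:
  assumes f[measurable]: "f \<in> borel_measurable borel"
  shows "(\<integral>\<^sup>+v. f (width b v) \<partial>U01) = (\<integral>\<^sup>+v. f v \<partial>U01)"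
proof (cases b)
  case True
  have "(\<integral>\<^sup>+v. f v \<partial>U01) = (\<integral>\<^sup>+x. f x * indicator {0<..<1} x \<partial>lborel)"
    by (rule nn_integral_U01) simp
  also have "\<dots> = (\<integral>\<^sup>+x. f (1 - x) * indicator {0<..<1} (1 - x) \<partial>lborel)"
    by (subst nn_integral_real_affine[where c = "- 1" and t = 1]) simp_all
  also have "\<dots> = (\<integral>\<^sup>+x. f (1 - x) * indicator {0<..<1} x \<partial>lborel)"
    by (intro nn_integral_cong) (auto simp: indicator_def)
  also have "\<dots> = (\<integral>\<^sup>+v. f (1 - v) \<partial>U01)"
    by (rule nn_integral_U01[symmetric]) simp
  finally show ?thesis using True by (simp add: width_def)
qed (simp add: width_def)

lemma nn_integral_powr_U01:
  assumes s: "0 \<le> s"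
  shows "(\<integral>\<^sup>+v. ennreal (v powr s) \<partial>U01) = ennreal (1 / (1 + s))"
proof -
  let ?g = "\<lambda>x :: real. if x \<in> {0..1} then x powr s else 0"
  have "(?g has_integral 1 / (1 + s)) UNIV"
    using has_integral_powr_from_0[of s 1] s
    by (subst has_integral_restrict_UNIV) (simp add: add.commute)
  then have "(\<integral>\<^sup>+x. ennreal (?g x) \<partial>lborel) = ennreal (1 / (1 + s))"
    by (intro nn_integral_has_integral_lborel) auto
  moreover have "(\<integral>\<^sup>+v. ennreal (v powr s) \<partial>U01) = (\<integral>\<^sup>+x. ennreal (?g x) \<partial>lborel)"
    unfolding nn_integral_U01[of "\<lambda>v. ennreal (v powr s)", simplified]
    by (rule nn_integral_cong_AE, use AE_lborel_singleton[of 0] AE_lborel_singleton[of 1] in eventually_elim)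
      (auto simp: indicator_def)
  ultimately show ?thesis by simp
qed

text \<open>\<open>Lam u\<close> is a product of \<open>length u\<close> independent uniform
  variables, each with \<open>s\<close>-th moment \<open>1 / (1 + s)\<close>.\<close>

lemma nn_integral_Lam_powr:
  assumes s: "0 \<le> s"
  shows "(\<integral>\<^sup>+t. ennreal (Lam u t powr s) \<partial>S01) = ennreal ((1 / (1 + s)) ^ length u)"
proof (induction u)
  case Nil
  then show ?case using S01.emeasure_space_1 by simp
next
  case (Cons b u)
  have "(\<integral>\<^sup>+t. ennreal (Lam (b # u) t powr s) \<partial>S01) =
      (\<integral>\<^sup>+v. \<integral>\<^sup>+r. ennreal (Lam (b # u) (v ## r) powr s) \<partial>S01 \<partial>U01)"
    by (rule U01.nn_integral_stream_space) measurable
  also have "\<dots> = (\<integral>\<^sup>+v. ennreal (width b v powr s) * ennreal ((1 / (1 + s)) ^ length u) \<partial>U01)"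
  proof (rule nn_integral_cong_AE, use AE_U01 in eventually_elim)
    case (elim v)
    then have v: "0 < v" "v < 1" by auto
    have "(\<integral>\<^sup>+r. ennreal (Lam (b # u) (v ## r) powr s) \<partial>S01) =
        (\<integral>\<^sup>+r. ennreal (width b v powr s) * ennreal (Lam u (child b v r) powr s) \<partial>S01)"
      by (simp add: powr_mult ennreal_mult)
    also have "\<dots> = ennreal (width b v powr s) * (\<integral>\<^sup>+r. ennreal (Lam u (child b v r) powr s) \<partial>S01)"
      by (rule nn_integral_cmult) measurable
    also have "(\<integral>\<^sup>+r. ennreal (Lam u (child b v r) powr s) \<partial>S01) =
        (\<integral>\<^sup>+r. ennreal (Lam u r powr s) \<partial>distr S01 S01 (child b v))"
      by (subst nn_integral_distr) simp_all
    finally show ?case using v by (simp add: distr_child Cons)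
  qed
  also have "\<dots> = (\<integral>\<^sup>+v. ennreal (width b v powr s) \<partial>U01) * ennreal ((1 / (1 + s)) ^ length u)"
    by (rule nn_integral_multc) measurable
  also have "(\<integral>\<^sup>+v. ennreal (width b v powr s) \<partial>U01) = ennreal (1 / (1 + s))"
    using nn_integral_U01_width[of "\<lambda>v. ennreal (v powr s)" b] s by (simp add: nn_integral_powr_U01)
  finally show ?case using s by (simp flip: ennreal_mult)
qed

lemma finite_level [simp]: "finite {u :: node. length u = k}"
  using finite_lists_length_eq[of "UNIV :: bool set" k] by simp

lemma card_level: "card {u :: node. length u = k} = 2 ^ k"
  using card_lists_length_eq[of "UNIV :: bool set" k] by simp

lemma nn_integral_level_powr:
  assumes s: "0 \<le> s"
  shows "(\<integral>\<^sup>+t. ennreal (\<Sum>u | length u = k. Lam u t powr s) \<partial>S01) = ennreal ((2 / (1 + s)) ^ k)"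
proof -
  have "(\<integral>\<^sup>+t. ennreal (\<Sum>u | length u = k. Lam u t powr s) \<partial>S01) =
      (\<integral>\<^sup>+t. (\<Sum>u | length u = k. ennreal (Lam u t powr s)) \<partial>S01)"
    by (subst sum_ennreal) simp_all
  also have "\<dots> = (\<Sum>u :: node | length u = k. ennreal ((1 / (1 + s)) ^ length u))"
    by (subst nn_integral_sum) (simp_all add: nn_integral_Lam_powr s)
  also have "\<dots> = ennreal (\<Sum>u :: node | length u = k. (1 / (1 + s)) ^ length u)"
    using s by (subst sum_ennreal) simp_all
  also have "(\<Sum>u :: node | length u = k. (1 / (1 + s)) ^ length u) = (2 / (1 + s)) ^ k"
    by (simp add: card_level power_divide)
  finally show ?thesis .
qed

section \<open>Unboundedness above the critical weight\<close>

definition peak :: "real \<Rightarrow> real \<Rightarrow> real stream set" where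
  "peak r c = {t. \<exists>u. c \<le> r ^ length u * Lam u t}"

lemma sets_peak [measurable]: "peak r c \<in> sets (stream_space borel)"
proof -
  have "{t \<in> space (stream_space borel). \<exists>u. c \<le> r ^ length u * Lam u t} \<in> sets (stream_space borel)"
    by measurable
  then show ?thesis by (simp add: peak_def space_stream_space)
qed

lemma peak_antimono: "c \<le> d \<Longrightarrow> peak r d \<subseteq> peak r c"
  unfolding peak_def by (blast intro: order_trans)

lemma peak_child:
  assumes "0 < r" "0 < v" "v < 1" "child b v s \<in> peak r (c / (r * width b v))"
  shows "v ## s \<in> peak r c"
proof -
  from assms obtain u where "c / (r * width b v) \<le> r ^ length u * Lam u (child b v s)"
    by (auto simp: peak_def)
  moreover have "0 < r * width b v" using assms by (simp add: width_def)
  ultimately have "c \<le> r ^ length (b # u) * Lam (b # u) (v ## s)"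
    by (simp add: field_simps)
  then show ?thesis unfolding peak_def by blast
qed

text \<open>The first pivot \<open>v\<close> produces two independent copies of the original sequence, rescaled by
  \<open>v\<close> and \<open>1 - v\<close>, of which at least one has to reach the level.\<close>

lemma peak_first_step:
  assumes r: "0 < r" and h[measurable]: "h \<in> borel_measurable borel" "integrable U01 h"
    and le: "\<And>v p q. 0 < v \<Longrightarrow> v < 1 \<Longrightarrow> p = measure S01 (peak r (c / (r * v))) \<Longrightarrow>
      q = measure S01 (peak r (c / (r * (1 - v)))) \<Longrightarrow> h v \<le> p + q - p * q"
  shows "(\<integral>v. h v \<partial>U01) \<le> measure S01 (peak r c)"
proof -
  \<comment> \<open>\<open>h\<close> may be negative, so it is replaced by its positive part before
    passing to nonnegative integrals.\<close>
  have "ennreal (\<integral>v. h v \<partial>U01) \<le> ennreal (\<integral>v. max 0 (h v) \<partial>U01)"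
    using h by (intro ennreal_leI integral_mono) auto
  also have "\<dots> = (\<integral>\<^sup>+v. ennreal (max 0 (h v)) \<partial>U01)"
    using h by (intro nn_integral_eq_integral[symmetric]) auto
  also have "\<dots> \<le> (\<integral>\<^sup>+v. \<P>(s in S01. v ## s \<in> peak r c) \<partial>U01)"
  proof (rule nn_integral_mono_AE, use AE_U01 in eventually_elim)
    case (elim v)
    then have v: "0 < v" "v < 1" by auto
    define F where "F = peak r (c / (r * v))"
    define T where "T = peak r (c / (r * (1 - v)))"
    have [measurable]: "F \<in> sets (stream_space borel)" "T \<in> sets (stream_space borel)"
      by (simp_all add: F_def T_def)
    have "{s \<in> space S01. child False v s \<in> F} \<in> sets S01" "{s \<in> space S01. child True v s \<in> T} \<in> sets S01"
      by measurable
    then have [measurable]: "{s. child False v s \<in> F} \<in> sets (stream_space borel)"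
      "{s. child True v s \<in> T} \<in> sets (stream_space borel)" by simp_all
    define p where "p = measure S01 F"
    define q where "q = measure S01 T"
    have cp: "\<P>(s in S01. child False v s \<in> F) = p" "\<P>(s in S01. child True v s \<in> T) = q"
      using child_indep[OF v, of F UNIV] child_indep[OF v, of UNIV T] S01.prob_space sets.top[of S01]
      by (simp_all add: p_def q_def)
    have "h v \<le> p + q - p * q"
      by (rule le[OF v]) (simp_all add: p_def q_def F_def T_def)
    also have "\<dots> = \<P>(s in S01. child False v s \<in> F \<or> child True v s \<in> T)"
    proof -
      have "\<P>(s in S01. child False v s \<in> F \<or> child True v s \<in> T) =
        measure S01 ({s \<in> space S01. child False v s \<in> F} \<union> {s \<in> space S01. child True v s \<in> T})"
        by (intro arg_cong[where f = "measure S01"]) auto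
      also have "\<dots> = p + measure S01 ({s \<in> space S01. child True v s \<in> T} - {s \<in> space S01. child False v s \<in> F})"
        by (subst S01.finite_measure_Union') (simp_all add: cp[simplified])
      also have "measure S01 ({s \<in> space S01. child True v s \<in> T} - {s \<in> space S01. child False v s \<in> F}) =
          q - measure S01 ({s \<in> space S01. child True v s \<in> T} \<inter> {s \<in> space S01. child False v s \<in> F})"
        by (subst S01.finite_measure_Diff') (simp_all add: cp[simplified])
      also have "{s \<in> space S01. child True v s \<in> T} \<inter> {s \<in> space S01. child False v s \<in> F} =
          {s \<in> space S01. child False v s \<in> F \<and> child True v s \<in> T}" by auto
      also have "measure S01 \<dots> = p * q"
        using child_indep[OF v, of F T] by (simp add: p_def q_def)
      finally show ?thesis by simp
    qed
    also have "\<dots> \<le> \<P>(s in S01. v ## s \<in> peak r c)"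
    proof (rule S01.finite_measure_mono)
      show "{s \<in> space S01. child False v s \<in> F \<or> child True v s \<in> T} \<subseteq> {s \<in> space S01. v ## s \<in> peak r c}"
        using peak_child[OF r v, of False] peak_child[OF r v, of True]
        by (auto simp: F_def T_def width_def)
    qed measurable
    finally show ?case by (intro ennreal_leI) auto
  qed
  also have "\<dots> = ennreal (measure S01 (peak r c))"
    using U01.prob_stream_space[of "\<lambda>t. t \<in> peak r c"] by simp
  finally show ?thesis by simp
qed

text \<open>A lower bound for the expected number of nodes \<open>u\<close> of length \<open>k\<close> with
  \<open>z * r ^ k * Lam u \<ge> 1\<close>. As \<open>- ln (Lam u)\<close> is a sum of \<open>k\<close> independent exponential variables, this
  number involves an Erlang distribution function, of which only the leading term is kept.\<close>

definition gam :: "real \<Rightarrow> nat \<Rightarrow> real \<Rightarrow> real" where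
  "gam r k z = (let y = ln z + real k * ln r in
     if 0 \<le> y then 2 ^ k * y ^ k * exp (- y) / fact k else 0)"

lemma power_le_exp_fact:
  assumes "0 \<le> (y :: real)"
  shows "y ^ k \<le> fact k * exp y"
proof -
  have s: "(\<lambda>n. inverse (fact n) * y ^ n) sums exp y"
    using exp_converges[of y] by simp
  have "(\<Sum>n\<in>{k}. inverse (fact n) * y ^ n) \<le> (\<Sum>n. inverse (fact n) * y ^ n)"
    by (rule sum_le_suminf[OF sums_summable[OF s]]) (use assms in auto)
  then have "(\<Sum>n\<in>{k}. inverse (fact n) * y ^ n) \<le> exp y"
    by (simp only: sums_unique[OF s, symmetric])
  then show ?thesis by (simp add: field_simps)
qed

text \<open>For nonnegative \<open>y\<close> the quotient \<open>gam r k z / 2 ^ k\<close> is the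
  Poisson probability of \<open>k\<close> at mean \<open>y\<close>.\<close>

lemma gam_bounds: "0 \<le> gam r k z" "gam r k z \<le> 2 ^ k"
proof -
  show "0 \<le> gam r k z" by (simp add: gam_def Let_def)
  show "gam r k z \<le> 2 ^ k"
  proof (cases "0 \<le> ln z + real k * ln r")
    case True
    define y where "y = ln z + real k * ln r"
    have "y ^ k * exp (- y) \<le> fact k * exp y * exp (- y)"
      using power_le_exp_fact[of y k] True by (intro mult_right_mono) (auto simp: y_def)
    also have "\<dots> = fact k" by (simp add: mult.assoc flip: exp_add)
    finally have "y ^ k * exp (- y) / fact k \<le> 1" by simp
    then have "2 ^ k * (y ^ k * exp (- y) / fact k) \<le> 2 ^ k * 1"
      by (intro mult_left_mono) auto
    then show ?thesis using True by (simp add: gam_def y_def[symmetric] mult.assoc)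
  qed (simp add: gam_def)
qed

lemma measurable_gam [measurable]: "gam r k \<in> borel_measurable borel"
  unfolding gam_def[abs_def] Let_def by measurable

lemma integrable_gam:
  assumes [measurable]: "f \<in> borel_measurable borel"
  shows "integrable U01 (\<lambda>v. gam r k (f v))"
  by (rule U01.integrable_const_bound[where B = "2 ^ k"]) (simp_all add: gam_bounds)

text \<open>First-step recursion: with \<open>y\<close> taken for \<open>Suc k\<close>, replacing
  \<open>z\<close> by \<open>z * r * v\<close> and \<open>Suc k\<close> by \<open>k\<close> turns
  \<open>y\<close> into \<open>y + ln v\<close>, and \<open>(y + ln v) ^ k / v\<close> has the
  antiderivative \<open>(y + ln v) ^ Suc k / Suc k\<close>. The factor 2 counts the two
  children.\<close>

lemma integral_gam:
  assumes r: "0 < r" and z: "0 < z"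
  shows "gam r (Suc k) z \<le> 2 * (\<integral>v. gam r k (z * r * v) \<partial>U01)"
proof -
  define y where "y = ln z + real (Suc k) * ln r"
  have gS: "gam r (Suc k) z = (if 0 \<le> y then 2 ^ Suc k * y ^ Suc k * exp (- y) / fact (Suc k) else 0)"
    by (simp only: gam_def y_def Let_def)
  show ?thesis
  proof (cases "0 \<le> y")
    case False
    then show ?thesis by (simp add: gS gam_bounds)
  next
    case True
    \<comment> \<open>The point from which on \<open>y + ln v\<close> is nonnegative; below it the
      integrand is 0 by the definition of \<open>gam\<close>.\<close>
    define a where "a = exp (- y)"
    define f where "f v = (if v \<in> {a..1} then 2 ^ k * (y + ln v) ^ k * exp (- y) / (v * fact k) else 0)" for v
    define G where "G v = 2 ^ k * exp (- y) * (y + ln v) ^ Suc k / (real (Suc k) * fact k)" for v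
    have a: "0 < a" "a \<le> 1" using True by (auto simp: a_def)
    have [measurable]: "f \<in> borel_measurable borel" unfolding f_def[abs_def] by measurable
    have ly: "0 \<le> y + ln v" if "a \<le> v" for v
    proof -
      have "0 < v" using that a by linarith
      then have "ln a \<le> ln v" using that a by simp
      then show ?thesis by (simp add: a_def)
    qed
    have f0: "0 \<le> f v" for v
      using a ly[of v] by (auto simp: f_def)
    have eq: "gam r k (z * r * v) = f v" if "0 < v" "v < 1" for v
    proof -
      have "ln (z * r * v) + real k * ln r = y + ln v"
        using that r z by (simp add: ln_mult y_def algebra_simps)
      moreover have "0 \<le> y + ln v \<longleftrightarrow> a \<le> v"
        using that a ln_le_cancel_iff[of a v] by (auto simp: a_def)
      moreover have "exp (- (y + ln v)) = exp (- y) / v"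
        using that by (simp add: exp_diff exp_add exp_minus field_simps)
      ultimately show ?thesis using that by (auto simp: gam_def f_def)
    qed
    have "(\<integral>\<^sup>+v. ennreal (gam r k (z * r * v)) \<partial>U01) = (\<integral>\<^sup>+v. ennreal (f v) \<partial>U01)"
      by (rule nn_integral_cong_AE, use AE_U01 in eventually_elim) (simp add: eq)
    also have "\<dots> = (\<integral>\<^sup>+v. ennreal (f v) * indicator {0<..<1} v \<partial>lborel)"
      by (rule nn_integral_U01) simp
    also have "\<dots> = (\<integral>\<^sup>+v. ennreal (f v) * indicator {a..1} v \<partial>lborel)"
      by (rule nn_integral_cong_AE, use AE_lborel_singleton[of 1] in eventually_elim)
        (use a in \<open>auto simp: indicator_def f_def\<close>)
    also have "\<dots> = (\<integral>\<^sup>+v. ennreal (2 ^ k * (y + ln v) ^ k * exp (- y) / (v * fact k)) * indicator {a..1} v \<partial>lborel)"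
      by (intro nn_integral_cong) (auto simp: f_def indicator_def)
    also have "\<dots> = ennreal (G 1 - G a)"
    proof (rule nn_integral_FTC_Icc)
      fix v assume "v \<in> {a..1}"
      then have v: "a \<le> v" "v \<le> 1" by auto
      show "DERIV G v :> 2 ^ k * (y + ln v) ^ k * exp (- y) / (v * fact k)"
      proof -
        have "DERIV (\<lambda>v. y + ln v) v :> 1 / v"
          using v a by (auto intro!: derivative_eq_intros)
        from DERIV_cmult[OF DERIV_power_Suc[OF this, of k], of "2 ^ k * exp (- y) / (real (Suc k) * fact k)"]
        have "DERIV G v :> 2 ^ k * exp (- y) / (real (Suc k) * fact k) * ((1 + real k) * (1 / v * (y + ln v) ^ k))"
          by (simp only: G_def[abs_def] times_divide_eq_left)
        also have "2 ^ k * exp (- y) / (real (Suc k) * fact k) * ((1 + real k) * (1 / v * (y + ln v) ^ k)) =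
            ((1 + real k) / real (Suc k)) * (2 ^ k * (y + ln v) ^ k * exp (- y) / (v * fact k))"
          by (simp add: mult_ac)
        finally show ?thesis by simp
      qed
      show "0 \<le> 2 ^ k * (y + ln v) ^ k * exp (- y) / (v * fact k)"
        using v a ly[of v] by simp
    qed (use a in auto)
    finally have "(\<integral>v. gam r k (z * r * v) \<partial>U01) = enn2real (ennreal (G 1 - G a))"
      by (subst integral_eq_nn_integral) (simp_all add: gam_bounds)
    moreover have "0 \<le> G 1" using True by (simp add: G_def)
    moreover have "G a = 0" by (simp add: G_def a_def)
    ultimately have "(\<integral>v. gam r k (z * r * v) \<partial>U01) = G 1" by simp
    moreover have "gam r (Suc k) z = 2 * G 1"
      using True by (simp add: gS G_def field_simps)
    ultimately show ?thesis by simp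
  qed
qed

lemma integral_U01_reflect:
  fixes f :: "real \<Rightarrow> real"
  assumes [measurable]: "f \<in> borel_measurable borel" and "\<And>x. 0 \<le> f x"
  shows "(\<integral>v. f (1 - v) \<partial>U01) = (\<integral>v. f v \<partial>U01)"
  using nn_integral_U01_width[of "\<lambda>v. ennreal (f v)" True] assms
  by (simp add: integral_eq_nn_integral width_def)

text \<open>The quadratic term accounts for the nodes that reach the level simultaneously.\<close>

lemma peak_lower_bound:
  assumes r: "0 < r"
  shows "\<exists>C\<ge>0. \<forall>z>0. \<forall>c>0. measure S01 (peak r c) * gam r k z - C * (measure S01 (peak r c))\<^sup>2 \<le> measure S01 (peak r (c / z))"
proof (induction k)
  case 0
  show ?case
  proof (intro exI[of _ 0] conjI allI impI)
    fix z c :: real assume z: "0 < z" and c: "0 < c"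
    show "measure S01 (peak r c) * gam r 0 z - 0 * (measure S01 (peak r c))\<^sup>2 \<le> measure S01 (peak r (c / z))"
    proof (cases "0 \<le> ln z")
      case True
      have "c / z \<le> c" using True z c by (simp add: field_simps)
      then have "measure S01 (peak r c) \<le> measure S01 (peak r (c / z))"
        by (intro S01.finite_measure_mono peak_antimono) auto
      moreover have "measure S01 (peak r c) * gam r 0 z \<le> measure S01 (peak r c) * 1"
        using True by (intro mult_left_mono) (auto simp: gam_def)
      ultimately show ?thesis by simp
    qed (simp add: gam_def)
  qed simp
next
  case (Suc k)
  then obtain C where C: "0 \<le> C" "\<And>z c. 0 < z \<Longrightarrow> 0 < c \<Longrightarrow>
    measure S01 (peak r c) * gam r k z - C * (measure S01 (peak r c))\<^sup>2 \<le> measure S01 (peak r (c / z))"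
    by blast
  show ?case
  \<comment> \<open>Each child contributes an error \<open>C\<close>; the product term of
    inclusion-exclusion is at most the square of \<open>P * 2 ^ k\<close>, by
    \<open>gam_bounds\<close>.\<close>
  proof (intro exI[of _ "2 * C + 4 ^ k"] conjI allI impI)
    fix z c :: real assume z: "0 < z" and c: "0 < c"
    define P where "P = measure S01 (peak r c)"
    define h where "h v = (P * gam r k (z * r * v) - C * P\<^sup>2) + (P * gam r k (z * r * (1 - v)) - C * P\<^sup>2) - 4 ^ k * P\<^sup>2" for v
    have P: "0 \<le> P" "P \<le> 1" by (auto simp: P_def)
    have [measurable]: "h \<in> borel_measurable borel" unfolding h_def[abs_def] by measurable
    have int: "integrable U01 (\<lambda>v. gam r k (z * r * v))" "integrable U01 (\<lambda>v. gam r k (z * r * (1 - v)))"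
      by (rule integrable_gam; measurable)+
    have "(\<integral>v. h v \<partial>U01) \<le> measure S01 (peak r (c / z))"
    proof (rule peak_first_step[OF r])
      show "integrable U01 h" unfolding h_def[abs_def] using int by simp
    next
      fix v p q
      assume v: "0 < v" "v < 1" and p: "p = measure S01 (peak r (c / z / (r * v)))"
        and q: "q = measure S01 (peak r (c / z / (r * (1 - v))))"
      define x where "x = P * gam r k (z * r * v)"
      define x' where "x' = P * gam r k (z * r * (1 - v))"
      have le: "x - C * P\<^sup>2 \<le> p" "x' - C * P\<^sup>2 \<le> q"
        using C(2)[of "z * r * v" c] C(2)[of "z * r * (1 - v)" c] v z c r
        by (simp_all add: x_def x'_def p q P_def mult.assoc)
      have x: "0 \<le> x" "x \<le> P * 2 ^ k" "0 \<le> x'" "x' \<le> P * 2 ^ k"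
        unfolding x_def x'_def using P gam_bounds by (auto intro!: mult_left_mono)
      have "x * x' \<le> (P * 2 ^ k) * (P * 2 ^ k)"
        using x P by (intro mult_mono) auto
      also have "\<dots> = 4 ^ k * P\<^sup>2"
        by (simp add: power2_eq_square power_mult_distrib[symmetric] mult_ac)
      finally have xx: "x * x' \<le> 4 ^ k * P\<^sup>2" .
      \<comment> \<open>The lower bounds for \<open>p\<close> and \<open>q\<close> may be negative.
        Truncation at 0 keeps the product bound \<open>\<alpha> * \<beta> \<le> x * x'\<close>
        valid.\<close>
      define \<alpha> where "\<alpha> = max 0 (x - C * P\<^sup>2)"
      define \<beta> where "\<beta> = max 0 (x' - C * P\<^sup>2)"
      have pq: "0 \<le> p" "p \<le> 1" "0 \<le> q" "q \<le> 1" by (auto simp: p q)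
      have CP: "0 \<le> C * P\<^sup>2" using C(1) by simp
      have ab: "0 \<le> \<alpha>" "\<alpha> \<le> p" "\<alpha> \<le> x" "x - C * P\<^sup>2 \<le> \<alpha>" "0 \<le> \<beta>" "\<beta> \<le> q" "\<beta> \<le> x'" "x' - C * P\<^sup>2 \<le> \<beta>"
        using le pq x CP by (auto simp: \<alpha>_def \<beta>_def)
      have "(1 - p) * (1 - q) \<le> (1 - \<alpha>) * (1 - \<beta>)"
        using ab pq by (intro mult_mono) auto
      moreover have "\<alpha> * \<beta> \<le> x * x'" using ab x by (intro mult_mono) auto
      ultimately have "\<alpha> + \<beta> - x * x' \<le> p + q - p * q" by (simp add: algebra_simps)
      then show "h v \<le> p + q - p * q"
        using ab xx by (simp add: h_def x_def[symmetric] x'_def[symmetric])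
    qed measurable
    moreover have "(\<integral>v. h v \<partial>U01) = P * (2 * (\<integral>v. gam r k (z * r * v) \<partial>U01)) - (2 * C + 4 ^ k) * P\<^sup>2"
      using int integral_U01_reflect[of "\<lambda>v. gam r k (z * r * v)"]
      by (simp add: h_def[abs_def] gam_bounds U01.prob_space[simplified] algebra_simps)
    moreover have "P * gam r (Suc k) z \<le> P * (2 * (\<integral>v. gam r k (z * r * v) \<partial>U01))"
      using P by (intro mult_left_mono integral_gam r z) auto
    ultimately show "measure S01 (peak r c) * gam r (Suc k) z - (2 * C + 4 ^ k) * (measure S01 (peak r c))\<^sup>2
        \<le> measure S01 (peak r (c / z))"
      by (simp add: P_def)
  qed (use C in auto)
qed

text \<open>A crude Stirling bound; the induction step amounts to
  \<open>exp 1 \<le> (1 + 1 / k) ^ Suc k\<close>.\<close>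

lemma fact_le_power_exp: "1 \<le> k \<Longrightarrow> fact k \<le> real k * (real k ^ k * exp (1 - real k))"
proof (induction k rule: dec_induct)
  case (step k)
  have k: "0 < real k" using step by simp
  have "1 \<le> real (Suc k) * ln (1 + 1 / real k)"
  proof -
    have "ln (real k / real (Suc k)) \<le> real k / real (Suc k) - 1"
      using k by (intro ln_le_minus_one) auto
    also have "\<dots> = - (1 / real (Suc k))" using k by (simp add: field_simps)
    also have "ln (real k / real (Suc k)) = - ln (1 + 1 / real k)"
      using k by (simp add: ln_div[symmetric] field_simps flip: ln_inverse)
    finally show ?thesis by (simp add: field_simps)
  qed
  then have "exp 1 \<le> exp (real (Suc k) * ln (1 + 1 / real k))" by simp
  also have "\<dots> = (1 + 1 / real k) ^ Suc k"
    using k by (simp only: exp_of_nat_mult) (simp add: exp_ln add_pos_pos)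
  finally have "exp 1 \<le> (1 + 1 / real k) ^ Suc k" .
  then have e: "exp 1 * real k ^ Suc k \<le> real (Suc k) ^ Suc k"
  proof -
    have "1 + 1 / real k = real (Suc k) / real k" using k by (simp add: field_simps)
    then have "(1 + 1 / real k) ^ Suc k = real (Suc k) ^ Suc k / real k ^ Suc k"
      by (simp only: power_divide)
    then show ?thesis using \<open>exp 1 \<le> (1 + 1 / real k) ^ Suc k\<close> k by (simp only: pos_le_divide_eq zero_less_power)
  qed
  have "fact (Suc k) = real (Suc k) * fact k" by simp
  also have "\<dots> \<le> real (Suc k) * (real k * (real k ^ k * exp (1 - real k)))"
    using step by (intro mult_left_mono) auto
  also have "\<dots> = real (Suc k) * ((exp 1 * real k ^ Suc k) * exp (1 - real (Suc k)))"
  proof -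
    have "exp (1 - real k) = exp 1 * exp (1 - real (Suc k))" by (simp flip: exp_add)
    then show ?thesis by simp
  qed
  also have "\<dots> \<le> real (Suc k) * (real (Suc k) ^ Suc k * exp (1 - real (Suc k)))"
    using e by (intro mult_left_mono mult_right_mono) auto
  finally show ?case .
qed simp

text \<open>By the Stirling bound, \<open>gam r k 1\<close> is at least
  \<open>\<kappa> ^ k / (k * exp 1)\<close> with the supercritical ratio
  \<open>\<kappa> > 1\<close>.\<close>

lemma gam_supercritical:
  assumes r: "1 < r" "r < 2 * exp 1 * ln r"
  shows "\<exists>k. 1 < gam r k 1"
proof -
  define \<kappa> where "\<kappa> = 2 * exp 1 * ln r / r"
  have \<kappa>: "1 < \<kappa>" using r by (simp add: \<kappa>_def)
  have "(\<lambda>k. real k / \<kappa> ^ k) \<longlonglongrightarrow> 0"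
    using \<kappa> by (intro lim_n_over_pown) auto
  then have "eventually (\<lambda>k. real k / \<kappa> ^ k < exp (- 1)) sequentially"
    by (rule order_tendstoD) simp
  then have "eventually (\<lambda>k. real k / \<kappa> ^ k < exp (- 1) \<and> 1 \<le> k) sequentially"
    using eventually_ge_at_top[of 1] by eventually_elim simp
  then obtain k where k: "real k / \<kappa> ^ k < exp (- 1)" "1 \<le> k"
    using eventually_happens'[OF sequentially_bot] by blast
  have L: "0 < ln r" using r by simp
  have "real k * exp 1 < \<kappa> ^ k"
    using k \<kappa> by (simp add: exp_minus field_simps)
  also have "\<kappa> ^ k = 2 ^ k * ln r ^ k * exp (- (real k * ln r)) * exp (real k)"
  proof -
    have "exp (real k * ln r) = r ^ k" using r by (simp add: exp_of_nat_mult)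
    moreover have "exp (real k) = exp 1 ^ k" using exp_of_nat_mult[of k 1] by simp
    ultimately show ?thesis
      by (simp add: \<kappa>_def exp_minus power_mult_distrib power_divide field_simps)
  qed
  finally have *: "real k * exp 1 < 2 ^ k * ln r ^ k * exp (- (real k * ln r)) * exp (real k)" .
  have "fact k \<le> real k * (real k ^ k * exp (1 - real k))"
    by (rule fact_le_power_exp[OF k(2)])
  also have "\<dots> = (real k * exp 1) * (real k ^ k * exp (- real k))"
    by (simp add: exp_diff exp_minus field_simps)
  also have "\<dots> < (2 ^ k * ln r ^ k * exp (- (real k * ln r)) * exp (real k)) * (real k ^ k * exp (- real k))"
    using k(2) by (intro mult_strict_right_mono *) simp
  also have "\<dots> = 2 ^ k * (real k * ln r) ^ k * exp (- (real k * ln r))"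
    by (simp add: power_mult_distrib exp_minus field_simps)
  finally have "1 < gam r k 1"
    using L by (simp add: gam_def Let_def)
  then show ?thesis ..
qed

text \<open>With positive probability the first pivot is at least \<open>1 / sqrt r\<close>; passing
  to its left child then gains a factor of at least \<open>sqrt r\<close>. Iterating reaches every
  level. Positivity is needed because the uniform lower bound is obtained by dividing by this
  probability.\<close>

lemma peak_pos:
  assumes r: "1 < r"
  shows "0 < measure S01 (peak r c)"
proof -
  define x where "x = sqrt r"
  have x: "1 < x" "x * x = r" using r by (auto simp: x_def)
  have step: "0 < measure S01 (peak r (d * x))" if d: "0 < d" "0 < measure S01 (peak r d)" for d
  proof -
    define P where "P = measure S01 (peak r d)"
    have le1: "P \<le> 1" by (simp add: P_def)
    have "(\<integral>v. P * indicator {1 / x..} v \<partial>U01) \<le> measure S01 (peak r (d * x))"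
    proof (rule peak_first_step)
      fix v p q
      assume v: "0 < v" "v < 1" and p: "p = measure S01 (peak r (d * x / (r * v)))"
        and q: "q = measure S01 (peak r (d * x / (r * (1 - v))))"
      have pq: "0 \<le> p" "p \<le> 1" "0 \<le> q" "q \<le> 1" by (auto simp: p q)
      have "0 \<le> q * (1 - p)" using pq by simp
      then have "p \<le> p + q - p * q" by (simp add: algebra_simps)
      moreover have "P * indicator {1 / x..} v \<le> p"
      proof (cases "1 / x \<le> v")
        case True
        have "x * 1 \<le> x * (x * v)" using True x v by (intro mult_left_mono) (auto simp: field_simps)
        then have "x \<le> r * v" using x by (simp add: mult.assoc[symmetric])
        then have "d * x / (r * v) \<le> d" using v r d by (simp add: field_simps)
        then show ?thesis using True unfolding p P_def
          by (simp add: S01.finite_measure_mono peak_antimono)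
      qed (use pq in simp)
      ultimately show "P * indicator {1 / x..} v \<le> p + q - p * q" by linarith
    next
      show "integrable U01 (\<lambda>v. P * indicator {1 / x..} v :: real)"
        by (rule U01.integrable_const_bound[where B = 1]) (use le1 in \<open>auto simp: indicator_def P_def\<close>)
    qed (use r in auto)
    moreover have "(\<integral>v. P * indicator {1 / x..} v \<partial>U01) = P * measure U01 {1 / x..}"
      by simp
    moreover have "0 < measure U01 {1 / x..}"
    proof -
      have "measure U01 {1 / x..} = measure lborel ({0<..<1} \<inter> {1 / x..})"
        unfolding U01_def by (subst measure_uniform_measure) auto
      also have "{0<..<1} \<inter> {1 / x..} = {1 / x..<1}"
      proof -
        have "0 < y" if "1 / x \<le> y" for y
          using that x divide_pos_pos[of 1 x] by linarith
        then show ?thesis by auto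
      qed
      finally show ?thesis using x by simp
    qed
    moreover have "0 < P" using d(2) by (simp add: P_def)
    ultimately show ?thesis using mult_pos_pos[of P "measure U01 {1 / x..}"] by linarith
  qed
  have "0 < measure S01 (peak r (x ^ n))" for n
  proof (induction n)
    case 0
    have "peak r 1 = UNIV" by (auto simp: peak_def intro!: exI[of _ "[]"])
    then show ?case using S01.prob_space by simp
  next
    case (Suc n)
    then show ?case using step[of "x ^ n"] x by (simp add: mult.commute)
  qed
  moreover obtain n where "c < x ^ n" using real_arch_pow[OF x(1)] by blast
  then have "measure S01 (peak r (x ^ n)) \<le> measure S01 (peak r c)"
    by (intro S01.finite_measure_mono peak_antimono) auto
  ultimately show ?thesis by (meson less_le_trans)
qed

text \<open>At \<open>z = 1\<close> the lower bound reads
  \<open>P * gam r k 1 - C * P^2 \<le> P\<close>, and division by \<open>P > 0\<close> keeps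
  \<open>P\<close> away from 0 uniformly in the level. So unboundedness has positive probability.
  Its failure requires failure in both independent halves, hence
  \<open>\<pi> \<le> \<pi> * \<pi>\<close>, and \<open>\<pi> < 1\<close> leaves only
  \<open>\<pi> = 0\<close>.\<close>

theorem AE_peaks_unbounded:
  assumes r: "1 < r" "r < 2 * exp 1 * ln r"
  shows "AE t in S01. \<forall>c. \<exists>u. c \<le> r ^ length u * Lam u t"
proof -
  obtain k where k: "1 < gam r k 1" using gam_supercritical[OF r] by blast
  have "0 < r" using r by simp
  from peak_lower_bound[OF this, of k]
  obtain C where C: "0 \<le> C" "\<And>z c. 0 < z \<Longrightarrow> 0 < c \<Longrightarrow>
    measure S01 (peak r c) * gam r k z - C * (measure S01 (peak r c))\<^sup>2 \<le> measure S01 (peak r (c / z))"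
    by blast
  \<comment> \<open>\<open>C + 1\<close> guards against \<open>C = 0\<close>.\<close>
  define \<delta> where "\<delta> = (gam r k 1 - 1) / (C + 1)"
  have \<delta>: "0 < \<delta>" using k C by (simp add: \<delta>_def)
  have lower: "\<delta> \<le> measure S01 (peak r c)" if c: "0 < c" for c
  proof -
    define P where "P = measure S01 (peak r c)"
    have P: "0 < P" unfolding P_def by (rule peak_pos[OF r(1)])
    have "P * gam r k 1 - C * P\<^sup>2 \<le> P" using C(2)[of 1 c] c by (simp add: P_def)
    then have "P * (gam r k 1 - 1 - C * P) \<le> P * 0" by (simp add: algebra_simps power2_eq_square)
    then have "gam r k 1 - 1 \<le> C * P" using P by (simp add: mult_le_0_iff)
    also have "\<dots> \<le> (C + 1) * P" using P by (simp add: algebra_simps)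
    finally show ?thesis using C by (simp add: \<delta>_def P_def field_simps)
  qed
  define I where "I = (\<Inter>n. peak r (real (Suc n)))"
  have I[measurable]: "I \<in> sets (stream_space borel)" unfolding I_def by measurable
  have "(\<lambda>n. measure S01 (peak r (real (Suc n)))) \<longlonglongrightarrow> measure S01 I"
    unfolding I_def
    by (rule S01.finite_Lim_measure_decseq) (auto simp: decseq_def intro!: peak_antimono)
  then have "\<delta> \<le> measure S01 I"
    by (rule LIMSEQ_le_const) (use lower in auto)
  with \<delta> have I_pos: "0 < measure S01 I" by linarith
  define J where "J = UNIV - I"
  have J[measurable]: "J \<in> sets (stream_space borel)"
    using sets.compl_sets[OF I] by (simp add: J_def space_stream_space)
  have I_iff: "t \<in> I \<longleftrightarrow> (\<forall>c. \<exists>u. c \<le> r ^ length u * Lam u t)" for t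
  proof
    assume t: "t \<in> I"
    show "\<forall>c. \<exists>u. c \<le> r ^ length u * Lam u t"
    proof
      fix c :: real
      obtain n where "c \<le> real n" using real_arch_simple by blast
      then have "c \<le> real (Suc n)" by simp
      moreover have "t \<in> peak r (real (Suc n))" using t by (simp add: I_def)
      ultimately show "\<exists>u. c \<le> r ^ length u * Lam u t" unfolding peak_def by (blast intro: order_trans)
    qed
  qed (simp add: I_def peak_def)
  define \<pi> where "\<pi> = measure S01 J"
  have "ennreal \<pi> = (\<integral>\<^sup>+v. \<P>(s in S01. v ## s \<in> J) \<partial>U01)"
    using U01.prob_stream_space[of "\<lambda>t. t \<in> J"] by (simp add: \<pi>_def)
  also have "\<dots> \<le> (\<integral>\<^sup>+v. ennreal (\<pi> * \<pi>) \<partial>U01)"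
  proof (rule nn_integral_mono_AE, use AE_U01 in eventually_elim)
    case (elim v)
    then have v: "0 < v" "v < 1" by auto
    have "v ## s \<in> I" if "child b v s \<in> I" for b s
      unfolding I_def
    proof
      fix n
      have "child b v s \<in> peak r (real (Suc n) / (r * width b v))"
        using that unfolding I_iff peak_def by blast
      then show "v ## s \<in> peak r (real (Suc n))"
        using r v by (intro peak_child) auto
    qed
    then have "\<P>(s in S01. v ## s \<in> J) \<le> \<P>(s in S01. child False v s \<in> J \<and> child True v s \<in> J)"
      by (intro S01.finite_measure_mono, force simp: J_def, measurable)
    also have "\<dots> = \<pi> * \<pi>" using child_indep[OF v, of J J] by (simp add: \<pi>_def)
    finally show ?case by (rule ennreal_leI)
  qed
  also have "\<dots> = ennreal (\<pi> * \<pi>)" using U01.emeasure_space_1 by simp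
  finally have "\<pi> \<le> \<pi> * \<pi>" by (simp add: \<pi>_def)
  moreover have "\<pi> = 1 - measure S01 I"
    using S01.prob_compl[of I] by (simp add: \<pi>_def J_def)
  ultimately have "(1 - measure S01 I) * measure S01 I \<le> 0" by (simp add: algebra_simps)
  with I_pos have "1 \<le> measure S01 I"
    by (simp add: mult_le_0_iff)
  then have "measure S01 I = 1" by (simp add: antisym)
  then have "AE t in S01. t \<in> I" by (subst S01.prob_eq_1[symmetric]) auto
  then show ?thesis by (simp add: I_iff)
qed

section \<open>The critical weight\<close>

text \<open>The derivative \<open>2 * exp 1 / z - 1\<close> is positive up to the maximiser
  \<open>2 * exp 1\<close>, which separates the two roots.\<close>

lemma crit_strict_mono:
  assumes "0 < x" "x < y" "y < 2 * exp 1"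
  shows "2 * exp 1 * ln x - x < 2 * exp 1 * ln y - (y :: real)"
proof (rule DERIV_pos_imp_increasing[OF assms(2)])
  fix z assume z: "x \<le> z" "z \<le> y"
  have "((\<lambda>r. 2 * exp 1 * ln r - r) has_real_derivative (2 * exp 1 / z - 1)) (at z)"
    using z assms by (auto intro!: derivative_eq_intros)
  moreover have "0 < 2 * exp 1 / z - 1" using z assms by (simp add: field_simps)
  ultimately show "\<exists>d. ((\<lambda>r. 2 * exp 1 * ln r - r) has_real_derivative d) (at z) \<and> 0 < d" by blast
qed

lemma exp_half_less: "exp (1 / 2) < 2 * exp (1 :: real)"
proof -
  have "exp (1 / 2) < (exp 1 :: real)" "0 < exp (1 :: real)" by simp_all
  then show ?thesis by linarith
qed

text \<open>The function is negative at 1 and positive at \<open>exp (1 / 2)\<close>; monotonicity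
  below \<open>2 * exp 1\<close> excludes a smaller root. The bound \<open>exp (1 / 2)\<close> later
  gives the moment exponent \<open>s \<ge> 1\<close> and \<open>\<rho> < 4\<close>.\<close>

lemma rho0_root: "1 < rho0" "rho0 < exp (1 / 2)" "2 * exp 1 * ln rho0 = rho0"
proof -
  define f where "f r = 2 * exp 1 * ln r - (r :: real)" for r
  have e: "exp (1 / 2) * exp (1 / 2) = (exp 1 :: real)" by (simp flip: exp_add)
  have e1: "1 < (exp (1 / 2) :: real)" by simp
  have "exp (1 / 2) * 1 < exp (1 / 2) * (exp (1 / 2) :: real)"
    using e1 by (intro mult_strict_left_mono) auto
  then have "0 < f (exp (1 / 2))" by (simp add: f_def e)
  moreover have "f 1 < 0" by (simp add: f_def)
  moreover have "\<exists>x. 1 \<le> x \<and> x \<le> exp (1 / 2) \<and> f x = 0"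
    using calculation e1 by (intro IVT') (auto simp: f_def intro!: continuous_intros)
  ultimately obtain x where x: "1 < x" "x < exp (1 / 2)" "f x = 0"
    by (metis less_eq_real_def order_less_irrefl)
  have x2: "x < 2 * exp 1"
    using x(2) exp_half_less by linarith
  have "rho0 = x"
    unfolding rho0_def
  proof (rule Least_equality)
    show "0 < x \<and> 2 * exp 1 * ln x = x" using x by (simp add: f_def)
    fix y :: real assume y: "0 < y \<and> 2 * exp 1 * ln y = y"
    show "x \<le> y"
      using crit_strict_mono[of y x] x y x2 by (force simp: f_def)
  qed
  then show "1 < rho0" "rho0 < exp (1 / 2)" "2 * exp 1 * ln rho0 = rho0"
    using x by (simp_all add: f_def)
qed

lemma below_rho0:
  assumes "0 < r" "r < rho0"
  shows "2 * exp 1 * ln r < r"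
proof -
  have "rho0 < 2 * exp 1" using rho0_root(2) exp_half_less by linarith
  then show ?thesis using crit_strict_mono[OF assms] rho0_root(3) by simp
qed

text \<open>\<open>r \<le> exp 1\<close> keeps \<open>r\<close> below the maximiser and hence below
  the second root.\<close>

lemma above_rho0:
  assumes "rho0 < r" "r \<le> exp 1"
  shows "r < 2 * exp 1 * ln r"
proof -
  have "r < 2 * exp 1" using assms(2) by (smt (verit) exp_gt_zero)
  then show ?thesis using crit_strict_mono[of rho0 r] assms rho0_root by simp
qed

lemma subcritical_exponent:
  assumes "1 \<le> \<rho>" "\<rho> < rho0"
  shows "\<exists>r s. \<rho> < r \<and> r < rho0 \<and> 1 \<le> s \<and> 2 * r powr s / (1 + s) \<le> 1"
proof -
  \<comment> \<open>The gap between \<open>\<rho>\<close> and \<open>r\<close> later produces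
    geometric decay over the levels.\<close>
  define r where "r = (\<rho> + rho0) / 2"
  \<comment> \<open>The zero of the derivative of \<open>r powr s / (1 + s)\<close> in
    \<open>s\<close>.\<close>
  define s where "s = 1 / ln r - 1"
  have r: "\<rho> < r" "r < rho0" "1 < r" using assms by (auto simp: r_def)
  then have L: "0 < ln r" by simp
  have "ln r \<le> ln (exp (1 / 2))"
    using r rho0_root(2) by (intro ln_mono) auto
  then have L2: "ln r \<le> 1 / 2" by simp
  have s: "1 \<le> s" using L L2 by (simp add: s_def field_simps)
  have "s * ln r = 1 - ln r" using L by (simp add: s_def field_simps)
  then have "r powr s = exp 1 / r" using r by (simp add: powr_def exp_diff)
  moreover have "1 + s = 1 / ln r" by (simp add: s_def)
  ultimately have "2 * r powr s / (1 + s) = 2 * exp 1 * ln r / r" by simp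
  also have "\<dots> \<le> 1" using below_rho0[of r] r by simp
  finally show ?thesis using r s by blast
qed

section \<open>Uniform control of the relative subtree sizes\<close>

text \<open>An interval of length at most \<open>2 ^ (- i)\<close> fits into one of twice that
  length starting at a grid point. At time \<open>2 ^ (i + j)\<close> the latter expects at most
  \<open>2 * 2 ^ j\<close> values; crowded means an excess by a factor of order
  \<open>l\<close>.\<close>

definition crowded :: "real \<Rightarrow> nat \<Rightarrow> nat \<Rightarrow> nat \<Rightarrow> nat \<Rightarrow> real stream set" where
  "crowded b l i a j = {s. b * real l * 2 ^ j \<le> real (cnt {real a / 2 ^ i..(real a + 2) / 2 ^ i} (2 ^ (i + j)) s)}"

text \<open>The scales stop at \<open>2 * l\<close>: shorter intervals are enlarged to length
  \<open>4 ^ (- l)\<close>, which costs only a summable term.\<close>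

definition bad :: "real \<Rightarrow> nat \<Rightarrow> real stream set" where
  "bad b l = (\<Union>i\<in>{..2 * l}. \<Union>a\<in>{..<2 ^ i}. \<Union>j. crowded b l i a j)"

lemma sets_crowded [measurable]: "crowded b l i a j \<in> sets (stream_space borel)"
proof -
  have "{s \<in> space (stream_space borel). b * real l * 2 ^ j \<le>
      real (cnt {real a / 2 ^ i..(real a + 2) / 2 ^ i} (2 ^ (i + j)) s)} \<in> sets (stream_space borel)"
    by measurable
  then show ?thesis by (simp add: crowded_def space_stream_space)
qed

lemma sets_bad [measurable]: "bad b l \<in> sets (stream_space borel)"
  unfolding bad_def by measurable

lemma measure_crowded:
  assumes \<theta>: "0 \<le> \<theta>"
  shows "measure S01 (crowded b l i a j) \<le> exp (2 ^ j * (2 * (exp \<theta> - 1) - \<theta> * b * real l))"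
proof -
  let ?A = "{real a / 2 ^ i..(real a + 2) / 2 ^ i}"
  have "measure U01 ?A = measure lborel ({0<..<1} \<inter> ?A)"
    unfolding U01_def by (subst measure_uniform_measure) simp_all
  also have "\<dots> \<le> measure lborel ?A"
    by (rule measure_mono_fmeasurable) (auto simp: fmeasurable_def emeasure_lborel_Icc_eq)
  also have "\<dots> = 2 / 2 ^ i" by (simp add: field_simps)
  finally have p: "measure U01 ?A \<le> 2 / 2 ^ i" .
  have "measure S01 (crowded b l i a j) \<le>
      exp (real (2 ^ (i + j)) * measure U01 ?A * (exp \<theta> - 1) - \<theta> * (b * real l * 2 ^ j))"
    using cnt_chernoff[of ?A \<theta> "b * real l * 2 ^ j" "2 ^ (i + j)"] \<theta> by (simp add: crowded_def)
  also have "real (2 ^ (i + j)) * measure U01 ?A * (exp \<theta> - 1) \<le> real (2 ^ (i + j)) * (2 / 2 ^ i) * (exp \<theta> - 1)"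
    using p \<theta> by (intro mult_right_mono mult_left_mono) auto
  also have "real (2 ^ (i + j)) * (2 / 2 ^ i) * (exp \<theta> - 1) - \<theta> * (b * real l * 2 ^ j) =
      2 ^ j * (2 * (exp \<theta> - 1) - \<theta> * b * real l)"
    by (simp add: power_add field_simps)
  finally show ?thesis by simp
qed

text \<open>There are fewer than \<open>2 * 4 ^ l\<close> pairs of scale and grid point, and for
  each of them the sum over the times is at most \<open>2 * (1 / 16) ^ l\<close>. The resulting
  decay \<open>4 ^ (- l)\<close> beats the weight \<open>\<rho> ^ l\<close>.\<close>

lemma measure_bad:
  assumes b: "0 < b"
  shows "\<exists>L. \<forall>l\<ge>L. measure S01 (bad b l) \<le> 4 * (1 / 4) ^ l"
proof -
  \<comment> \<open>This turns the Chernoff exponent into \<open>2 ^ j * (K - 5 * l)\<close>, at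
    most \<open>- 4 * l * 2 ^ j\<close> once \<open>l \<ge> K\<close>; and
    \<open>exp (- 4) \<le> 1 / 16\<close>.\<close>
  define \<theta> where "\<theta> = 5 / b"
  define K where "K = 2 * (exp \<theta> - 1)"
  obtain L where L: "max 1 K \<le> real L" using real_arch_simple by blast
  have "measure S01 (bad b l) \<le> 4 * (1 / 4) ^ l" if "L \<le> l" for l
  proof -
    have l: "1 \<le> real l" "K \<le> real l" using that L by linarith+
    define q where "q = exp (- 4 * real l)"
    have q: "0 < q" "q \<le> (1 / 16) ^ l" "q \<le> 1 / 2"
    proof -
      have "(16 :: real) \<le> exp 4"
      proof -
        have "(2 :: real) ^ 4 \<le> exp 1 ^ 4"
          using exp_ge_add_one_self[of "1 :: real"] by (intro power_mono) auto
        then show ?thesis by (simp flip: exp_of_nat_mult)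
      qed
      then have "exp (- 4) \<le> (1 / 16 :: real)" by (simp add: exp_minus field_simps)
      then have "exp (- 4) ^ l \<le> (1 / 16 :: real) ^ l" by (intro power_mono) auto
      moreover have "q = exp (- 4) ^ l" by (simp add: q_def mult.commute flip: exp_of_nat_mult)
      ultimately show "q \<le> (1 / 16) ^ l" by simp
      also have "\<dots> \<le> (1 / 16) ^ 1" using l by (intro power_decreasing) auto
      finally show "q \<le> 1 / 2" by simp
      show "0 < q" by (simp add: q_def)
    qed
    have cr: "measure S01 (crowded b l i a j) \<le> q * q ^ j" for i a j
    proof -
      have j: "real (Suc j) \<le> 2 ^ j" using Suc_leI[OF less_exp[of j]] by (metis of_nat_le_iff of_nat_numeral of_nat_power)
      have "measure S01 (crowded b l i a j) \<le> exp (2 ^ j * (K - 5 * real l))"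
        using measure_crowded[of \<theta> b l i a j] b by (simp add: K_def \<theta>_def)
      also have "\<dots> \<le> exp (real (Suc j) * (- 4 * real l))"
      proof -
        have "2 ^ j * (K - 5 * real l) \<le> 2 ^ j * (- 4 * real l)"
          using l by (intro mult_left_mono) auto
        also have "\<dots> \<le> real (Suc j) * (- 4 * real l)"
          using j l by (intro mult_right_mono_neg) auto
        finally show ?thesis by simp
      qed
      also have "\<dots> = q ^ Suc j" by (simp only: exp_of_nat_mult q_def)
      finally show ?thesis by simp
    qed
    have sq: "summable (\<lambda>j. q * q ^ j)" "(\<Sum>j. q * q ^ j) \<le> 2 * q"
    proof -
      have s: "summable (\<lambda>j. q ^ j)" using q by (intro summable_geometric) auto
      then show "summable (\<lambda>j. q * q ^ j)" by (rule summable_mult)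
      have "(\<Sum>j. q * q ^ j) = q * (1 / (1 - q))"
        using q by (subst suminf_mult[OF s]) (simp add: suminf_geometric)
      also have "\<dots> \<le> q * 2" using q by (intro mult_left_mono) (auto simp: field_simps)
      finally show "(\<Sum>j. q * q ^ j) \<le> 2 * q" by simp
    qed
    have row: "measure S01 (\<Union>j. crowded b l i a j) \<le> 2 * q" for i a
    proof -
      have s: "summable (\<lambda>j. measure S01 (crowded b l i a j))"
        by (rule summable_comparison_test'[OF sq(1), where N = 0]) (simp add: cr)
      have "measure S01 (\<Union>j. crowded b l i a j) \<le> (\<Sum>j. measure S01 (crowded b l i a j))"
        by (rule S01.finite_measure_subadditive_countably) (auto simp: s)
      also have "\<dots> \<le> (\<Sum>j. q * q ^ j)" by (rule suminf_le[OF _ s sq(1)]) (rule cr)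
      finally show ?thesis using sq(2) by simp
    qed
    have "measure S01 (bad b l) \<le> (\<Sum>i\<in>{..2 * l}. measure S01 (\<Union>a\<in>{..<2 ^ i}. \<Union>j. crowded b l i a j))"
      unfolding bad_def by (rule S01.finite_measure_subadditive_finite) auto
    also have "\<dots> \<le> (\<Sum>i\<in>{..2 * l}. \<Sum>a\<in>{..<2 ^ i :: nat}. measure S01 (\<Union>j. crowded b l i a j))"
      by (intro sum_mono S01.finite_measure_subadditive_finite) auto
    also have "\<dots> \<le> (\<Sum>i\<in>{..2 * l}. \<Sum>a\<in>{..<2 ^ i :: nat}. 2 * q)"
      by (intro sum_mono row)
    also have "\<dots> = (\<Sum>i<Suc (2 * l). 2 ^ i) * (2 * q)"
      by (simp add: lessThan_Suc_atMost sum_distrib_right)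
    also have "(\<Sum>i<Suc (2 * l). 2 ^ i) = (2 ^ Suc (2 * l) - 1 :: real)"
      by (subst geometric_sum) simp_all
    also have "(2 ^ Suc (2 * l) - 1 :: real) * (2 * q) \<le> 2 ^ Suc (2 * l) * (2 * (1 / 16) ^ l)"
      using q by (intro mult_mono) auto
    also have "\<dots> = 4 * (1 / 4) ^ l"
      by (simp add: power_mult power_divide power2_eq_square flip: power_mult_distrib)
        (simp add: field_simps flip: power_mult_distrib)
    finally show ?thesis .
  qed
  then show ?thesis by blast
qed

text \<open>Since \<open>u\<close> is occupied, its ancestor \<open>take k u\<close> holds more than
  \<open>l - k \<ge> b * l\<close> values. Outside \<open>bad b l\<close> this is impossible before
  a time comparable to the inverse of the ancestor's interval, enlarged to \<open>4 ^ (- l)\<close>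
  if shorter; at later times the count is bounded at the next dyadic time. The constant 4 is a
  factor 2 from rounding the length times a factor 2 from rounding the time.\<close>

lemma relative_size_bound:
  assumes good: "good (take k u) t" and t: "t \<notin> bad b l" and u: "length u = l" and k: "b * real l \<le> real (l - k)"
    and ne: "sub u (stake n t) \<noteq> []" and b: "0 \<le> b"
  shows "real (length (sub u (stake n t))) / real n \<le> 4 * b * real l * max (Lam (take k u) t) ((1 / 4) ^ l)"
proof -
  define u' where "u' = take k u"
  define \<Lambda> where "\<Lambda> = Lam u' t"
  define x where "x = lo u' t"
  have x: "0 < \<Lambda>" "0 \<le> x" "x + \<Lambda> \<le> 1"
    using Lam_lo_bounds[OF good] by (simp_all add: \<Lambda>_def x_def u'_def)
  have split: "u = u' @ drop k u" by (simp add: u'_def)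
  have "length (drop k u) < length (sub u' (stake n t))"
    using ne split length_sub_append[of u' "drop k u" "stake n t"] by simp
  then have many: "l - k < length (sub u' (stake n t))" using u by simp
  \<comment> \<open>The finest dyadic scale not below the interval length is wanted, capped at the
    last scale covered by \<open>bad\<close>.\<close>
  define P where "P i \<longleftrightarrow> i \<le> 2 * l \<and> \<Lambda> \<le> (1 / 2) ^ i" for i
  define i where "i = Greatest P"
  have "P 0" using x by (simp add: P_def)
  then have Pi: "P i" and max: "\<And>j. P j \<Longrightarrow> j \<le> i"
    unfolding i_def using GreatestI_nat[of P 0 "2 * l"] Greatest_le_nat[of P _ "2 * l"] by (auto simp: P_def)
  have scale: "(1 / 2) ^ i \<le> 2 * max \<Lambda> ((1 / 4) ^ l)"
  proof (cases "i = 2 * l")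
    case True
    then have "(1 / 2 :: real) ^ i = (1 / 4) ^ l" by (simp add: power_mult power2_eq_square)
    moreover have "(1 / 4) ^ l \<le> max \<Lambda> ((1 / 4) ^ l)" "(0 :: real) \<le> (1 / 4) ^ l" by simp_all
    ultimately show ?thesis by linarith
  next
    case False
    have "\<not> P (Suc i)" using max[of "Suc i"] by auto
    then have "(1 / 2) ^ Suc i < \<Lambda>" using False Pi by (auto simp: P_def)
    then show ?thesis by simp
  qed
  \<comment> \<open>The left endpoint is rounded down to the grid, which is why the grid intervals
    have double length.\<close>
  define a where "a = nat \<lfloor>2 ^ i * x\<rfloor>"
  have a: "real a \<le> 2 ^ i * x" "2 ^ i * x < real a + 1"
    using x unfolding a_def by (auto simp: of_nat_nat)
  have "x < 1" using x by linarith
  then have "2 ^ i * x < 2 ^ i * 1" by (intro mult_strict_left_mono) auto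
  then have "real a < 2 ^ i" using a by linarith
  then have ai: "a < 2 ^ i" by (metis of_nat_less_iff of_nat_numeral of_nat_power)
  define D where "D = {real a / 2 ^ i..(real a + 2) / 2 ^ i}"
  have sub: "{x..x + \<Lambda>} \<subseteq> D"
  proof -
    have "real a / 2 ^ i \<le> x" using a by (simp add: field_simps)
    moreover have "x + \<Lambda> \<le> (real a + 2) / 2 ^ i"
    proof -
      have "x \<le> (real a + 1) / 2 ^ i" using a by (simp add: field_simps)
      moreover have "\<Lambda> \<le> 1 / 2 ^ i" using Pi by (simp add: P_def power_one_over)
      ultimately show ?thesis by (simp add: add_divide_distrib)
    qed
    ultimately show ?thesis by (auto simp: D_def)
  qed
  have cnt: "real (cnt D (2 ^ (i + j)) t) < b * real l * 2 ^ j" for j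
    using t Pi ai by (auto simp: bad_def crowded_def D_def P_def not_le)
  have le: "length (sub u' (stake n t)) \<le> cnt D m t" if "n \<le> m" for m
    using length_sub_le_cnt[OF good, of n] cnt_mono[OF sub that, of t]
    unfolding u'_def[symmetric] x_def[symmetric] \<Lambda>_def[symmetric] by linarith
  \<comment> \<open>Up to time \<open>2 ^ i\<close> the case \<open>j = 0\<close> allows fewer than
    \<open>b * l\<close> values, too few for the path from the ancestor to \<open>u\<close>.\<close>
  have "2 ^ i < n"
  proof (rule ccontr)
    assume "\<not> 2 ^ i < n"
    then have "length (sub u' (stake n t)) \<le> cnt D (2 ^ (i + 0)) t" by (intro le) simp
    with cnt[of 0] many k show False by simp
  qed
  \<comment> \<open>The first dyadic time at or after \<open>n\<close>; it is less than
    \<open>2 * n\<close>.\<close>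
  define j where "j = (LEAST j. n \<le> 2 ^ (i + j))"
  have "n \<le> 2 ^ (i + n)"
    by (metis less_exp less_imp_le order_trans power_increasing one_le_numeral le_add2)
  then have nj: "n \<le> 2 ^ (i + j)" unfolding j_def by (rule LeastI)
  have "j \<noteq> 0" using nj \<open>2 ^ i < n\<close> by (intro notI) simp
  then obtain j' where j': "j = Suc j'" by (cases j) auto
  have "\<not> n \<le> 2 ^ (i + j')" using not_less_Least[of j' "\<lambda>j. n \<le> 2 ^ (i + j)"] j' by (simp add: j_def)
  then have nj': "2 ^ (i + j') < real n" by (metis not_le of_nat_less_iff of_nat_numeral of_nat_power)
  have "real (length (sub u (stake n t))) \<le> real (length (sub u' (stake n t)))"
    using length_sub_append_le[of u' "drop k u" "stake n t"] split by simp
  also have "\<dots> \<le> real (cnt D (2 ^ (i + j)) t)" using le[OF nj] by simp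
  also have "\<dots> \<le> b * real l * 2 ^ j" using cnt[of j] by simp
  also have "\<dots> = (2 * b * real l * (1 / 2) ^ i) * 2 ^ (i + j')"
    by (simp add: j' power_add power_one_over)
  also have "\<dots> \<le> (2 * b * real l * (1 / 2) ^ i) * real n"
    using nj' b by (intro mult_left_mono) auto
  finally have "real (length (sub u (stake n t))) / real n \<le> 2 * b * real l * (1 / 2) ^ i"
    using \<open>2 ^ i < n\<close> by (simp add: pos_divide_le_eq)
  also have "\<dots> \<le> 2 * b * real l * (2 * max \<Lambda> ((1 / 4) ^ l))"
    using scale b by (intro mult_left_mono) auto
  finally show ?thesis by (simp add: \<Lambda>_def u'_def mult_ac)
qed

section \<open>A dominating function for the relative sizes at each depth\<close>

lemma summable_mult_geometric:
  fixes x :: real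
  assumes "0 \<le> x" "x < 1"
  shows "summable (\<lambda>l. real (Suc l) * x ^ l)"
  using geometric_deriv_sums[of x] assms by (intro sums_summable) auto

text \<open>For \<open>y > 1 / R\<close> write \<open>y\<close> as
  \<open>y powr (1 - s) * y powr s\<close> and use \<open>1 - s \<le> 0\<close>. Thus a maximum over
  a level is controlled by a sum of \<open>s\<close>-th powers, whose mean is known.\<close>

lemma le_power_sum:
  fixes y R s S :: real
  assumes "0 < y" "0 < R" "1 \<le> s" "y powr s \<le> S"
  shows "y \<le> 1 / R + R powr (s - 1) * S"
proof (cases "y \<le> 1 / R")
  case True
  have "0 \<le> R powr (s - 1) * S" using assms by (intro mult_nonneg_nonneg order_trans[OF powr_ge_zero assms(4)]) auto
  then show ?thesis using True by linarith
next
  case False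
  have "y = y powr (1 - s) * y powr s" using assms by (simp flip: powr_add)
  also have "\<dots> \<le> (1 / R) powr (1 - s) * S"
    using assms False by (intro mult_mono powr_mono2') auto
  also have "(1 / R) powr (1 - s) = R powr (s - 1)"
    using assms by (simp add: powr_def ln_div algebra_simps)
  finally show ?thesis using assms by (simp add: add_increasing)
qed

text \<open>An upper bound for all relative subtree sizes at depth \<open>l\<close>, at all times. Taking
  \<open>k\<close> a little smaller than \<open>l\<close>, the first term controls the interval lengths at depth \<open>k\<close>; the
  indicator of the overcrowded samples has expectation \<open>O(4 ^ (- l))\<close>.\<close>

definition envelope :: "real \<Rightarrow> real \<Rightarrow> real \<Rightarrow> nat \<Rightarrow> nat \<Rightarrow> real stream \<Rightarrow> real" where
  "envelope b r s k l t =
     4 * b * real l * (1 / r ^ k + (r ^ k) powr (s - 1) * (\<Sum>u | length u = k. Lam u t powr s) + (1 / 4) ^ l)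
       + indicator (bad b l) t"

lemma measurable_envelope [measurable]: "envelope b r s k l \<in> borel_measurable (stream_space borel)"
  unfolding envelope_def[abs_def] by measurable

lemma envelope_nonneg: "0 \<le> b \<Longrightarrow> 0 \<le> r \<Longrightarrow> 0 \<le> envelope b r s k l t"
  unfolding envelope_def by (auto intro!: add_nonneg_nonneg mult_nonneg_nonneg sum_nonneg)

lemma relative_size_le_envelope:
  assumes good: "\<And>u. good u t" and k: "b * real (length u) \<le> real (length u - k)" "k \<le> length u"
    and b: "0 \<le> b" and r: "0 < r" and s: "1 \<le> s" and ne: "sub u (stake n t) \<noteq> []"
  shows "real (length (sub u (stake n t))) / real n \<le> envelope b r s k (length u) t"
proof -
  let ?S = "\<Sum>u | length u = k. Lam u t powr s"
  define M where "M = 1 / r ^ k + (r ^ k) powr (s - 1) * ?S"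
  have n: "0 < n" using ne by (cases n) auto
  have M: "0 \<le> M" unfolding M_def using r by (intro add_nonneg_nonneg mult_nonneg_nonneg sum_nonneg) auto
  have env: "envelope b r s k (length u) t =
      4 * b * real (length u) * (M + (1 / 4) ^ length u) + indicator (bad b (length u)) t"
    by (simp add: envelope_def M_def)
  have nn: "0 \<le> 4 * b * real (length u) * (M + (1 / 4) ^ length u)"
    using b M by simp
  show ?thesis
  proof (cases "t \<in> bad b (length u)")
    case True
    have "length (sub u (stake n t)) \<le> n" using length_sub_le[of u "stake n t"] by simp
    then have "real (length (sub u (stake n t))) / real n \<le> 1" using n by simp
    then show ?thesis using nn True unfolding env by simp
  next
    case False
    have "Lam (take k u) t powr s \<le> ?S"
      using k by (intro member_le_sum) auto
    then have "Lam (take k u) t \<le> M"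
      unfolding M_def using Lam_lo_bounds(1)[OF good] r s by (intro le_power_sum) auto
    then have "max (Lam (take k u) t) ((1 / 4) ^ length u) \<le> M + (1 / 4) ^ length u"
      using M zero_le_power[of "1 / 4 :: real" "length u"] by (intro max.boundedI) linarith+
    then have "4 * b * real (length u) * max (Lam (take k u) t) ((1 / 4) ^ length u) \<le>
        4 * b * real (length u) * (M + (1 / 4) ^ length u)"
      using b by (intro mult_left_mono) auto
    with relative_size_bound[OF good False refl k(1) ne b] show ?thesis
      unfolding env using False by simp
  qed
qed

text \<open>The threshold \<open>1 / r ^ k\<close> is matched to the moment term, whose mean is
  \<open>(2 * r powr s / (1 + s)) ^ k / r ^ k\<close> and hence at most \<open>1 / r ^ k\<close> by
  \<open>crit\<close>.\<close>

lemma nn_integral_envelope: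
  assumes b: "0 \<le> b" "b \<le> 1" and r: "0 < r" and s: "1 \<le> s" and crit: "2 * r powr s / (1 + s) \<le> 1"
  shows "(\<integral>\<^sup>+t. ennreal (envelope b r s k l t) \<partial>S01) \<le>
    ennreal (4 * real l * (2 / r ^ k + (1 / 4) ^ l) + measure S01 (bad b l))"
proof -
  let ?S = "\<lambda>t. \<Sum>u | length u = k. Lam u t powr s"
  define A where "A = 4 * b * real l * (1 / r ^ k + (1 / 4) ^ l)"
  define B where "B = 4 * b * real l * (r ^ k) powr (s - 1)"
  have AB: "0 \<le> A" "0 \<le> B" using b r by (simp_all add: A_def B_def)
  have "ennreal (envelope b r s k l t) = ennreal A + ennreal B * ennreal (?S t) + indicator (bad b l) t" for t
  proof -
    have "envelope b r s k l t = A + B * ?S t + indicator (bad b l) t"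
      by (simp add: envelope_def A_def B_def algebra_simps)
    moreover have "0 \<le> ?S t" by (intro sum_nonneg) auto
    ultimately show ?thesis using AB
      by (simp add: ennreal_mult ennreal_indicator[symmetric])
  qed
  then have "(\<integral>\<^sup>+t. ennreal (envelope b r s k l t) \<partial>S01) =
      (\<integral>\<^sup>+t. ennreal A + ennreal B * ennreal (?S t) + indicator (bad b l) t \<partial>S01)" by simp
  also have "\<dots> = ennreal A + ennreal B * ennreal ((2 / (1 + s)) ^ k) + ennreal (measure S01 (bad b l))"
    using s S01.emeasure_space_1
    by (simp add: nn_integral_add nn_integral_cmult nn_integral_level_powr S01.emeasure_eq_measure)
  also have "\<dots> = ennreal (A + B * (2 / (1 + s)) ^ k + measure S01 (bad b l))"
    using AB s by (simp add: ennreal_mult)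
  also have "\<dots> \<le> ennreal (4 * real l * (2 / r ^ k + (1 / 4) ^ l) + measure S01 (bad b l))"
  proof (rule ennreal_leI)
    have "(r ^ k) powr (s - 1) * (2 / (1 + s)) ^ k = (2 * r powr s / (1 + s)) ^ k / r ^ k"
    proof -
      have "(r ^ k) powr s = (r powr s) ^ k"
        using r by (simp add: powr_powr mult.commute flip: powr_realpow)
      then show ?thesis using r by (simp add: powr_diff power_mult_distrib power_divide mult_ac)
    qed
    also have "\<dots> \<le> 1 / r ^ k"
      using r s by (intro divide_right_mono power_le_one crit) auto
    finally have "B * (2 / (1 + s)) ^ k \<le> 4 * b * real l * (1 / r ^ k)"
      unfolding B_def using b by (simp only: mult.assoc) (intro mult_left_mono, auto)
    moreover have "b * (4 * real l * (2 / r ^ k + (1 / 4) ^ l)) = A + 4 * b * real l * (1 / r ^ k)"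
      using r by (simp add: A_def field_simps)
    ultimately have "A + B * (2 / (1 + s)) ^ k \<le> b * (4 * real l * (2 / r ^ k + (1 / 4) ^ l))"
      by linarith
    also have "\<dots> \<le> 1 * (4 * real l * (2 / r ^ k + (1 / 4) ^ l))"
      using b r by (intro mult_right_mono) auto
    finally show "A + B * (2 / (1 + s)) ^ k + measure S01 (bad b l) \<le>
        4 * real l * (2 / r ^ k + (1 / 4) ^ l) + measure S01 (bad b l)" by simp
  qed
  finally show ?thesis .
qed

text \<open>Finite mean of the whole weighted series serves twice: almost sure summability gives
  compactness and uniform convergence, and the sum is an integrable majorant for convergence in
  mean.\<close>

theorem envelope_exists:
  assumes \<rho>: "1 \<le> \<rho>" "\<rho> < rho0"
  obtains H :: "nat \<Rightarrow> real stream \<Rightarrow> real"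
  where "\<And>l. H l \<in> borel_measurable (stream_space borel)" "\<And>l t. 0 \<le> H l t"
    "(\<integral>\<^sup>+t. (\<Sum>l. ennreal (\<rho> ^ l * H l t)) \<partial>S01) < \<infinity>"
    "AE t in S01. \<forall>u n. sub u (stake n t) \<noteq> [] \<longrightarrow>
      real (length (sub u (stake n t))) / real n \<le> H (length u) t"
proof -
  obtain r s where r: "\<rho> < r" "r < rho0" and s: "1 \<le> s" "2 * r powr s / (1 + s) \<le> 1"
    using subcritical_exponent[OF \<rho>] by blast
  have r1: "1 < r" using r \<rho> by simp
  \<comment> \<open>Here \<open>r powr q = \<rho>\<close>, so any \<open>\<theta>\<close> strictly
    between \<open>q\<close> and 1 has \<open>\<rho> < r powr \<theta>\<close> while leaving the
    fraction \<open>b = 1 - \<theta>\<close> of the path below the ancestor.\<close>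
  define q where "q = ln \<rho> / ln r"
  define \<theta> where "\<theta> = (q + 1) / 2"
  have lnr: "0 < ln r" "ln \<rho> < ln r" "0 \<le> ln \<rho>" using r r1 \<rho> by simp_all
  have q: "0 \<le> q" "q < 1" "q * ln r = ln \<rho>" using lnr by (simp_all add: q_def)
  then have \<theta>: "0 < \<theta>" "\<theta> < 1" by (simp_all add: \<theta>_def)
  have "\<theta> * ln r = (ln \<rho> + ln r) / 2" by (simp add: \<theta>_def distrib_right flip: q(3))
  then have "exp (ln \<rho>) < exp (\<theta> * ln r)" using lnr(2) by simp
  then have "\<rho> < r powr \<theta>" using \<rho> r1 by (simp add: powr_def)
  define b where "b = 1 - \<theta>"
  define k where "k l = nat \<lfloor>\<theta> * real l\<rfloor>" for l
  have b: "0 < b" "b \<le> 1" using \<theta> by (auto simp: b_def)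
  have k: "real (k l) \<le> \<theta> * real l" "\<theta> * real l - 1 \<le> real (k l)" for l
    using \<theta> unfolding k_def by (auto simp: of_nat_nat)
  have kl: "k l \<le> l" for l
  proof -
    have "\<theta> * real l \<le> 1 * real l" using \<theta> by (intro mult_right_mono) auto
    then show ?thesis using k(1)[of l] by linarith
  qed
  have bk: "b * real l \<le> real (l - k l)" for l
    using k(1)[of l] kl[of l] by (simp add: b_def algebra_simps of_nat_diff)
  define H where "H l = envelope b r s (k l) l" for l
  \<comment> \<open>The first rate comes from the intervals at depth \<open>\<theta> * l\<close>,
    the second from the cutoff scale and the overcrowded samples.\<close>
  define x where "x = max (\<rho> / r powr \<theta>) (\<rho> / 4)"
  have "exp (1 / 2) \<le> (2 :: real)" using real_exp_bound_lemma[of "1 / 2"] by simp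
  then have "\<rho> < 4" using \<rho> rho0_root(2) by linarith
  moreover have "0 < r powr \<theta>" using r1 by simp
  ultimately have x: "0 \<le> x" "x < 1"
    using \<rho> \<open>\<rho> < r powr \<theta>\<close> by (simp_all add: x_def le_max_iff_disj)
  have xr: "\<rho> ^ l / r ^ k l \<le> r * x ^ l" for l
  proof -
    have "(r powr \<theta>) ^ l / r = r powr (\<theta> * real l - 1)"
      using r1 by (simp add: powr_diff powr_powr flip: powr_realpow)
    also have "\<dots> \<le> r powr real (k l)" using r1 k(2)[of l] by (intro powr_mono) auto
    finally have le: "(r powr \<theta>) ^ l / r \<le> r ^ k l" using r1 by (simp add: powr_realpow)
    have "\<rho> ^ l / r ^ k l \<le> \<rho> ^ l / ((r powr \<theta>) ^ l / r)"
      using le r1 \<rho> by (intro divide_left_mono) auto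
    also have "\<dots> = r * (\<rho> / r powr \<theta>) ^ l" by (simp add: power_divide)
    also have "\<dots> \<le> r * x ^ l"
      using r1 \<rho> by (intro mult_left_mono power_mono) (auto simp: x_def)
    finally show ?thesis .
  qed
  have x4: "\<rho> ^ l * (1 / 4) ^ l \<le> x ^ l" for l
  proof -
    have "\<rho> ^ l * (1 / 4) ^ l = (\<rho> / 4) ^ l" by (simp add: power_divide)
    also have "\<dots> \<le> x ^ l" using \<rho> by (intro power_mono) (auto simp: x_def)
    finally show ?thesis .
  qed
  define c where "c l = \<rho> ^ l * (4 * real l * (2 / r ^ k l + (1 / 4) ^ l) + measure S01 (bad b l))" for l
  have c0: "0 \<le> c l" for l using \<rho> r1 by (simp add: c_def)
  obtain L where L: "\<And>l. L \<le> l \<Longrightarrow> measure S01 (bad b l) \<le> 4 * (1 / 4) ^ l"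
    using measure_bad[OF b(1)] by blast
  have "summable c"
  proof (rule summable_comparison_test'[where N = L])
    show "summable (\<lambda>l. (8 * r + 8) * (real (Suc l) * x ^ l))"
      by (intro summable_mult summable_mult_geometric x)
    fix l assume "L \<le> l"
    have "c l \<le> \<rho> ^ l * (4 * real l * (2 / r ^ k l + (1 / 4) ^ l) + 4 * (1 / 4) ^ l)"
      unfolding c_def using L[OF \<open>L \<le> l\<close>] \<rho> by (intro mult_left_mono) auto
    also have "\<dots> = 8 * real l * (\<rho> ^ l / r ^ k l) + (4 * real l + 4) * (\<rho> ^ l * (1 / 4) ^ l)"
      by (simp add: algebra_simps)
    also have "\<dots> \<le> 8 * real (Suc l) * (r * x ^ l) + (8 * real (Suc l)) * x ^ l"
      using xr[of l] x4[of l] x r1 \<rho> by (intro add_mono mult_mono) auto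
    also have "\<dots> = (8 * r + 8) * (real (Suc l) * x ^ l)" by (simp add: algebra_simps)
    finally show "norm (c l) \<le> (8 * r + 8) * (real (Suc l) * x ^ l)" using c0[of l] by simp
  qed
  have meas[measurable]: "H l \<in> borel_measurable (stream_space borel)" for l
    unfolding H_def by measurable
  have H0: "0 \<le> H l t" for l t
    unfolding H_def using b r1 by (intro envelope_nonneg) auto
  have "(\<integral>\<^sup>+t. (\<Sum>l. ennreal (\<rho> ^ l * H l t)) \<partial>S01) = (\<Sum>l. \<integral>\<^sup>+t. ennreal (\<rho> ^ l * H l t) \<partial>S01)"
    by (rule nn_integral_suminf) measurable
  also have "\<dots> \<le> (\<Sum>l. ennreal (c l))"
  proof (rule suminf_le)
    fix l
    have "(\<integral>\<^sup>+t. ennreal (\<rho> ^ l * H l t) \<partial>S01) = ennreal (\<rho> ^ l) * (\<integral>\<^sup>+t. ennreal (H l t) \<partial>S01)"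
      using \<rho> H0 by (simp add: ennreal_mult nn_integral_cmult)
    also have "\<dots> \<le> ennreal (\<rho> ^ l) * ennreal (4 * real l * (2 / r ^ k l + (1 / 4) ^ l) + measure S01 (bad b l))"
      unfolding H_def using b r1 s by (intro mult_left_mono nn_integral_envelope) auto
    also have "\<dots> = ennreal (c l)" unfolding c_def using \<rho> r1 by (simp add: ennreal_mult)
    finally show "(\<integral>\<^sup>+t. ennreal (\<rho> ^ l * H l t) \<partial>S01) \<le> ennreal (c l)" .
  qed auto
  also have "\<dots> = ennreal (\<Sum>l. c l)"
    using c0 \<open>summable c\<close> by (rule suminf_ennreal2)
  also have "\<dots> < \<infinity>" by simp
  finally have fin: "(\<integral>\<^sup>+t. (\<Sum>l. ennreal (\<rho> ^ l * H l t)) \<partial>S01) < \<infinity>" .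
  have "AE t in S01. \<forall>u. good u t" by (simp add: AE_all_countable AE_good)
  then have "AE t in S01. \<forall>u n. sub u (stake n t) \<noteq> [] \<longrightarrow>
      real (length (sub u (stake n t))) / real n \<le> H (length u) t"
  proof eventually_elim
    case (elim t)
    then show ?case
      unfolding H_def using bk kl b r1 s by (auto intro!: relative_size_le_envelope)
  qed
  with meas H0 fin show thesis by (rule that)
qed

section \<open>Limits of uniform distributions on trees\<close>

text \<open>The meet is a proper prefix of \<open>u\<close>, and \<open>x\<close> lies at least one
  level below it; half the difference of these two levels survives in the metric. So the points
  above \<open>u\<close> form a clopen set.\<close>

lemma dist_xnode_separated:
  assumes "xprefix u x" "\<not> xprefix u y"
  shows "(1 / 2) ^ length u / 4 \<le> dist x y"
proof -
  have "x \<noteq> y" using assms by auto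
  then obtain w where w: "xmeet x y = Node w" "xprefix w x" "xprefix w y"
    by (rule xmeet_props)
  have "length w < length u"
  proof (rule ccontr)
    assume "\<not> length w < length u"
    then have "prefix u w" using xprefix_eq_take[OF assms(1) w(2)] by simp
    then show False using xprefix_mono w(3) assms(2) by blast
  qed
  then have le: "(1 / 2 :: real) ^ length u \<le> (1 / 2) ^ Suc (length w)"
    by (intro power_decreasing) auto
  have "two_pow_neg x \<le> (1 / 2) ^ Suc (length w)"
    using two_pow_neg_xprefix[OF assms(1)] le by linarith
  moreover have "two_pow_neg y \<le> (1 / 2) ^ length w"
    by (rule two_pow_neg_xprefix[OF w(3)])
  ultimately have "(1 / 2) ^ length w / 4 \<le> dist x y"
    by (simp add: dist_xnode_def w(1))
  moreover have "(1 / 2 :: real) ^ length u * 2 \<le> (1 / 2) ^ length w" using le by simp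
  moreover have "0 \<le> (1 / 2 :: real) ^ length u" by simp
  ultimately show ?thesis by linarith
qed

lemma continuous_on_xprefix: "continuous_on UNIV (\<lambda>x. of_bool (xprefix u x) :: real)"
  unfolding continuous_on_iff
proof (intro ballI allI impI)
  fix x :: xnode and e :: real assume "0 < e"
  show "\<exists>d>0. \<forall>x'\<in>UNIV. dist x' x < d \<longrightarrow> dist (of_bool (xprefix u x') :: real) (of_bool (xprefix u x)) < e"
  proof (intro exI conjI ballI impI)
    show "(0 :: real) < (1 / 2) ^ length u / 4" by simp
    fix x' assume "dist x' x < (1 / 2) ^ length u / 4"
    then have "xprefix u x' \<longleftrightarrow> xprefix u x"
      using dist_xnode_separated[of u x x'] dist_xnode_separated[of u x' x] by (auto simp: dist_commute)
    then show "dist (of_bool (xprefix u x') :: real) (of_bool (xprefix u x)) < e" using \<open>0 < e\<close> by simp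
  qed
qed

text \<open>A point above \<open>v\<close> is \<open>v\<close> itself iff it is above neither child
  of \<open>v\<close>. Hence single nodes have continuous indicators too.\<close>

lemma of_bool_Node:
  "of_bool (x = Node v) =
    of_bool (xprefix v x) * (1 - of_bool (xprefix (v @ [False]) x)) * (1 - of_bool (xprefix (v @ [True]) x) :: real)"
proof (cases x)
  case (Node y)
  show ?thesis
  proof (cases "prefix v y")
    case True
    then obtain z where z: "y = v @ z" by (rule prefixE)
    show ?thesis
    proof (cases z)
      case (Cons b z')
      then show ?thesis using z Node by (cases b) auto
    qed (use z Node in auto)
  qed (use Node in auto)
next
  case (End s)
  have "map s [0..<Suc (length v)] = map s [0..<length v] @ [s (length v)]" by simp
  then show ?thesis using End by (cases "s (length v)") auto
qed

lemma continuous_on_Node: "continuous_on UNIV (\<lambda>x. of_bool (x = Node v) :: real)"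
  unfolding of_bool_Node by (intro continuous_intros continuous_on_xprefix)

lemma xprefix_sets [measurable]: "{x. xprefix u x} \<in> sets borel"
proof -
  have "(\<lambda>x. of_bool (xprefix u x) :: real) \<in> borel_measurable borel"
    by (rule borel_measurable_continuous_onI[OF continuous_on_xprefix])
  then have "(\<lambda>x. of_bool (xprefix u x) :: real) -` {1} \<inter> space borel \<in> sets borel"
    by (rule measurable_sets) simp
  also have "(\<lambda>x. of_bool (xprefix u x) :: real) -` {1} \<inter> space borel = {x. xprefix u x}" by auto
  finally show ?thesis .
qed

lemma range_End: "range End = UNIV - (\<Union>v. {Node v})"
proof -
  have "x \<in> range End" if "\<And>v. x \<noteq> Node v" for x using that by (cases x) auto
  then show ?thesis by auto
qed

lemma cylinder_sets [measurable]: "cylinder u \<in> sets borel"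
proof -
  have "cylinder u = {x. xprefix u x} - (\<Union>v. {Node v})"
    unfolding cylinder_def range_End by auto
  also have "\<dots> \<in> sets borel" by (intro sets.Diff xprefix_sets sets.countable_UN) auto
  finally show ?thesis .
qed

text \<open>The indicator of \<open>P\<close> is an admissible test function, and its integral
  against \<open>unif_nodes (x n)\<close> is a relative frequency.\<close>

lemma weak_limit_measure:
  assumes conv: "weakly_converges (\<lambda>n. unif_nodes (x n)) \<nu>" and \<nu>: "sets \<nu> = sets borel" "prob_space \<nu>"
    and x: "\<And>n. finite (x n)" "\<And>n. 1 \<le> n \<Longrightarrow> card (x n) = n"
    and cont: "continuous_on UNIV (\<lambda>y. of_bool (P y) :: real)"
  shows "(\<lambda>n. real (card {v \<in> x n. P (Node v)}) / real n) \<longlonglongrightarrow> measure \<nu> {y. P y}"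
proof -
  interpret \<nu>: prob_space \<nu> by fact
  have "space \<nu> = UNIV" using \<nu>(1) by (metis sets_eq_imp_space_eq space_borel)
  have meas: "(\<lambda>y. of_bool (P y) :: real) \<in> borel_measurable borel"
    by (rule borel_measurable_continuous_onI[OF cont])
  then have "(\<lambda>y. of_bool (P y) :: real) -` {1} \<inter> space borel \<in> sets borel"
    by (rule measurable_sets) simp
  also have "(\<lambda>y. of_bool (P y) :: real) -` {1} \<inter> space borel = {y. P y}" by auto
  finally have P: "{y. P y} \<in> sets borel" .
  have eq: "(\<lambda>y. of_bool (P y) :: real) = indicator {y. P y}" by (auto simp: indicator_def)
  have "(\<lambda>n. \<integral>y. of_bool (P y) \<partial>unif_nodes (x n)) \<longlonglongrightarrow> (\<integral>y. (of_bool (P y) :: real) \<partial>\<nu>)"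
  proof -
    have "bounded (range (\<lambda>y. of_bool (P y) :: real))" by (rule boundedI[where B = 1]) auto
    with conv cont show ?thesis unfolding weakly_converges_def by blast
  qed
  also have "(\<integral>y. (of_bool (P y) :: real) \<partial>\<nu>) = measure \<nu> {y. P y}"
    using P \<nu>(1) \<open>space \<nu> = UNIV\<close> by (simp add: eq)
  finally have lim: "(\<lambda>n. \<integral>y. of_bool (P y) \<partial>unif_nodes (x n)) \<longlonglongrightarrow> measure \<nu> {y. P y}" .
  have "(\<integral>y. of_bool (P y) \<partial>unif_nodes (x n)) = real (card {v \<in> x n. P (Node v)}) / real n" if "1 \<le> n" for n
  proof -
    have ne: "x n \<noteq> {}" using x(2)[OF that] that by auto
    have "(\<integral>y. (of_bool (P y) :: real) \<partial>unif_nodes (x n)) = (\<integral>v. of_bool (P (Node v)) \<partial>measure_pmf (pmf_of_set (x n)))"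
      unfolding unif_nodes_def by (subst integral_distr) (use meas in auto)
    also have "\<dots> = (\<Sum>v\<in>x n. of_bool (P (Node v))) / real (card (x n))"
      using ne x(1) by (rule integral_pmf_of_set)
    also have "(\<Sum>v\<in>x n. of_bool (P (Node v)) :: real) = real (card {v \<in> x n. P (Node v)})"
      using x(1) by (simp add: of_bool_def sum.If_cases Int_def)
    finally show ?thesis using x(2)[OF that] by simp
  qed
  then have "eventually (\<lambda>n. (\<integral>y. of_bool (P y) \<partial>unif_nodes (x n)) = real (card {v \<in> x n. P (Node v)}) / real n) sequentially"
    unfolding eventually_sequentially by blast
  from Lim_transform_eventually[OF lim this] show ?thesis .
qed

text \<open>Weak convergence sees all points above \<open>u\<close>, nodes included. A single node
  has mass at most \<open>1 / n\<close> before the limit, so the countably many nodes are a null set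
  for \<open>\<nu>\<close> and only the infinite paths count.\<close>

lemma weak_limit_cylinder:
  assumes conv: "weakly_converges (\<lambda>n. unif_nodes (x n)) \<nu>" and \<nu>: "sets \<nu> = sets borel" "prob_space \<nu>"
    and x: "\<And>n. finite (x n)" "\<And>n. 1 \<le> n \<Longrightarrow> card (x n) = n"
    and L: "(\<lambda>n. real (subtree_size (x n) u) / real n) \<longlonglongrightarrow> L"
  shows "measure \<nu> (cylinder u) = L"
proof -
  interpret \<nu>: prob_space \<nu> by fact
  have "measure \<nu> {y. y = Node v} = 0" for v
  proof -
    have "(\<lambda>n. real (card {w \<in> x n. Node w = Node v}) / real n) \<longlonglongrightarrow> measure \<nu> {y. y = Node v}"
      by (rule weak_limit_measure[OF conv \<nu> x continuous_on_Node])
    moreover have "(\<lambda>n. real (card {w \<in> x n. Node w = Node v}) / real n) \<longlonglongrightarrow> 0"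
    proof (rule tendsto_sandwich[OF _ _ tendsto_const lim_1_over_n])
      have "card {w \<in> x n. Node w = Node v} \<le> card {v}" for n by (intro card_mono) auto
      then show "eventually (\<lambda>n. real (card {w \<in> x n. Node w = Node v}) / real n \<le> 1 / real n) sequentially"
        by (intro always_eventually allI divide_right_mono) auto
    qed auto
    ultimately show ?thesis by (rule LIMSEQ_unique)
  qed
  then have "{Node v} \<in> null_sets \<nu>" for v
    using \<nu>(1) by (simp add: null_sets_def \<nu>.emeasure_eq_measure)
  then have N: "(\<Union>v. {Node v}) \<in> null_sets \<nu>" by (intro null_sets_UN) auto
  have "cylinder u = {y. xprefix u y} - (\<Union>v. {Node v})"
    unfolding cylinder_def range_End by auto
  then have "measure \<nu> (cylinder u) = measure \<nu> {y. xprefix u y}"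
    using N xprefix_sets[of u] \<nu>(1) by (simp add: measure_Diff_null_set)
  moreover have "(\<lambda>n. real (subtree_size (x n) u) / real n) \<longlonglongrightarrow> measure \<nu> {y. xprefix u y}"
    using weak_limit_measure[OF conv \<nu> x continuous_on_xprefix[of u]] by (simp add: subtree_size_def)
  ultimately show ?thesis using LIMSEQ_unique[OF L] by metis
qed

section \<open>Tree metrics with summable level weights\<close>

text \<open>Prefixes of the same \<open>u\<close> have distinct lengths, so each level contributes
  at most one term.\<close>

lemma sum_prefixes_le:
  fixes G :: "nat \<Rightarrow> real"
  assumes g: "\<And>a. a \<in> A \<Longrightarrow> g a \<le> G (length a)" and G: "\<And>l. 0 \<le> G l" "summable G"
    and A: "A \<subseteq> {a. prefix a u}" "\<And>a. a \<in> A \<Longrightarrow> N \<le> length a"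
  shows "sum g A \<le> (\<Sum>l. G (l + N))"
proof -
  have fin: "finite A" using A(1) finite_prefixes finite_subset by blast
  have inj: "inj_on (\<lambda>a. length a - N) A"
  proof (rule inj_onI)
    fix a b assume ab: "a \<in> A" "b \<in> A" "length a - N = length b - N"
    then have "length a = length b" using A(2)[of a] A(2)[of b] by simp
    moreover have "a = take (length a) u" "b = take (length b) u"
      using ab A(1) by (auto simp: prefix_def)
    ultimately show "a = b" by simp
  qed
  have "sum g A \<le> (\<Sum>a\<in>A. G ((length a - N) + N))"
    using g A(2) by (intro sum_mono) simp
  also have "\<dots> = (\<Sum>l\<in>(\<lambda>a. length a - N) ` A. G (l + N))"
    using inj by (simp add: sum.reindex)
  also have "\<dots> \<le> (\<Sum>l. G (l + N))"
    using fin G by (intro sum_le_suminf) (auto simp: summable_iff_shift)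
  finally show ?thesis .
qed

text \<open>The path has two branches, each with at most one edge per level; hence the factor
  2.\<close>

lemma tree_dist_diff_le:
  fixes G :: "nat \<Rightarrow> real"
  assumes g: "\<And>a. a \<noteq> [] \<Longrightarrow> prefix a u \<or> prefix a v \<Longrightarrow> \<bar>w a - w' a\<bar> \<le> G (length a)"
    and G: "\<And>l. 0 \<le> G l" "summable G"
  shows "\<bar>tree_dist w u v - tree_dist w' u v\<bar> \<le> 2 * (\<Sum>l. G l)"
proof -
  let ?E = "{a. a \<noteq> [] \<and> prefix a u \<noteq> prefix a v}"
  let ?U = "{a. a \<noteq> [] \<and> prefix a u}" and ?V = "{a. a \<noteq> [] \<and> prefix a v}"
  have fin: "finite ?U" "finite ?V"
    by (rule finite_subset[OF _ finite_prefixes]; auto)+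
  have "\<bar>tree_dist w u v - tree_dist w' u v\<bar> \<le> (\<Sum>a\<in>?E. \<bar>w a - w' a\<bar>)"
    unfolding tree_dist_def sum_subtractf[symmetric] by (rule sum_abs)
  also have "\<dots> \<le> (\<Sum>a\<in>?U \<union> ?V. \<bar>w a - w' a\<bar>)"
    using fin by (intro sum_mono2) auto
  also have "\<dots> \<le> (\<Sum>a\<in>?U. \<bar>w a - w' a\<bar>) + (\<Sum>a\<in>?V. \<bar>w a - w' a\<bar>)"
    using fin by (simp add: sum_Un sum_nonneg)
  also have "\<dots> \<le> (\<Sum>l. G (l + 0)) + (\<Sum>l. G (l + 0))"
    by (intro add_mono sum_prefixes_le G) (use g in auto)
  finally show ?thesis by simp
qed

lemma Metric_space_tree_dist:
  assumes pos: "\<And>u. u \<noteq> [] \<Longrightarrow> w u > 0"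
  shows "Metric_space UNIV (tree_dist w)"
proof
  have nn: "0 \<le> sum w {a. a \<noteq> [] \<and> Q a}" for Q
    using pos by (intro sum_nonneg) (auto intro: less_imp_le)
  show "0 \<le> tree_dist w x y" for x y unfolding tree_dist_def by (rule nn)
  show "tree_dist w x y = tree_dist w y x" for x y unfolding tree_dist_def by (metis (no_types, lifting))
  show "tree_dist w x y = 0 \<longleftrightarrow> x = y" for x y
  proof
    assume "tree_dist w x y = 0"
    then have "{a. a \<noteq> [] \<and> prefix a x \<noteq> prefix a y} = {}"
      unfolding tree_dist_def using pos finite_path_edges[of x y]
      by (subst (asm) sum_nonneg_eq_0_iff) (auto intro: less_imp_le, (metis less_irrefl)+)
    then have "prefix x y" "prefix y x" by (cases "x = []"; cases "y = []"; force)+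
    then show "x = y" by (rule prefix_order.antisym)
  qed (simp add: tree_dist_def)
  show "tree_dist w x z \<le> tree_dist w x y + tree_dist w y z" for x y z
  proof -
    let ?A = "{a. a \<noteq> [] \<and> prefix a x \<noteq> prefix a y}" and ?B = "{a. a \<noteq> [] \<and> prefix a y \<noteq> prefix a z}"
    have "tree_dist w x z \<le> sum w (?A \<union> ?B)"
      unfolding tree_dist_def using finite_path_edges[of x y] finite_path_edges[of y z] pos
      by (intro sum_mono2) (auto intro: less_imp_le)
    also have "\<dots> = sum w ?A + sum w ?B - sum w (?A \<inter> ?B)"
      by (rule sum_Un[OF finite_path_edges finite_path_edges])
    finally have "tree_dist w x z \<le> sum w ?A + sum w ?B - sum w (?A \<inter> ?B)" .
    moreover have "0 \<le> sum w (?A \<inter> ?B)" using pos by (intro sum_nonneg) (auto intro: less_imp_le)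
    ultimately show ?thesis by (simp add: tree_dist_def[of w x y] tree_dist_def[of w y z])
  qed
qed

text \<open>Cutting a node off at depth \<open>N\<close> moves it by at most a tail of
  \<open>G\<close>, so the finitely many nodes of depth at most \<open>N\<close> form a net. Total
  boundedness passes to the closure, and completeness yields compactness.\<close>

lemma compact_completion_tree_dist:
  fixes G :: "nat \<Rightarrow> real"
  assumes pos: "\<And>u. u \<noteq> [] \<Longrightarrow> w u > 0" and w: "\<And>u. w u \<le> G (length u)"
    and G: "\<And>l. 0 \<le> G l" "summable G"
  shows "compact_completion UNIV (tree_dist w)"
proof -
  have ms: "Metric_space UNIV (tree_dist w)" by (rule Metric_space_tree_dist[OF pos])
  then obtain m :: "(node \<Rightarrow> real) metric" and \<iota> where comp: "is_metric_completion UNIV (tree_dist w) m \<iota>"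
    using is_metric_completion_exists by blast
  then have m: "mcomplete_of m" "\<And>x. \<iota> x \<in> mspace m" "\<And>x y. mdist m (\<iota> x) (\<iota> y) = tree_dist w x y"
    "mtopology_of m closure_of range \<iota> = mspace m"
    by (auto simp: is_metric_completion_def Pi_iff)
  interpret m: Metric_space "mspace m" "mdist m" by (rule Metric_space_mspace_mdist)
  have "m.mtotally_bounded (range \<iota>)"
    unfolding m.mtotally_bounded_def
  proof (intro allI impI)
    fix e :: real assume "0 < e"
    have "(\<lambda>N. \<Sum>l. G (l + N)) \<longlonglongrightarrow> 0"
      using suminf_exist_split2[OF G(2)] by (simp add: add.commute)
    then have "eventually (\<lambda>N. (\<Sum>l. G (l + N)) < e) sequentially"
      using \<open>0 < e\<close> by (rule order_tendstoD(2))
    then obtain N where N: "(\<Sum>l. G (l + N)) < e" by (auto simp: eventually_sequentially)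
    define K where "K = {u :: node. length u \<le> N}"
    have "finite K" unfolding K_def using finite_lists_length_le[of "UNIV :: bool set" N] by simp
    have "\<iota> v \<in> (\<Union>x\<in>\<iota> ` K. m.mball x e)" for v
    proof -
      have K: "take N v \<in> K" by (simp add: K_def)
      have "tree_dist w (take N v) v \<le> (\<Sum>l. G (l + N))"
        unfolding tree_dist_def
      proof (rule sum_prefixes_le[OF w G])
        show "{a. a \<noteq> [] \<and> prefix a (take N v) \<noteq> prefix a v} \<subseteq> {a. prefix a v}"
          using take_is_prefix[of N v] by (auto intro: prefix_order.trans)
        fix a assume "a \<in> {a. a \<noteq> [] \<and> prefix a (take N v) \<noteq> prefix a v}"
        then have a: "prefix a v" "\<not> prefix a (take N v)"
          using take_is_prefix[of N v] by (auto intro: prefix_order.trans)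
        show "N \<le> length a"
        proof (rule ccontr)
          assume "\<not> N \<le> length a"
          then have "prefix a (take N v)" using a(1) by (auto simp: prefix_def)
          with a(2) show False by simp
        qed
      qed
      then have "\<iota> v \<in> m.mball (\<iota> (take N v)) e" using N m by simp
      then show ?thesis using K by blast
    qed
    then show "\<exists>K. finite K \<and> K \<subseteq> range \<iota> \<and> range \<iota> \<subseteq> (\<Union>x\<in>K. m.mball x e)"
      using \<open>finite K\<close> by (intro exI[of _ "\<iota> ` K"]) auto
  qed
  from m.mtotally_bounded_closure_of[OF this] have "m.mtotally_bounded (mspace m)"
    using m(4) by (simp add: mtopology_of_def)
  then have "compact_space (mtopology_of m)"
    using m(1) m.compact_space_eq_mcomplete_mtotally_bounded by (simp add: mtopology_of_def mcomplete_of_def)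
  with comp show ?thesis unfolding compact_completion_def by blast
qed

section \<open>Convergence of the tree metrics\<close>

lemma stake_to_stream: "stake n (to_stream f) = map f [0..<n]"
  by (rule nth_equalityI) (simp_all add: to_stream_def)

lemma distr_to_stream:
  fixes M :: "'w measure" and U :: "nat \<Rightarrow> 'w \<Rightarrow> real"
  assumes M: "prob_space M" and ind: "prob_space.indep_vars M (\<lambda>_. borel) U UNIV"
    and unif: "\<And>i. distr M borel (U i) = uniform_measure lborel {0<..<1}"
  shows "(\<lambda>\<omega>. to_stream (\<lambda>i. U i \<omega>)) \<in> measurable M S01"
    "distr M S01 (\<lambda>\<omega>. to_stream (\<lambda>i. U i \<omega>)) = S01"
proof -
  interpret M: prob_space M by fact
  have U[measurable]: "U i \<in> borel_measurable M" for i
    using ind by (simp add: M.indep_vars_def)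
  have seq: "(\<lambda>\<omega> i. U i \<omega>) \<in> measurable M (Pi\<^sub>M UNIV (\<lambda>_. borel))"
    by (rule measurable_PiM_single') auto
  have to: "to_stream \<in> measurable (Pi\<^sub>M UNIV (\<lambda>_. borel)) (stream_space borel)"
    by (rule measurable_to_stream)
  have "(\<lambda>\<omega>. to_stream (\<lambda>i. U i \<omega>)) \<in> measurable M (stream_space borel)"
    by (rule measurable_compose[OF seq to])
  then show T: "(\<lambda>\<omega>. to_stream (\<lambda>i. U i \<omega>)) \<in> measurable M S01"
    by (simp cong: measurable_cong_sets)
  have "distr M (Pi\<^sub>M UNIV (\<lambda>_. borel)) (\<lambda>\<omega> i. U i \<omega>) = Pi\<^sub>M UNIV (\<lambda>i. distr M borel (U i))"
    using M.indep_vars_iff_distr_eq_PiM[of UNIV U "\<lambda>_. borel"] ind by (simp add: restrict_UNIV)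
  also have "\<dots> = Pi\<^sub>M UNIV (\<lambda>_. U01)" by (simp add: unif U01_def)
  finally have D: "distr M (Pi\<^sub>M UNIV (\<lambda>_. borel)) (\<lambda>\<omega> i. U i \<omega>) = Pi\<^sub>M UNIV (\<lambda>_. U01)" .
  have to': "to_stream \<in> measurable (Pi\<^sub>M UNIV (\<lambda>_. borel)) S01"
    using to by (simp cong: measurable_cong_sets)
  have "distr M S01 (\<lambda>\<omega>. to_stream (\<lambda>i. U i \<omega>)) =
      distr (distr M (Pi\<^sub>M UNIV (\<lambda>_. borel)) (\<lambda>\<omega> i. U i \<omega>)) S01 to_stream"
    using seq to' by (simp add: distr_distr o_def)
  also have "\<dots> = S01" unfolding D by (rule stream_space_eq_distr[symmetric])
  finally show "distr M S01 (\<lambda>\<omega>. to_stream (\<lambda>i. U i \<omega>)) = S01" .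
qed

lemma subtree_dist_bounded:
  assumes "finite x" "0 \<le> \<rho>"
  shows "\<exists>C. \<forall>u v. \<bar>subtree_dist \<rho> x u v\<bar> \<le> C"
proof -
  define w where "w = (\<lambda>u. if u \<in> x then \<rho> ^ length u * real (subtree_size x u) / real (subtree_size x []) else 0)"
  have w: "0 \<le> w a" for a using assms by (simp add: w_def)
  have "\<bar>subtree_dist \<rho> x u v\<bar> \<le> sum w x" for u v
  proof -
    let ?E = "{a. a \<noteq> [] \<and> prefix a u \<noteq> prefix a v}"
    have e: "subtree_dist \<rho> x u v = sum w ?E" by (simp only: subtree_dist_def tree_dist_def w_def)
    also have "\<dots> = sum w (?E \<inter> x)"
      using finite_path_edges[of u v] by (intro sum.mono_neutral_right) (auto simp: w_def)
    also have "\<dots> \<le> sum w x" using assms w by (intro sum_mono2) auto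
    finally have "subtree_dist \<rho> x u v \<le> sum w x" .
    moreover have "0 \<le> subtree_dist \<rho> x u v"
      unfolding e by (intro sum_nonneg w)
    ultimately show ?thesis by simp
  qed
  then show ?thesis by blast
qed

text \<open>A single edge value on the path from the root already exceeds the bound.\<close>

lemma limit_dist_unbounded:
  assumes eq: "\<And>u. measure \<mu> (cylinder u) = Lam u t"
    and peaks: "\<And>c. \<exists>u. c \<le> r ^ length u * Lam u t" and good: "\<And>u. good u t"
    and r: "0 \<le> r" "r \<le> \<rho>"
  shows "\<exists>u. c \<le> limit_dist \<rho> \<mu> [] u"
proof -
  \<comment> \<open>The level 2 excludes the root, which has value 1 but no edge above it.\<close>
  obtain u where u: "max c 2 \<le> r ^ length u * Lam u t" using peaks by blast
  have pos: "0 < Lam a t" for a using Lam_lo_bounds(1)[OF good] .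
  have "u \<noteq> []" using u by auto
  have "max c 2 \<le> \<rho> ^ length u * Lam u t"
    using u r pos[of u] by (meson less_imp_le mult_right_mono order_trans power_mono)
  also have "\<dots> \<le> limit_dist \<rho> \<mu> [] u"
    unfolding limit_dist_def tree_dist_def eq
  proof (rule member_le_sum)
    show "0 \<le> \<rho> ^ length a * Lam a t" for a using r pos[of a] by simp
    show "finite {a. a \<noteq> [] \<and> prefix a [] \<noteq> prefix a u}" by (rule finite_path_edges)
  qed (use \<open>u \<noteq> []\<close> in auto)
  finally show ?thesis by auto
qed

lemma SUP_ereal_eq_infinity:
  assumes "\<And>c. \<exists>x\<in>A. c \<le> f x"
  shows "(SUP x\<in>A. ereal (f x)) = \<infinity>"
proof (rule ereal_top)
  fix c
  obtain x where "x \<in> A" "c \<le> f x" using assms by blast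
  then show "ereal c \<le> (SUP x\<in>A. ereal (f x))" by (intro SUP_upper2[of x]) auto
qed

lemma tree_dist_convergence:
  fixes t :: "real stream"
  assumes lim: "\<And>u. (\<lambda>n. real (length (sub u (stake n t))) / real n) \<longlonglongrightarrow> Lam u t"
    and H: "\<And>u n. sub u (stake n t) \<noteq> [] \<Longrightarrow> real (length (sub u (stake n t))) / real n \<le> H (length u)"
    and H0: "\<And>l. 0 \<le> H l" and sm: "summable (\<lambda>l. \<rho> ^ l * H l)" and \<rho>: "0 \<le> \<rho>"
    and good: "\<And>u. good u t" and eq: "\<And>u. measure \<mu> (cylinder u) = Lam u t"
    and X: "\<And>n. X n = {u. sub u (stake n t) \<noteq> []}" "\<And>n u. subtree_size (X n) u = length (sub u (stake n t))"
    and D: "\<And>n. D n = (SUP (u, v)\<in>X n \<times> X n. \<bar>subtree_dist \<rho> (X n) u v - limit_dist \<rho> \<mu> u v\<bar>)"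
  shows "\<And>u. Lam u t \<le> H (length u)" "\<And>n. 1 \<le> n \<Longrightarrow> 0 \<le> D n"
    "\<And>n. 1 \<le> n \<Longrightarrow> D n \<le> 2 * (\<Sum>l. \<rho> ^ l * H l)" "D \<longlonglongrightarrow> 0"
proof -
  have pos: "0 < Lam u t" for u using Lam_lo_bounds(1)[OF good] .
  have ne: "eventually (\<lambda>n. sub u (stake n t) \<noteq> []) sequentially" for u
  proof -
    have "eventually (\<lambda>n. 0 < real (length (sub u (stake n t))) / real n) sequentially"
      by (rule order_tendstoD(1)[OF lim pos])
    then show ?thesis by eventually_elim auto
  qed
  show LamH: "Lam u t \<le> H (length u)" for u
    by (rule tendsto_upperbound[OF lim]) (use ne[of u] H in \<open>auto elim: eventually_mono\<close>)
  \<comment> \<open>The level sum tends to 0 for fixed \<open>l\<close> but is not controlled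
    uniformly in \<open>l\<close>; the minimum with \<open>H l\<close> adds a summable majorant, as
    Tannery's theorem requires.\<close>
  define \<delta> where "\<delta> n l = min (H l) (\<Sum>a | length a = l. \<bar>real (length (sub a (stake n t))) / real n - Lam a t\<bar>)" for n l
  have \<delta>0: "0 \<le> \<delta> n l" for n l using H0 by (simp add: \<delta>_def sum_nonneg)
  have \<delta>H: "\<delta> n l \<le> H l" for n l by (simp add: \<delta>_def)
  have \<delta>lim: "(\<lambda>n. \<delta> n l) \<longlonglongrightarrow> 0" for l
  proof (rule tendsto_sandwich[OF _ _ tendsto_const])
    have "(\<lambda>n. \<Sum>a | length a = l. \<bar>real (length (sub a (stake n t))) / real n - Lam a t\<bar>) \<longlonglongrightarrow> (\<Sum>a :: node | length a = l. \<bar>Lam a t - Lam a t\<bar>)"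
      by (intro tendsto_sum tendsto_rabs tendsto_diff lim tendsto_const)
    then show "(\<lambda>n. \<Sum>a | length a = l. \<bar>real (length (sub a (stake n t))) / real n - Lam a t\<bar>) \<longlonglongrightarrow> 0" by simp
  qed (auto simp: H0 sum_nonneg \<delta>_def)
  have \<delta>sm: "summable (\<lambda>l. \<rho> ^ l * \<delta> n l)" for n
    by (rule summable_comparison_test'[OF sm, where N = 0])
      (use \<rho> \<delta>0 \<delta>H in \<open>auto simp: abs_mult intro!: mult_left_mono\<close>)
  have le: "\<bar>subtree_dist \<rho> (X n) u v - limit_dist \<rho> \<mu> u v\<bar> \<le> 2 * (\<Sum>l. \<rho> ^ l * \<delta> n l)"
    if uv: "u \<in> X n" "v \<in> X n" for n u v
    unfolding subtree_dist_def limit_dist_def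
  proof (rule tree_dist_diff_le)
    fix a assume "a \<noteq> []" "prefix a u \<or> prefix a v"
    then obtain w where "a @ w \<in> X n" using uv by (auto simp: prefix_def)
    then have ne: "sub a (stake n t) \<noteq> []" by (auto simp: X(1) sub_append)
    then have "a \<in> X n" by (simp add: X(1))
    let ?s = "real (length (sub a (stake n t))) / real n"
    have "\<bar>?s - Lam a t\<bar> \<le> \<delta> n (length a)"
    proof -
      have "\<bar>?s - Lam a t\<bar> \<le> H (length a)"
        using H[OF ne] LamH[of a] pos[of a] by (simp add: abs_le_iff) (smt (verit) divide_nonneg_nonneg of_nat_0_le_iff)
      moreover have "\<bar>?s - Lam a t\<bar> \<le> (\<Sum>b | length b = length a. \<bar>real (length (sub b (stake n t))) / real n - Lam b t\<bar>)"
        by (rule member_le_sum[where f = "\<lambda>b. \<bar>real (length (sub b (stake n t))) / real n - Lam b t\<bar>"]) auto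
      ultimately show ?thesis by (simp add: \<delta>_def)
    qed
    then have "\<rho> ^ length a * \<bar>?s - Lam a t\<bar> \<le> \<rho> ^ length a * \<delta> n (length a)"
      using \<rho> by (intro mult_left_mono) auto
    moreover have "\<rho> ^ length a * \<bar>?s - Lam a t\<bar> = \<bar>\<rho> ^ length a * ?s - \<rho> ^ length a * Lam a t\<bar>"
      using \<rho> by (simp only: right_diff_distrib[symmetric] abs_mult) simp
    ultimately show "\<bar>(if a \<in> X n then \<rho> ^ length a * real (subtree_size (X n) a) / real (subtree_size (X n) []) else 0)
        - \<rho> ^ length a * measure \<mu> (cylinder a)\<bar> \<le> \<rho> ^ length a * \<delta> n (length a)"
      using \<open>a \<in> X n\<close> by (simp add: X(2) eq)
  qed (use \<rho> \<delta>0 \<delta>sm in auto)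
  \<comment> \<open>For \<open>n = 0\<close> the tree is empty and the supremum over the empty set
    says nothing.\<close>
  have root: "[] \<in> X n" if "1 \<le> n" for n using that by (cases n) (auto simp: X(1))
  have D_le: "D n \<le> 2 * (\<Sum>l. \<rho> ^ l * \<delta> n l)" if "1 \<le> n" for n
    unfolding D using root[OF that] le by (intro cSUP_least) auto
  show D_ge: "0 \<le> D n" if "1 \<le> n" for n
    unfolding D
  proof (rule cSUP_upper2[of _ _ "([], [])"])
    show "bdd_above ((\<lambda>(u, v). \<bar>subtree_dist \<rho> (X n) u v - limit_dist \<rho> \<mu> u v\<bar>) ` (X n \<times> X n))"
      by (rule bdd_aboveI2[where M = "2 * (\<Sum>l. \<rho> ^ l * \<delta> n l)"]) (auto intro: le)
  qed (use root[OF that] in auto)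
  have "(\<Sum>l. \<rho> ^ l * \<delta> n l) \<le> (\<Sum>l. \<rho> ^ l * H l)" for n
    using \<rho> \<delta>H by (intro suminf_le \<delta>sm sm mult_left_mono) auto
  then show "D n \<le> 2 * (\<Sum>l. \<rho> ^ l * H l)" if "1 \<le> n" for n
    using D_le[OF that] by (meson mult_left_mono order_trans zero_le_numeral)
  have "(\<lambda>n. \<Sum>l. \<rho> ^ l * \<delta> n l) \<longlonglongrightarrow> (\<Sum>l. 0)"
  proof (rule tannerys_theorem[THEN conjunct2, THEN conjunct2])
    show "(\<lambda>n. \<rho> ^ l * \<delta> n l) \<longlonglongrightarrow> 0" for l by (rule tendsto_mult_right_zero[OF \<delta>lim])
    show "eventually (\<lambda>(l, n). norm (\<rho> ^ l * \<delta> n l) \<le> \<rho> ^ l * H l) (sequentially \<times>\<^sub>F sequentially)"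
      using \<rho> \<delta>0 \<delta>H by (intro always_eventually) (auto simp: abs_mult intro!: mult_left_mono)
  qed (use sm in auto)
  then have lim2: "(\<lambda>n. 2 * (\<Sum>l. \<rho> ^ l * \<delta> n l)) \<longlonglongrightarrow> 0" by (auto intro: tendsto_mult_right_zero)
  show "D \<longlonglongrightarrow> 0"
    by (rule tendsto_sandwich[OF _ _ tendsto_const lim2])
      (use D_le D_ge in \<open>auto simp: eventually_sequentially\<close>)
qed

theorem theorem3:
  fixes M :: "'w measure" and U :: "nat \<Rightarrow> 'w \<Rightarrow> real"
    and X :: "nat \<Rightarrow> 'w \<Rightarrow> node set" and Xinf :: "'w \<Rightarrow> xnode measure" and \<rho> :: real
  assumes "prob_space M"
    and "prob_space.indep_vars M (\<lambda>_. borel) U UNIV"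
    and "\<And>i. distr M borel (U i) = uniform_measure lborel {0<..<1}"
    and "\<And>n \<omega>. X n \<omega> = bst_tree (\<lambda>i. U i \<omega>) n"
    and "Xinf \<in> measurable M (prob_algebra borel)"
    and "AE \<omega> in M. weakly_converges (\<lambda>n. unif_nodes (X n \<omega>)) (Xinf \<omega>)"
    and "\<rho> \<ge> 1"
  shows
    "(\<rho> < rho0 \<longrightarrow>
        (AE \<omega> in M. compact_completion UNIV (limit_dist \<rho> (Xinf \<omega>)))) \<and>
     (\<rho> > rho0 \<longrightarrow>
        (AE \<omega> in M. (SUP (u, v)\<in>UNIV. ereal (limit_dist \<rho> (Xinf \<omega>) u v)) = \<infinity>)) \<and>
     (\<rho> < rho0 \<longrightarrow>
        (let D = (\<lambda>n \<omega>. SUP (u, v)\<in>X n \<omega> \<times> X n \<omega>.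
                    \<bar>subtree_dist \<rho> (X n \<omega>) u v - limit_dist \<rho> (Xinf \<omega>) u v\<bar>) in
          (AE \<omega> in M. (\<lambda>n. D n \<omega>) \<longlonglongrightarrow> 0) \<and>
          (\<forall>n\<ge>1. integrable M (D n)) \<and>
          (\<lambda>n. \<integral>\<omega>. \<bar>D n \<omega>\<bar> \<partial>M) \<longlonglongrightarrow> 0)) \<and>
     (\<rho> > rho0 \<longrightarrow>
        (AE \<omega> in M. \<forall>n\<ge>1.
          (SUP (u, v)\<in>UNIV.
             ereal \<bar>subtree_dist \<rho> (X n \<omega>) u v - limit_dist \<rho> (Xinf \<omega>) u v\<bar>) = \<infinity>))"
proof -
  define T where "T \<omega> = to_stream (\<lambda>i. U i \<omega>)" for \<omega>
  interpret M: prob_space M by (rule assms(1))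
  have T: "T \<in> measurable M S01" and distr_T: "distr M S01 T = S01"
    unfolding T_def by (rule distr_to_stream[OF assms(1-3)])+
  have T_borel[measurable]: "T \<in> measurable M (stream_space borel)"
    using T by (simp cong: measurable_cong_sets)
  have AE_T: "AE \<omega> in M. P (T \<omega>)" if "AE t in S01. P t" for P
  proof -
    have "AE t in distr M S01 T. P t" using that by (simp only: distr_T)
    then show ?thesis by (rule AE_distrD[OF T])
  qed
  have stake: "map (\<lambda>i. U i \<omega>) [0..<n] = stake n (T \<omega>)" for n \<omega>
    by (simp add: T_def stake_to_stream)
  have X: "X n \<omega> = {u. sub u (stake n (T \<omega>)) \<noteq> []}" for n \<omega>
    by (simp add: assms(4) bst_tree_eq stake)
  have size: "subtree_size (X n \<omega>) u = length (sub u (stake n (T \<omega>)))" for n \<omega> u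
    by (simp add: assms(4) subtree_size_bst stake)
  have fin_X: "finite (X n \<omega>)" for n \<omega> by (simp add: assms(4))
  have card_X: "card (X n \<omega>) = n" for n \<omega> by (simp add: assms(4) card_bst_tree)
  have AE_good: "AE \<omega> in M. \<forall>u. good u (T \<omega>)"
    by (simp add: AE_all_countable AE_T AE_good)
  have AE_lim: "AE \<omega> in M. \<forall>u. (\<lambda>n. real (length (sub u (stake n (T \<omega>)))) / real n) \<longlonglongrightarrow> Lam u (T \<omega>)"
    by (simp add: AE_all_countable AE_T[OF length_sub_limit])
  have AE_eq: "AE \<omega> in M. \<forall>u. measure (Xinf \<omega>) (cylinder u) = Lam u (T \<omega>)"
    using assms(6) AE_lim AE_space
  proof eventually_elim
    case (elim \<omega>)
    have "sets (Xinf \<omega>) = sets borel" "prob_space (Xinf \<omega>)"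
      using measurable_space[OF assms(5) elim(3)] by (auto simp: space_prob_algebra)
    then show ?case
      using weak_limit_cylinder[OF elim(1) _ _ fin_X card_X] elim(2) by (simp add: size)
  qed

  have above: "AE \<omega> in M. \<forall>c. \<exists>u. c \<le> limit_dist \<rho> (Xinf \<omega>) [] u" if \<rho>: "rho0 < \<rho>"
  proof -
    \<comment> \<open>Beyond the second root the supercritical inequality fails for
      \<open>\<rho>\<close> itself. A smaller weight suffices because edge values increase with the
      weight.\<close>
    define r where "r = min \<rho> (exp 1)"
    have "rho0 < exp 1"
      using rho0_root(2) exp_less_cancel_iff[of "1 / 2" "1 :: real"] by linarith
    then have r: "rho0 < r" "r \<le> exp 1" "r \<le> \<rho>" using \<rho> by (auto simp: r_def)
    have "1 < r" "r < 2 * exp 1 * ln r"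
      using r rho0_root(1) above_rho0[OF r(1,2)] by auto
    from AE_T[OF AE_peaks_unbounded[OF this]] AE_good AE_eq show ?thesis
    proof eventually_elim
      case (elim \<omega>)
      then show ?case
        using limit_dist_unbounded[of "Xinf \<omega>" "T \<omega>" r \<rho>] r(3) \<open>1 < r\<close> by simp
    qed
  qed

  have b: "AE \<omega> in M. (SUP (u, v)\<in>UNIV. ereal (limit_dist \<rho> (Xinf \<omega>) u v)) = \<infinity>" if \<rho>: "rho0 < \<rho>"
    using above[OF \<rho>]
  proof eventually_elim
    case (elim \<omega>)
    then have "(SUP x\<in>UNIV. ereal (case x of (u, v) \<Rightarrow> limit_dist \<rho> (Xinf \<omega>) u v)) = \<infinity>"
      by (intro SUP_ereal_eq_infinity) (auto, blast)
    then show ?case by (simp add: case_prod_beta)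
  qed
  have d: "AE \<omega> in M. \<forall>n\<ge>1. (SUP (u, v)\<in>UNIV.
      ereal \<bar>subtree_dist \<rho> (X n \<omega>) u v - limit_dist \<rho> (Xinf \<omega>) u v\<bar>) = \<infinity>" if \<rho>: "rho0 < \<rho>"
    using above[OF \<rho>]
  proof eventually_elim
    case (elim \<omega>)
    show ?case
    proof (intro allI impI)
      fix n :: nat
      \<comment> \<open>The edge weights of a finite tree vanish outside it, so its metric is
        bounded and cannot cancel the unbounded limit metric.\<close>
      obtain C where C: "\<And>u v. \<bar>subtree_dist \<rho> (X n \<omega>) u v\<bar> \<le> C"
        using subtree_dist_bounded[OF fin_X, of \<rho> n \<omega>] assms(7) by auto
      have "\<exists>x\<in>UNIV. c \<le> (case x of (u, v) \<Rightarrow> \<bar>subtree_dist \<rho> (X n \<omega>) u v - limit_dist \<rho> (Xinf \<omega>) u v\<bar>)" for c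
      proof -
        obtain u where "C + c \<le> limit_dist \<rho> (Xinf \<omega>) [] u" using elim by blast
        then have "c \<le> \<bar>subtree_dist \<rho> (X n \<omega>) [] u - limit_dist \<rho> (Xinf \<omega>) [] u\<bar>"
          using C[of "[]" u] by linarith
        then show ?thesis by (intro bexI[of _ "([], u)"]) auto
      qed
      from SUP_ereal_eq_infinity[OF this]
      show "(SUP (u, v)\<in>UNIV. ereal \<bar>subtree_dist \<rho> (X n \<omega>) u v - limit_dist \<rho> (Xinf \<omega>) u v\<bar>) = \<infinity>"
        by (simp add: case_prod_beta)
    qed
  qed

  define D where "D n \<omega> = (SUP (u, v)\<in>X n \<omega> \<times> X n \<omega>. \<bar>subtree_dist \<rho> (X n \<omega>) u v - limit_dist \<rho> (Xinf \<omega>) u v\<bar>)" for n \<omega>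
  have D_meas: "D n \<in> borel_measurable M" for n
  proof -
    have cyl: "(\<lambda>\<omega>. measure (Xinf \<omega>) (cylinder u)) \<in> borel_measurable M" for u
      by (rule measurable_compose[OF assms(5) measurable_measure_prob_algebra[OF cylinder_sets]])
    have ld: "(\<lambda>\<omega>. limit_dist \<rho> (Xinf \<omega>) u v) \<in> borel_measurable M" for u v
      unfolding limit_dist_def tree_dist_def
      by (intro borel_measurable_sum borel_measurable_times borel_measurable_const cyl)
    \<comment> \<open>The tree takes only countably many values, so measurability of the supremum
      can be checked for each fixed finite tree.\<close>
    have cnt: "countable {S :: node set. finite S}"
      using countable_Collect_finite by simp
    have "X n \<in> measurable M (count_space {S. finite S})"
      unfolding measurable_count_space_eq_countable[OF cnt]
    proof (intro conjI ballI)
      fix S :: "node set"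
      have "{\<omega> \<in> space M. \<forall>u. u \<in> S \<longleftrightarrow> 0 < length (sub u (stake n (T \<omega>)))} \<in> sets M"
        by measurable
      also have "{\<omega> \<in> space M. \<forall>u. u \<in> S \<longleftrightarrow> 0 < length (sub u (stake n (T \<omega>)))} = X n -` {S} \<inter> space M"
        by (auto simp: X)
      finally show "X n -` {S} \<inter> space M \<in> sets M" .
    qed (use fin_X in auto)
    then have X_meas: "X n \<in> measurable M (count_space {S. finite S})" .
    define F where "F S \<omega> = (SUP (u, v)\<in>S \<times> S. \<bar>subtree_dist \<rho> S u v - limit_dist \<rho> (Xinf \<omega>) u v\<bar>)" for S \<omega>
    have F: "F S \<in> borel_measurable M" if "S \<in> {S. finite S}" for S
      unfolding F_def[abs_def] case_prod_beta
      using that by (intro borel_measurable_cSUP borel_measurable_abs borel_measurable_diff borel_measurable_const ld)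
        (auto intro: countable_finite)
    have "(\<lambda>\<omega>. F (X n \<omega>) \<omega>) \<in> borel_measurable M"
      by (rule measurable_compose_countable'[where f = F and g = "X n", OF F X_meas cnt])
    then show ?thesis by (simp add: F_def D_def[abs_def])
  qed

  have c: "(AE \<omega> in M. (\<lambda>n. D n \<omega>) \<longlonglongrightarrow> 0) \<and> (\<forall>n\<ge>1. integrable M (D n)) \<and>
      (\<lambda>n. \<integral>\<omega>. \<bar>D n \<omega>\<bar> \<partial>M) \<longlonglongrightarrow> 0"
    and a: "AE \<omega> in M. compact_completion UNIV (limit_dist \<rho> (Xinf \<omega>))" if \<rho>: "\<rho> < rho0"
  proof -
    obtain H where H: "\<And>l. H l \<in> borel_measurable (stream_space borel)" "\<And>l t. 0 \<le> H l t"
      "(\<integral>\<^sup>+t. (\<Sum>l. ennreal (\<rho> ^ l * H l t)) \<partial>S01) < \<infinity>"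
      "AE t in S01. \<forall>u n. sub u (stake n t) \<noteq> [] \<longrightarrow>
        real (length (sub u (stake n t))) / real n \<le> H (length u) t"
      using envelope_exists[OF assms(7) \<rho>] by blast
    note H(1)[measurable]
    \<comment> \<open>Twice this variable dominates all \<open>D n\<close> with
      \<open>n \<ge> 1\<close> simultaneously.\<close>
    define V where "V \<omega> = (\<Sum>l. ennreal (\<rho> ^ l * H l (T \<omega>)))" for \<omega>
    have V_meas[measurable]: "V \<in> borel_measurable M" unfolding V_def[abs_def] by measurable
    have V_int: "(\<integral>\<^sup>+\<omega>. V \<omega> \<partial>M) < \<infinity>"
    proof -
      have "(\<integral>\<^sup>+t. (\<Sum>l. ennreal (\<rho> ^ l * H l t)) \<partial>distr M S01 T) = (\<integral>\<^sup>+\<omega>. V \<omega> \<partial>M)"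
        unfolding V_def by (rule nn_integral_distr[OF T]) measurable
      then show ?thesis using H(3) by (simp add: distr_T)
    qed
    have "AE \<omega> in M. V \<omega> \<noteq> \<infinity>"
      by (rule nn_integral_PInf_AE) (use V_int in auto)
    then have AE_sum: "AE \<omega> in M. summable (\<lambda>l. \<rho> ^ l * H l (T \<omega>)) \<and> enn2real (V \<omega>) = (\<Sum>l. \<rho> ^ l * H l (T \<omega>))"
    proof eventually_elim
      case (elim \<omega>)
      have nn: "0 \<le> \<rho> ^ l * H l (T \<omega>)" for l using H(2) assms(7) by simp
      have "summable (\<lambda>l. \<rho> ^ l * H l (T \<omega>))"
        using elim nn by (intro summable_suminf_not_top) (auto simp: V_def)
      then show ?case using nn by (simp add: V_def suminf_ennreal2 suminf_nonneg)
    qed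
    have V_integrable: "integrable M (\<lambda>\<omega>. 2 * enn2real (V \<omega>))"
    proof (intro integrable_mult_right integrableI_nonneg)
      have "(\<integral>\<^sup>+\<omega>. ennreal (enn2real (V \<omega>)) \<partial>M) \<le> (\<integral>\<^sup>+\<omega>. V \<omega> \<partial>M)"
      proof (rule nn_integral_mono)
        show "ennreal (enn2real (V \<omega>)) \<le> V \<omega>" for \<omega> by (cases "V \<omega>") auto
      qed
      then show "(\<integral>\<^sup>+\<omega>. ennreal (enn2real (V \<omega>)) \<partial>M) < \<infinity>" using V_int by (rule le_less_trans)
    qed auto
    have key: "AE \<omega> in M. (\<forall>u. 0 < Lam u (T \<omega>) \<and> Lam u (T \<omega>) \<le> H (length u) (T \<omega>)) \<and>
        summable (\<lambda>l. \<rho> ^ l * H l (T \<omega>)) \<and>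
        (\<forall>n\<ge>1. 0 \<le> D n \<omega> \<and> D n \<omega> \<le> 2 * enn2real (V \<omega>)) \<and> (\<lambda>n. D n \<omega>) \<longlonglongrightarrow> 0"
      using AE_T[OF H(4)] AE_sum AE_good AE_lim AE_eq
    proof eventually_elim
      case (elim \<omega>)
      note conv = tree_dist_convergence[where t = "T \<omega>" and H = "\<lambda>l. H l (T \<omega>)" and \<rho> = \<rho> and \<mu> = "Xinf \<omega>"
          and X = "\<lambda>n. X n \<omega>" and D = "\<lambda>n. D n \<omega>"]
      have "\<And>u. Lam u (T \<omega>) \<le> H (length u) (T \<omega>)" "\<And>n. 1 \<le> n \<Longrightarrow> 0 \<le> D n \<omega>"
        "\<And>n. 1 \<le> n \<Longrightarrow> D n \<omega> \<le> 2 * (\<Sum>l. \<rho> ^ l * H l (T \<omega>))" "(\<lambda>n. D n \<omega>) \<longlonglongrightarrow> 0"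
        by (rule conv; use elim H(2) assms(7) X size D_def in simp)+
      then show ?case using elim Lam_lo_bounds(1)[of _ "T \<omega>"] by auto
    qed
    show "AE \<omega> in M. compact_completion UNIV (limit_dist \<rho> (Xinf \<omega>))"
      using key AE_eq
    proof eventually_elim
      case (elim \<omega>)
      show ?case
        unfolding limit_dist_def
      proof (rule compact_completion_tree_dist[where G = "\<lambda>l. \<rho> ^ l * H l (T \<omega>)"])
        show "0 < \<rho> ^ length u * measure (Xinf \<omega>) (cylinder u)" for u
          using elim assms(7) by simp
        show "\<rho> ^ length u * measure (Xinf \<omega>) (cylinder u) \<le> \<rho> ^ length u * H (length u) (T \<omega>)" for u
          using elim assms(7) by (simp add: mult_left_mono)
      qed (use elim assms(7) H(2) in auto)
    qed
    have conv0: "AE \<omega> in M. (\<lambda>n. D n \<omega>) \<longlonglongrightarrow> 0" using key by eventually_elim simp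
    have bound: "AE \<omega> in M. norm (D n \<omega>) \<le> 2 * enn2real (V \<omega>)" if "1 \<le> n" for n
      using key by eventually_elim (use that in auto)
    have int: "integrable M (D n)" if "1 \<le> n" for n
      by (rule Bochner_Integration.integrable_bound[OF V_integrable D_meas])
        (use bound[OF that] in eventually_elim, simp)
    \<comment> \<open>The index is shifted because the majorant is available only from
      \<open>n = 1\<close> on.\<close>
    have "(\<lambda>n. \<integral>\<omega>. \<bar>D (Suc n) \<omega>\<bar> \<partial>M) \<longlonglongrightarrow> (\<integral>\<omega>. 0 \<partial>M)"
    proof (rule integral_dominated_convergence)
      show "AE \<omega> in M. (\<lambda>n. \<bar>D (Suc n) \<omega>\<bar>) \<longlonglongrightarrow> 0"
        using conv0 by eventually_elim (auto intro!: tendsto_rabs_zero LIMSEQ_Suc)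
      show "AE \<omega> in M. norm \<bar>D (Suc n) \<omega>\<bar> \<le> 2 * enn2real (V \<omega>)" for n
        using bound[of "Suc n"] by simp
    qed (use D_meas V_integrable in auto)
    then have "(\<lambda>n. \<integral>\<omega>. \<bar>D (Suc n) \<omega>\<bar> \<partial>M) \<longlonglongrightarrow> 0" by simp
    then have "(\<lambda>n. \<integral>\<omega>. \<bar>D n \<omega>\<bar> \<partial>M) \<longlonglongrightarrow> 0" by (rule LIMSEQ_imp_Suc)
    with conv0 int show "(AE \<omega> in M. (\<lambda>n. D n \<omega>) \<longlonglongrightarrow> 0) \<and> (\<forall>n\<ge>1. integrable M (D n)) \<and>
      (\<lambda>n. \<integral>\<omega>. \<bar>D n \<omega>\<bar> \<partial>M) \<longlonglongrightarrow> 0" by blast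
  qed
  have D_eq: "D = (\<lambda>n \<omega>. SUP (u, v)\<in>X n \<omega> \<times> X n \<omega>. \<bar>subtree_dist \<rho> (X n \<omega>) u v - limit_dist \<rho> (Xinf \<omega>) u v\<bar>)"
    by (intro ext) (rule D_def)
  show ?thesis
    unfolding Let_def by (intro conjI impI; (rule a b d c[unfolded D_eq, THEN conjunct1]
      c[unfolded D_eq, THEN conjunct2, THEN conjunct1] c[unfolded D_eq, THEN conjunct2, THEN conjunct2]); assumption)
qed

end
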